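(* Let $n\ge 1$. There exist a numerical constant $c>0$ (independent of $n$ and of the weight), a numerical constant $C>0$, and a constant $C_n>0$ depending only on $n$, such that the following hold for every non-negative, locally integrable function $w$ on $\mathbb R^n$. (1) If $w\in A_\infty^*$, then $$\mathsf C_{\mathsf S,w}(\alpha)-1\le C_n\,(1-\alpha)^{(cn[w]_{A_\infty^*})^{-1}}\quad\text{for all } 1>\alpha>1-e^{-cn[w]_{A_\infty^*}}.$$ (2) (Sharpness) If there exist $B,\beta>1$ and $\gamma>0$ such that $\mathsf C_{\mathsf S,w}(\alpha)-1\le B(1-\alpha)^{1/\beta}$ for all $1>\alpha>1-e^{-\gamma}$, then $w\in A_\infty^*$ and $$[w]_{A_\infty^*}\le C\,\beta\,\bigl(1+\max(\gamma/\beta,\ln B)\bigr).$$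
   Context: Write $w(E)=\int_E w(x)\,dx$ for measurable $E$. The strong maximal operator on $\mathbb R^n$ is $\mathsf M_{\mathrm S}f(x)=\sup_{R\ni x}\frac1{|R|}\int_R|f(y)|\,dy$, with the supremum over all rectangular parallelepipeds $R\subseteq\mathbb R^n$ with sides parallel to the coordinate axes. For a non-negative locally integrable $w$ on $\mathbb R^n$ and $\alpha\in(0,1)$, the weighted sharp Tauberian constant is $$\mathsf C_{\mathsf S,w}(\alpha)=\sup_{E\subset\mathbb R^n,\ 0<w(E)<+\infty}\frac1{w(E)}\,w(\{x\in\mathbb R^n:\ \mathsf M_{\mathrm S}(\mathbf 1_E)(x)>\alpha\}),$$ the supremum being over measurable sets $E$. For a weight (non-negative locally integrable function) $v$ on $\mathbb R$, the Fujii–Wilson constant is $[v]_{A_\infty}=\sup_I\frac1{v(I)}\int_I\mathsf M_1(v\mathbf 1_I)$, the supremum over bounded intervals $I\subset\mathbb R$, where $\mathsf M_1f(x)=\sup_{I\ni x}\frac1{|I|}\int_I|f|$ is the non-centered Hardy–Littlewood maximal operator on $\mathbb R$. For a weight $w$ on $\mathbb R^n$, $1\le j\le n$ and $\bar x^j=(x_1,\dots,x_{j-1},x_{j+1},\dots,x_n)\in\mathbb R^{n-1}$, let $w_{\bar x^j}(t)=w(x_1,\dots,x_{j-1},t,x_{j+1},\dots,x_n)$, $t\in\mathbb R$. Define $[w]_{A_\infty^*}=\sup_{1\le j\le n}\operatorname{ess\,sup}_{\bar x^j\in\mathbb R^{n-1}}[w_{\bar x^j}]_{A_\infty}$. The class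 $A_\infty^*$ of strong Muckenhoupt weights consists of the weights $w$ with $[w]_{A_\infty^*}<+\infty$. *)

theory Defs
  imports "HOL-Probability.Essential_Supremum"
begin

text \<open>
  Since the constants in the theorem are uniform in the dimension, \<open>n\<close> has to be a term and
  not a type. The space of real families indexed by a finite set \<open>J\<close> of naturals is the set
  of extensional functions \<open>J \<rightarrow>\<^sub>E UNIV\<close>; the Euclidean space of dimension \<open>n\<close> is the case
  \<open>J = {..<n}\<close>, with coordinates numbered from \<open>0\<close>. Its topology is the product topology on
  functions.
\<close>

definition leb :: "nat set \<Rightarrow> (nat \<Rightarrow> real) measure" where
  "leb J = completion (Pi\<^sub>M J (\<lambda>_. lborel))"

text \<open>Weights are real-valued; their values outside \<open>{..<n} \<rightarrow>\<^sub>E UNIV\<close> are irrelevant.\<close>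

definition weight :: "nat \<Rightarrow> ((nat \<Rightarrow> real) \<Rightarrow> real) \<Rightarrow> bool" where
  "weight n w \<longleftrightarrow>
     w \<in> borel_measurable (leb {..<n}) \<and>
     (\<forall>x \<in> space (leb {..<n}). 0 \<le> w x) \<and>
     (\<forall>K. compact K \<longrightarrow> K \<subseteq> space (leb {..<n}) \<longrightarrow> set_integrable (leb {..<n}) K w)"

definition wmeas :: "nat \<Rightarrow> ((nat \<Rightarrow> real) \<Rightarrow> real) \<Rightarrow> (nat \<Rightarrow> real) set \<Rightarrow> ennreal" where
  "wmeas n w E = (\<integral>\<^sup>+x\<in>E. ennreal (w x) \<partial>leb {..<n})"

text \<open>
  Rectangles and intervals are taken closed and nondegenerate. This does not affect the
  maximal functions: a rectangle containing \<open>x\<close> is contained, up to a null set, in its closure,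
  which has the same measure and contains \<open>x\<close>.
\<close>

definition rectangles :: "nat \<Rightarrow> (nat \<Rightarrow> real) set set" where
  "rectangles n = {Pi\<^sub>E {..<n} (\<lambda>i. {a i..b i}) | a b. \<forall>i<n. a i < b i}"

definition strong_maximal :: "nat \<Rightarrow> ((nat \<Rightarrow> real) \<Rightarrow> real) \<Rightarrow> (nat \<Rightarrow> real) \<Rightarrow> ennreal" where
  "strong_maximal n f x =
     (SUP R\<in>{R \<in> rectangles n. x \<in> R}.
        (\<integral>\<^sup>+y\<in>R. ennreal \<bar>f y\<bar> \<partial>leb {..<n}) / emeasure (leb {..<n}) R)"

text \<open>If \<open>w\<close> vanishes almost everywhere, the supremum is over the empty set and equals \<open>0\<close>.\<close>

definition tauberian :: "nat \<Rightarrow> ((nat \<Rightarrow> real) \<Rightarrow> real) \<Rightarrow> real \<Rightarrow> ennreal" where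
  "tauberian n w \<alpha> =
     (SUP E\<in>{E \<in> sets (leb {..<n}). 0 < wmeas n w E \<and> wmeas n w E < \<infinity>}.
        wmeas n w {x \<in> space (leb {..<n}). strong_maximal n (indicator E) x > ennreal \<alpha>}
        / wmeas n w E)"

definition maximal1 :: "(real \<Rightarrow> real) \<Rightarrow> real \<Rightarrow> ennreal" where
  "maximal1 f x =
     (SUP (a, b)\<in>{(a, b). a < b \<and> x \<in> {a..b}}.
        (\<integral>\<^sup>+y\<in>{a..b}. ennreal \<bar>f y\<bar> \<partial>lebesgue) / ennreal (b - a))"

text \<open>
  If \<open>v\<close> vanishes almost everywhere on an interval, both integrals below are \<open>0\<close> and the
  quotient is \<open>0 / 0 = 0\<close>, so that such intervals do not contribute to the supremum.
\<close>

definition fujii_wilson :: "(real \<Rightarrow> real) \<Rightarrow> ennreal" where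
  "fujii_wilson v =
     (SUP (a, b)\<in>{(a, b). a < b}.
        (\<integral>\<^sup>+x\<in>{a..b}. maximal1 (\<lambda>t. v t * indicator {a..b} t) x \<partial>lebesgue)
        / (\<integral>\<^sup>+x\<in>{a..b}. ennreal (v x) \<partial>lebesgue))"

text \<open>
  A point \<open>y\<close> of the space indexed by \<open>{..<n} - {j}\<close> is a point with the \<open>j\<close>-th coordinate
  removed, and \<open>y(j := t)\<close> puts \<open>t\<close> back as that coordinate. For \<open>n = 1\<close> the essential supremum
  is over a one-point space of measure \<open>1\<close>. The convention that \<open>esssup\<close> is \<open>top\<close> for
  non-measurable functions is not triggered for weights: almost all slices are locally integrable,
  and for those the suprema in \<open>fujii_wilson\<close> may be restricted to rational endpoints.
\<close>

definition strong_Ainf_const :: "nat \<Rightarrow> ((nat \<Rightarrow> real) \<Rightarrow> real) \<Rightarrow> ennreal" where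
  "strong_Ainf_const n w =
     (SUP j\<in>{..<n}. esssup (leb ({..<n} - {j})) (\<lambda>y. fujii_wilson (\<lambda>t. w (y(j := t)))))"

definition strong_Ainf :: "nat \<Rightarrow> ((nat \<Rightarrow> real) \<Rightarrow> real) set" where
  "strong_Ainf n = {w. weight n w \<and> strong_Ainf_const n w < \<infinity>}"

end

theory Submission
  imports Defs "HOL-Probability.Distribution_Functions"
begin

text \<open>
  Both parts reduce to a statement about one variable: for a weight \<open>v\<close> on the line, a finite
  Fujii--Wilson constant \<open>A\<close> is the same as a power decay
  \<open>v(F) \<le> C (|F| / |I|) powr (1 / (c A)) v(I)\<close> for \<open>F \<subseteq> I\<close>, up to numerical factors.

  From the constant to the decay. Let \<open>F\<close> be a finite union of intervals inside \<open>I\<close> that is much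
  shorter than \<open>I\<close>. Enlarge every interval until \<open>F\<close> fills exactly half of it; call the union
  \<open>F\<^sub>1\<close> and repeat with \<open>F\<^sub>1\<close>. On \<open>F\<^sub>1 - F\<close> the local maximal function dominates the averages of
  \<open>v\<close> over the enlarged intervals, so its integral there is at least a fixed multiple of
  \<open>v(F\<^sub>1) \<ge> v(F)\<close>. One can enlarge about \<open>ln (|I| / |F|)\<close> times before leaving \<open>I\<close>, each step
  contributes the same amount, and the total is at most \<open>A v(I)\<close>; hence \<open>v(F) \<le> v(I) / 4\<close> as soon
  as \<open>|F| \<le> exp (- c A) |I|\<close> (\<open>small_union_quarter\<close>). Iterating this over a cover of \<open>F\<close> gives
  the decay (\<open>small_set_power_decay\<close>).

  From the decay to the constant. The level sets of the local maximal function satisfy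
  \<open>\<lambda> |{M v > \<lambda>}| \<le> 2 v({M v > \<lambda>})\<close>; inserting the decay and summing over dyadic levels bounds the
  integral of \<open>M v\<close> (\<open>integral_local_maximal_le\<close>). The initial levels, where the decay says nothing,
  cost a term proportional to \<open>max \<gamma> (\<beta> ln B)\<close> because each of them contributes the same amount.

  Part (1). If \<open>E\<close> fills more than the proportion \<open>1 - \<delta>\<close> of an interval, the decay bounds the mass
  that the interval has outside \<open>E\<close>; intervals on the line can be selected with overlap at most \<open>2\<close>,
  so the union of all such intervals has mass at most \<open>(1 + 8 \<delta> powr (1 / (c A))) v(E)\<close>
  (\<open>emeasure_density_hull_le\<close>). In dimension \<open>n\<close> this enlargement is applied in each coordinate
  direction in turn with \<open>\<delta> = (1 - \<alpha>) powr (1 / n)\<close>. By Chebyshev's inequality and Fubini's theorem,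
  the \<open>n\<close> enlargements swallow every rectangle of which \<open>E\<close> fills more than the proportion
  \<open>\<alpha> = 1 - \<delta> ^ n\<close> (\<open>dense_box_subset_iterated_hull\<close>), and the mass grows by a factor at most
  \<open>(1 + 8 \<delta> powr (1 / (c A))) ^ n\<close>.

  Part (2). Let \<open>F \<subseteq> I\<close> be small and \<open>S\<close> an open set in the remaining variables. Every point of
  \<open>I \<times> S\<close> lies in a rectangle \<open>I \<times> Q\<close> with \<open>Q \<subseteq> S\<close>, and \<open>(I - F) \<times> S\<close> fills most of it; the Tauberian
  hypothesis for the set \<open>(I - F) \<times> S\<close> therefore bounds \<open>w(F \<times> S)\<close> by a small multiple of
  \<open>w(I \<times> S)\<close> (\<open>weight_thin_cylinder_le\<close>). Outer regularity transfers the inequality from open to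
  measurable \<open>S\<close>, and so to almost every one-dimensional slice (\<open>AE_slice_thin_le\<close>). Countably many
  pairs \<open>F, I\<close> suffice, so almost every slice has the decay and hence a bounded constant.

  Slices are treated as Radon measures \<open>\<mu>\<close> on the line without atoms; absolute continuity is then a
  consequence of the decay. A Lebesgue measurable weight is replaced throughout by a Borel function
  that agrees with it almost everywhere.
\<close>

section \<open>Covering by intervals\<close>

definition cint :: "real \<times> real \<Rightarrow> real set" where
  "cint J = {fst J..snd J}"

abbreviation Cover :: "(real \<times> real) set \<Rightarrow> real set" where
  "Cover \<K> \<equiv> \<Union>K\<in>\<K>. cint K"

abbreviation len :: "real set \<Rightarrow> ennreal" where
  "len \<equiv> emeasure lborel"

lemma cint_simps [simp]: "x \<in> cint J \<longleftrightarrow> fst J \<le> x \<and> x \<le> snd J" "cint J \<in> sets borel"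
  by (auto simp: cint_def)

text \<open>
  The covering lemma that replaces Vitali's: passing to a subfamily loses nothing of the union, so it
  can be used with measures that are not doubling. A subfamily of minimal cardinality with the same
  union has overlap at most \<open>2\<close>.
\<close>

lemma exists_subcover_overlap_2:
  assumes "finite \<K>"
  shows "\<exists>\<J>\<subseteq>\<K>. Cover \<J> = Cover \<K> \<and> (\<forall>x. card {J\<in>\<J>. x \<in> cint J} \<le> 2)"
proof -
  let ?P = "\<lambda>\<J>. \<J> \<subseteq> \<K> \<and> Cover \<J> = Cover \<K>"
  have "?P \<K>" by simp
  from ex_has_least_nat[of ?P, OF this, of card]
  obtain \<J> where J: "?P \<J>" and min: "\<And>\<J>'. ?P \<J>' \<Longrightarrow> card \<J> \<le> card \<J>'" by blast
  have fin: "finite \<J>" using J assms finite_subset by blast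
  have "card {J\<in>\<J>. x \<in> cint J} \<le> 2" for x
  proof (rule ccontr)
    let ?S = "{J\<in>\<J>. x \<in> cint J}"
    assume "\<not> ?thesis"
    then have c: "card ?S > 2" and fS: "finite ?S" using fin by auto
    then have ne: "?S \<noteq> {}" by (metis card.empty not_less_zero)
    \<comment> \<open>Among intervals with a common point, the one reaching furthest left and the one reaching
      furthest right cover all others, so a third one would be redundant.\<close>
    define L where "L = arg_min_on fst ?S"
    define R where "R = arg_min_on (\<lambda>J. - snd J) ?S"
    have L: "L \<in> ?S" "\<And>J. J \<in> ?S \<Longrightarrow> fst L \<le> fst J"
      unfolding L_def using arg_min_if_finite(1)[OF fS ne] arg_min_least[OF fS ne] by blast+
    have R: "R \<in> ?S" "\<And>J. J \<in> ?S \<Longrightarrow> snd J \<le> snd R"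
      unfolding R_def using arg_min_if_finite(1)[OF fS ne] arg_min_least[OF fS ne, of _ "\<lambda>J. - snd J"]
      by (blast, simp del: cint_simps)
    have "card {L,R} \<le> 2" by (simp add: card_insert_if)
    with c have "\<not> ?S \<subseteq> {L,R}" using card_mono[of "{L,R}" ?S] by fastforce
    then obtain J where Jm: "J \<in> ?S" "J \<noteq> L" "J \<noteq> R" by blast
    have "cint J \<subseteq> cint L \<union> cint R"
      using L(1) R(1) L(2)[OF Jm(1)] R(2)[OF Jm(1)] by auto
    then have "(\<Union>I\<in>\<J> - {J}. cint I) = (\<Union>I\<in>\<J>. cint I)"
      using L(1) R(1) Jm by blast
    then have "?P (\<J> - {J})" using J by blast
    from min[OF this] have "card \<J> \<le> card (\<J> - {J})" .
    moreover have "J \<in> \<J>" using Jm by simp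
    ultimately show False using fin by (metis card_Diff1_less linorder_not_less)
  qed
  then show ?thesis using J by blast
qed

lemma sum_measure_overlap_2:
  assumes "finite \<J>" and ov: "\<And>x. card {J\<in>\<J>. x \<in> cint J} \<le> 2"
    and M: "sets M = sets borel" and S: "S \<in> sets borel"
  shows "(\<Sum>J\<in>\<J>. emeasure M (cint J \<inter> S)) \<le> 2 * emeasure M (Cover \<J> \<inter> S)"
proof -
  have m: "\<And>J. cint J \<inter> S \<in> sets M" and mU: "Cover \<J> \<inter> S \<in> sets M"
    unfolding M using S assms(1) by (auto intro!: sets.Int sets.finite_UN simp del: cint_simps(1))
  have "(\<Sum>J\<in>\<J>. emeasure M (cint J \<inter> S)) = (\<Sum>J\<in>\<J>. \<integral>\<^sup>+x. indicator (cint J \<inter> S) x \<partial>M)"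
    using m by (simp del: cint_simps)
  also have "\<dots> = (\<integral>\<^sup>+x. (\<Sum>J\<in>\<J>. indicator (cint J \<inter> S) x) \<partial>M)"
    using m by (intro nn_integral_sum[symmetric]) auto
  also have "\<dots> \<le> (\<integral>\<^sup>+x. 2 * indicator (Cover \<J> \<inter> S) x \<partial>M)"
  proof (rule nn_integral_mono)
    fix x
    have "(\<Sum>J\<in>\<J>. indicator (cint J \<inter> S) x :: ennreal) = of_nat (card {J\<in>\<J>. x \<in> cint J \<inter> S})"
      using assms(1) by (simp add: indicator_def sum.If_cases Int_def del: cint_simps)
    also have "\<dots> \<le> 2 * indicator (Cover \<J> \<inter> S) x"
    proof (cases "x \<in> Cover \<J> \<inter> S")
      case True
      then have "of_nat (card {J\<in>\<J>. x \<in> cint J \<inter> S}) = (of_nat (card {J\<in>\<J>. x \<in> cint J}) :: ennreal)"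
        by (simp del: cint_simps)
      also have "\<dots> \<le> of_nat 2" using ov[of x] by (simp only: of_nat_le_iff)
      finally show ?thesis using True by (simp del: cint_simps)
    next
      case False
      then have "{J\<in>\<J>. x \<in> cint J \<inter> S} = {}" by (auto simp del: cint_simps)
      then show ?thesis by (simp only:) simp
    qed
    finally show "(\<Sum>J\<in>\<J>. indicator (cint J \<inter> S) x :: ennreal) \<le> 2 * indicator (Cover \<J> \<inter> S) x" .
  qed
  also have "\<dots> = 2 * emeasure M (Cover \<J> \<inter> S)"
    using mU by (simp add: nn_integral_cmult del: cint_simps)
  finally show ?thesis .
qed

text \<open>
  The density of \<open>F\<close> in an interval that grows continuously from \<open>K \<subseteq> F\<close> to \<open>{a..b}\<close> starts at \<open>1\<close> and
  ends at no more than \<open>\<eta>\<close>.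
\<close>

lemma interval_of_given_density:
  fixes a b \<eta> :: real
  assumes F: "F \<in> sets borel" "F \<subseteq> {a..b}" and K: "fst K < snd K" "cint K \<subseteq> {a..b}" "cint K \<subseteq> F"
    and \<eta>: "0 < \<eta>" "\<eta> \<le> 1" "len F \<le> ennreal (\<eta> * (b - a))"
  shows "\<exists>J. fst J < snd J \<and> cint K \<subseteq> cint J \<and> cint J \<subseteq> {a..b} \<and>
    len (cint J \<inter> F) = ennreal (\<eta> * (snd J - fst J))"
proof -
  define \<Phi> where "\<Phi> x = measure lborel ({a..x} \<inter> F)" for x
  have fin: "len ({p..q} \<inter> F) \<noteq> \<infinity>" for p q
    using emeasure_mono[of "{p..q} \<inter> F" "{p..q}" lborel] by (auto simp: top_unique emeasure_lborel_Icc_eq split: if_splits)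
  have mm: "measure lborel ({p..q} \<inter> F) \<le> q - p" if "p \<le> q" for p q
    using measure_mono_fmeasurable[of "{p..q} \<inter> F" "{p..q}" lborel] F that by (simp add: fmeasurable_def)
  have diff: "measure lborel ({p..q} \<inter> F) = \<Phi> q - \<Phi> p" if "a \<le> p" "p \<le> q" for p q
  proof -
    have null: "{p} \<in> null_sets lborel" by auto
    have "\<Phi> q = measure lborel (({a..p} \<inter> F) \<union> ({p..q} \<inter> F))"
      unfolding \<Phi>_def using that by (intro arg_cong[where f="measure lborel"]) auto
    also have "\<dots> = measure lborel ({a..p} \<inter> F) + measure lborel ({p..q} \<inter> F)"
    proof (rule measure_Un_AE)
      show "AE x in lborel. x \<notin> {a..p} \<inter> F \<or> x \<notin> {p..q} \<inter> F"
        using AE_not_in[OF null] by eventually_elim auto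
    qed (use F fin in \<open>auto simp: fmeasurable_def less_top\<close>)
    finally show ?thesis by (simp add: \<Phi>_def)
  qed
  have cont: "continuous_on {a..b} \<Phi>"
  proof -
    have "dist (\<Phi> x) (\<Phi> y) \<le> 1 * dist x y" if xy: "x \<in> {a..b}" "y \<in> {a..b}" for x y
    proof -
      have *: "\<bar>\<Phi> u - \<Phi> v\<bar> \<le> u - v" if "a \<le> v" "v \<le> u" for u v
        using mm[of v u] that unfolding diff[OF that] using diff[OF that] measure_nonneg[of lborel "{v..u} \<inter> F"] by linarith
      show ?thesis using *[of x y] *[of y x] xy by (cases "x \<le> y") (auto simp: dist_real_def abs_minus_commute)
    qed
    then have "1-lipschitz_on {a..b} \<Phi>" by (auto simp: lipschitz_on_def)
    then show ?thesis by (rule lipschitz_on_continuous_on)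
  qed
  define p where "p s = fst K + s * (a - fst K)" for s :: real
  define q where "q s = snd K + s * (b - snd K)" for s :: real
  define h where "h s = (\<Phi> (q s) - \<Phi> (p s)) - \<eta> * (q s - p s)" for s
  have Kab: "a \<le> fst K" "snd K \<le> b" using K by (auto simp: subset_eq)
  have pq: "a \<le> p s \<and> p s \<le> fst K \<and> snd K \<le> q s \<and> q s \<le> b" if "s \<in> {0..1}" for s
  proof -
    have "s * (fst K - a) \<le> 1 * (fst K - a)" "s * (b - snd K) \<le> 1 * (b - snd K)"
      using that Kab by (intro mult_right_mono; simp)+
    moreover have "0 \<le> s * (fst K - a)" "0 \<le> s * (b - snd K)" using that Kab by simp_all
    ultimately show ?thesis by (auto simp: p_def q_def algebra_simps)
  qed
  have h0: "h 0 \<ge> 0"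
  proof -
    have "{fst K..snd K} \<inter> F = {fst K..snd K}" using K by (auto simp: cint_def)
    then have "\<Phi> (q 0) - \<Phi> (p 0) = snd K - fst K"
      using diff[of "fst K" "snd K"] Kab K by (simp add: p_def q_def)
    then show ?thesis using \<eta> K by (simp add: h_def p_def q_def)
  qed
  have h1: "h 1 \<le> 0"
  proof -
    have "{a..b} \<inter> F = F" using F by auto
    then have "\<Phi> b - \<Phi> a = measure lborel F"
      using diff[of a b] Kab K by simp
    also have "\<dots> \<le> \<eta> * (b - a)"
      unfolding measure_def using \<eta> Kab K by (intro enn2real_leI) auto
    finally show ?thesis by (simp add: h_def p_def q_def)
  qed
  have qc: "continuous_on {0..1} q" and pc: "continuous_on {0..1} p"
    unfolding q_def p_def by (intro continuous_intros)+
  have "continuous_on {0..1} (\<lambda>s. \<Phi> (q s))" "continuous_on {0..1} (\<lambda>s. \<Phi> (p s))"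
    by (rule continuous_on_compose2[OF cont qc] continuous_on_compose2[OF cont pc];
        use pq K(1) in fastforce)+
  then have "continuous_on {0..1} h"
    unfolding h_def using pc qc by (intro continuous_on_diff continuous_on_mult continuous_on_const)
  from IVT2'[of h 1 0 0, OF h1 h0 _ this] obtain s where s: "s \<in> {0..1}" "h s = 0" by auto
  have "measure lborel ({p s..q s} \<inter> F) = \<eta> * (q s - p s)"
    using diff[of "p s" "q s"] pq[OF s(1)] K s(2) by (simp add: h_def)
  then have "len ({p s..q s} \<inter> F) = ennreal (\<eta> * (q s - p s))"
    using fin[of "p s" "q s"] by (simp add: emeasure_eq_ennreal_measure)
  with pq[OF s(1)] K show ?thesis
    by (intro exI[of _ "(p s, q s)"]) (auto simp: cint_def)
qed

text \<open>
  The enlargement step. The exact density gives \<open>\<eta> |J| = |J \<inter> F|\<close>, and the overlap bound turns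
  the sum of these equations into control of the length of the union.
\<close>

lemma cover_of_given_density:
  fixes a b \<eta> :: real
  assumes \<K>: "finite \<K>" "\<And>K. K \<in> \<K> \<Longrightarrow> fst K < snd K \<and> cint K \<subseteq> {a..b}"
    and F: "F = Cover \<K>"
    and \<eta>: "0 < \<eta>" "\<eta> \<le> 1" "len F \<le> ennreal (\<eta> * (b - a))"
  obtains \<J> where "finite \<J>" "\<And>J. J \<in> \<J> \<Longrightarrow> fst J < snd J \<and> cint J \<subseteq> {a..b}"
    "\<And>J. J \<in> \<J> \<Longrightarrow> len (cint J \<inter> F) = ennreal (\<eta> * (snd J - fst J))"
    "F \<subseteq> Cover \<J>" "\<And>x. card {J\<in>\<J>. x \<in> cint J} \<le> 2"
    "ennreal \<eta> * len (Cover \<J>) \<le> 2 * len F"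
proof -
  have Fb: "F \<in> sets borel" "F \<subseteq> {a..b}" using \<K> F by auto
  have "\<forall>K\<in>\<K>. \<exists>J. fst J < snd J \<and> cint K \<subseteq> cint J \<and> cint J \<subseteq> {a..b} \<and>
    len (cint J \<inter> F) = ennreal (\<eta> * (snd J - fst J))"
    using \<K> F by (intro ballI interval_of_given_density[OF Fb _ _ _ \<eta>]) blast+
  then obtain e where e: "\<And>K. K \<in> \<K> \<Longrightarrow> fst (e K) < snd (e K) \<and> cint K \<subseteq> cint (e K) \<and> cint (e K) \<subseteq> {a..b} \<and>
    len (cint (e K) \<inter> F) = ennreal (\<eta> * (snd (e K) - fst (e K)))"
    by metis
  obtain \<J> where J: "\<J> \<subseteq> e ` \<K>" "Cover \<J> = (\<Union>J\<in>e ` \<K>. cint J)"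
    "\<And>x. card {J\<in>\<J>. x \<in> cint J} \<le> 2"
    using exists_subcover_overlap_2[of "e ` \<K>"] \<K>(1) by blast
  have fJ: "finite \<J>" using J(1) \<K>(1) finite_subset by blast
  have den: "len (cint J \<inter> F) = ennreal (\<eta> * (snd J - fst J))"
    and lt: "fst J < snd J \<and> cint J \<subseteq> {a..b}" if "J \<in> \<J>" for J
    using e J(1) that by (blast, blast)
  have cov: "F \<subseteq> Cover \<J>" unfolding J(2) F using e by blast
  have "ennreal \<eta> * len (Cover \<J>) \<le> ennreal \<eta> * (\<Sum>J\<in>\<J>. len (cint J))"
    using fJ by (intro mult_left_mono emeasure_subadditive_finite) auto
  also have "\<dots> = (\<Sum>J\<in>\<J>. ennreal \<eta> * len (cint J))" by (simp add: sum_distrib_left)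
  also have "\<dots> = (\<Sum>J\<in>\<J>. len (cint J \<inter> F))"
    using lt den \<eta> by (intro sum.cong) (auto simp: cint_def ennreal_mult less_imp_le)
  also have "\<dots> \<le> 2 * len (Cover \<J> \<inter> F)"
    using fJ J(3) Fb by (intro sum_measure_overlap_2) auto
  also have "Cover \<J> \<inter> F = F" using cov by blast
  finally show thesis using that fJ lt den cov J(3) by blast
qed

section \<open>The local maximal function\<close>

text \<open>
  The maximal function of the restriction of \<open>\<mu>\<close> to \<open>{a..b}\<close>; for \<open>\<mu>\<close> with density \<open>v\<close> it is
  \<open>maximal1\<close> of \<open>v\<close> cut off outside \<open>{a..b}\<close>.
\<close>

definition local_maximal :: "real measure \<Rightarrow> real \<Rightarrow> real \<Rightarrow> real \<Rightarrow> ennreal" where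
  "local_maximal \<mu> a b x =
     (SUP (p, q)\<in>{(p, q). p < q \<and> x \<in> {p..q}}. emeasure \<mu> ({a..b} \<inter> {p..q}) / ennreal (q - p))"

text \<open>
  The class of measures to which almost every slice of a weight belongs. Atoms are excluded so that
  endpoints of intervals and degenerate intervals can be neglected.
\<close>

definition diffuse_radon :: "real measure \<Rightarrow> bool" where
  "diffuse_radon \<mu> \<longleftrightarrow> sets \<mu> = sets borel \<and> (\<forall>a b. emeasure \<mu> {a..b} < \<infinity>) \<and> (\<forall>x. emeasure \<mu> {x} = 0)"

definition fw_bound :: "real measure \<Rightarrow> real \<Rightarrow> bool" where
  "fw_bound \<mu> A \<longleftrightarrow> (\<forall>a b. a < b \<longrightarrow>
     (\<integral>\<^sup>+x\<in>{a..b}. local_maximal \<mu> a b x \<partial>lborel) \<le> ennreal A * emeasure \<mu> {a..b})"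

lemma less_divide_ennreal_iff:
  fixes c l :: ennreal and d :: real
  assumes "0 < d"
  shows "l < c / ennreal d \<longleftrightarrow> l * ennreal d < c"
  using assms
  by (cases l c rule: ennreal2_cases)
     (auto simp: divide_ennreal ennreal_mult[symmetric] ennreal_less_iff field_simps ennreal_top_divide
        ennreal_mult_top ennreal_top_mult ennreal_mult_less_top)

text \<open>
  Enlarging an interval slightly does not spoil a strict inequality between its mass and a multiple of
  its length, because the mass can only grow. Hence rational open intervals suffice; this gives at once
  the openness of the level sets and the measurability in parameters.
\<close>

lemma local_maximal_greater_iff:
  assumes \<mu>: "sets \<mu> = sets borel"
  shows "l < local_maximal \<mu> a b x \<longleftrightarrow>
    (\<exists>p\<in>\<rat>. \<exists>q\<in>\<rat>. p < x \<and> x < q \<and> l * ennreal (q - p) < emeasure \<mu> ({a..b} \<inter> {p..q}))"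
proof
  assume "l < local_maximal \<mu> a b x"
  then obtain p q where pq: "p < q" "x \<in> {p..q}" "l < emeasure \<mu> ({a..b} \<inter> {p..q}) / ennreal (q - p)"
    unfolding local_maximal_def by (auto simp: less_SUP_iff)
  let ?c = "emeasure \<mu> ({a..b} \<inter> {p..q})"
  have lc: "l * ennreal (q - p) < ?c" using pq less_divide_ennreal_iff[of "q - p" l ?c] by simp
  have lfin: "l < top" using pq(3) by (rule less_le_trans) simp
  obtain m where m: "q - p < m" "l * ennreal m < ?c"
  proof (cases "l = 0")
    case True then show ?thesis using that[of "q - p + 1"] lc by simp
  next
    case False
    obtain l' where l': "l = ennreal l'" "l' > 0" using lfin False
      by (metis ennreal_cases ennreal_eq_0_iff linorder_not_less not_less_iff_gr_or_eq)
    obtain d where d: "l * ennreal (q - p) < d" "d < ?c" using dense[OF lc] by blast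
    then have dt: "d < top" using less_top_ennreal top.not_eq_extremum by (metis order_less_trans)
    obtain d' where d': "d = ennreal d'" "d' \<ge> 0" using dt by (metis ennreal_cases order_less_irrefl)
    have "l' * (q - p) < d'" using d(1) l' d' pq(1) by (simp add: ennreal_mult[symmetric] ennreal_less_iff)
    then have "q - p < d' / l'" using l' by (simp add: field_simps)
    moreover have "l * ennreal (d' / l') = d" using l' d' by (simp add: ennreal_mult[symmetric])
    ultimately show ?thesis using that[of "d' / l'"] d by simp
  qed
  define e where "e = (m - (q - p)) / 2"
  have e: "e > 0" using m by (simp add: e_def)
  obtain p' where p': "p' \<in> \<rat>" "p - e < p'" "p' < p" using Rats_dense_in_real[of "p - e" p] e by auto
  obtain q' where q': "q' \<in> \<rat>" "q < q'" "q' < q + e" using Rats_dense_in_real[of q "q + e"] e by auto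
  have "q' - p' \<le> m" using p' q' by (simp add: e_def field_simps)
  then have "l * ennreal (q' - p') \<le> l * ennreal m" by (intro mult_left_mono ennreal_leI) auto
  also have "\<dots> < ?c" by (rule m)
  also have "?c \<le> emeasure \<mu> ({a..b} \<inter> {p'..q'})" using p' q' \<mu> by (intro emeasure_mono) auto
  finally show "\<exists>p\<in>\<rat>. \<exists>q\<in>\<rat>. p < x \<and> x < q \<and> l * ennreal (q - p) < emeasure \<mu> ({a..b} \<inter> {p..q})"
    using p' q' pq by (intro bexI[of _ p'] bexI[of _ q']) auto
next
  assume "\<exists>p\<in>\<rat>. \<exists>q\<in>\<rat>. p < x \<and> x < q \<and> l * ennreal (q - p) < emeasure \<mu> ({a..b} \<inter> {p..q})"
  then obtain p q where pq: "p < x" "x < q" "l * ennreal (q - p) < emeasure \<mu> ({a..b} \<inter> {p..q})" by blast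
  then have "l < emeasure \<mu> ({a..b} \<inter> {p..q}) / ennreal (q - p)" by (subst less_divide_ennreal_iff) auto
  also have "\<dots> \<le> local_maximal \<mu> a b x"
    unfolding local_maximal_def using pq by (intro SUP_upper2[of "(p, q)"]) auto
  finally show "l < local_maximal \<mu> a b x" .
qed

lemma open_local_maximal_greater:
  assumes "sets \<mu> = sets borel"
  shows "open {x. l < local_maximal \<mu> a b x}"
proof -
  have "{x. l < local_maximal \<mu> a b x} =
    (\<Union>p\<in>\<rat>. \<Union>q\<in>\<rat>. if l * ennreal (q - p) < emeasure \<mu> ({a..b} \<inter> {p..q}) then {p<..<q} else {})"
    unfolding local_maximal_greater_iff[OF assms] by (rule set_eqI) (force split: if_splits simp del: Int_atLeastAtMost)
  also have "open \<dots>" by (intro open_UN ballI) auto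
  finally show ?thesis .
qed

lemma borel_measurable_local_maximal:
  assumes "sets \<mu> = sets borel"
  shows "local_maximal \<mu> a b \<in> borel_measurable borel"
  using open_local_maximal_greater[OF assms] by (intro borel_measurableI_greater) auto

lemma local_maximal_ge:
  assumes "p < q" "x \<in> {p..q}" "{p..q} \<subseteq> {a..b}"
  shows "emeasure \<mu> {p..q} / ennreal (q - p) \<le> local_maximal \<mu> a b x"
proof -
  have "{a..b} \<inter> {p..q} = {p..q}" using assms by auto
  then show ?thesis unfolding local_maximal_def using assms by (intro SUP_upper2[of "(p, q)"]) auto
qed

section \<open>Power decay from the Fujii--Wilson constant\<close>

lemma ennreal_half_twice: "ennreal (1/2) * (2 * x) = x" "2 * (ennreal (1/2) * x) = x"
proof -
  have "ennreal (1/2) * 2 = ennreal (1/2) * ennreal 2" by simp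
  also have "\<dots> = ennreal (1/2 * 2)" by (rule ennreal_mult[symmetric]) auto
  finally have "ennreal (1/2) * 2 = 1" by simp
  then show "ennreal (1/2) * (2 * x) = x" "2 * (ennreal (1/2) * x) = x"
    by (metis mult.assoc mult.commute mult_1)+
qed

text \<open>
  Each enlargement to density \<open>1/2\<close> multiplies the length by at most \<open>4\<close> and adds at least
  \<open>\<mu>(F) / 4\<close> to the integral of the local maximal function.
\<close>

lemma iterated_expansion:
  fixes a b :: real
  assumes \<mu>: "sets \<mu> = sets borel"
    and \<K>: "finite \<K>" "\<And>K. K \<in> \<K> \<Longrightarrow> fst K < snd K \<and> cint K \<subseteq> {a..b}"
    and F: "F = Cover \<K>"
    and small: "4 ^ N * len F \<le> ennreal (b - a)"
  shows "\<exists>\<G>. finite \<G> \<and> (\<forall>K\<in>\<G>. fst K < snd K \<and> cint K \<subseteq> {a..b}) \<and> F \<subseteq> Cover \<G> \<and>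
     len (Cover \<G>) \<le> 4 ^ N * len F \<and>
     of_nat N * emeasure \<mu> F \<le> 4 * emeasure (density lborel (local_maximal \<mu> a b)) (Cover \<G>)"
  using small
proof (induction N)
  case 0
  then show ?case using \<K> F by (intro exI[of _ \<K>]) auto
next
  case (Suc N)
  define M where "M = density lborel (local_maximal \<mu> a b)"
  note [measurable] = borel_measurable_local_maximal[OF \<mu>]
  have M: "sets M = sets borel" by (simp add: M_def)
  have le: "4 ^ N * len F \<le> 4 ^ Suc N * len F"
    by (intro mult_right_mono power_increasing) auto
  obtain \<G> where G: "finite \<G>" "\<And>K. K \<in> \<G> \<Longrightarrow> fst K < snd K \<and> cint K \<subseteq> {a..b}" "F \<subseteq> Cover \<G>"
     "len (Cover \<G>) \<le> 4 ^ N * len F"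
     "of_nat N * emeasure \<mu> F \<le> 4 * emeasure M (Cover \<G>)"
    using Suc.IH[OF order_trans[OF le Suc.prems], folded M_def] by (elim exE conjE) (rule that; blast)
  define G' where "G' = Cover \<G>"
  have four: "4 * len G' \<le> ennreal (b - a)"
    using mult_left_mono[OF G(4), of 4] Suc.prems by (simp add: mult.assoc G'_def)
  have half: "len G' \<le> ennreal (1/2 * (b - a))"
  proof -
    have "2 * len G' \<le> 4 * len G'" by (intro mult_right_mono) auto
    then have "2 * len G' \<le> ennreal (b - a)" using four by simp
    from mult_left_mono[OF this, of "ennreal (1/2)"]
    have "ennreal (1/2) * (2 * len G') \<le> ennreal (1/2 * (b - a))"
      by (subst ennreal_mult') auto
    then show ?thesis by (simp only: ennreal_half_twice)
  qed
  obtain \<J> where J: "finite \<J>" "\<And>J. J \<in> \<J> \<Longrightarrow> fst J < snd J \<and> cint J \<subseteq> {a..b}"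
    "\<And>J. J \<in> \<J> \<Longrightarrow> len (cint J \<inter> G') = ennreal (1/2 * (snd J - fst J))"
    "G' \<subseteq> Cover \<J>" "\<And>x. card {J\<in>\<J>. x \<in> cint J} \<le> 2"
    "ennreal (1/2) * len (Cover \<J>) \<le> 2 * len G'"
    by (rule cover_of_given_density[OF G(1,2) G'_def, of "1/2"]) (use half in auto)
  define H where "H = Cover \<J>"
  have Hb: "H \<in> sets borel" "G' \<in> sets borel" using J(1) G(1) by (auto simp: H_def G'_def)
  have H4: "len H \<le> 4 * len G'"
  proof -
    have "2 * (ennreal (1/2) * len H) \<le> 2 * (2 * len G')"
      using J(6) by (intro mult_left_mono) (auto simp: H_def)
    then show ?thesis by (simp only: ennreal_half_twice) (simp add: mult.assoc[symmetric])
  qed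
  \<comment> \<open>Half of J lies outside the previous set, and there the local maximal function is at least
    the average over J.\<close>
  have piece: "ennreal (1/2) * emeasure \<mu> (cint J) \<le> emeasure M (cint J \<inter> (- G'))" if "J \<in> \<J>" for J
  proof -
    define l where "l = snd J - fst J"
    have l: "l > 0" using J(2)[OF that] by (simp add: l_def)
    have D: "len (cint J \<inter> (- G')) = ennreal (1/2 * l)"
    proof -
      have "len (cint J - (cint J \<inter> G')) = len (cint J) - len (cint J \<inter> G')"
        using Hb J(3)[OF that] by (intro emeasure_Diff) auto
      also have "\<dots> = ennreal l - ennreal (1/2 * l)"
        using J(3)[OF that] J(2)[OF that] by (simp add: cint_def l_def)
      also have "\<dots> = ennreal (1/2 * l)" using l by (subst ennreal_minus) auto
      also have "cint J - (cint J \<inter> G') = cint J \<inter> (- G')" by blast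
      finally show ?thesis .
    qed
    have "ennreal (1/2) * emeasure \<mu> (cint J) = emeasure \<mu> (cint J) / ennreal l * ennreal (1/2 * l)"
    proof -
      have "emeasure \<mu> (cint J) / ennreal l * ennreal (1/2 * l) = ennreal (1/2) * (emeasure \<mu> (cint J) / ennreal l * ennreal l)"
        using l by (subst ennreal_mult, simp, simp) (rule mult.left_commute)
      also have "emeasure \<mu> (cint J) / ennreal l * ennreal l = emeasure \<mu> (cint J)"
        using l by (simp add: ennreal_divide_times mult_divide_eq_ennreal)
      finally show ?thesis by simp
    qed
    also have "\<dots> = (\<integral>\<^sup>+x\<in>cint J \<inter> (- G'). emeasure \<mu> (cint J) / ennreal l \<partial>lborel)"
      using Hb D by (subst nn_integral_cmult_indicator) auto
    also have "\<dots> \<le> (\<integral>\<^sup>+x\<in>cint J \<inter> (- G'). local_maximal \<mu> a b x \<partial>lborel)"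
      using local_maximal_ge[of "fst J" "snd J" _ a b \<mu>] J(2)[OF that]
      by (intro nn_integral_mono) (auto simp: indicator_def cint_def l_def)
    also have "\<dots> = emeasure M (cint J \<inter> (- G'))"
      using Hb unfolding M_def by (subst emeasure_density) auto
    finally show ?thesis .
  qed
  have "emeasure \<mu> F \<le> emeasure \<mu> H"
    using G(3) J(4) Hb \<mu> by (intro emeasure_mono) (auto simp: H_def G'_def)
  also have "\<dots> \<le> (\<Sum>J\<in>\<J>. emeasure \<mu> (cint J))"
    unfolding H_def using J(1) by (intro emeasure_subadditive_finite) (auto simp: \<mu>)
  finally have "ennreal (1/2) * emeasure \<mu> F \<le> (\<Sum>J\<in>\<J>. ennreal (1/2) * emeasure \<mu> (cint J))"
    by (simp only: sum_distrib_left[symmetric]) (intro mult_left_mono; simp)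
  also have "\<dots> \<le> (\<Sum>J\<in>\<J>. emeasure M (cint J \<inter> (- G')))" by (intro sum_mono piece)
  also have "\<dots> \<le> 2 * emeasure M (H \<inter> (- G'))"
    unfolding H_def using J(1,5) M Hb by (intro sum_measure_overlap_2) auto
  finally have "2 * (ennreal (1/2) * emeasure \<mu> F) \<le> 2 * (2 * emeasure M (H \<inter> (- G')))"
    by (intro mult_left_mono) auto
  then have inc: "emeasure \<mu> F \<le> 4 * emeasure M (H \<inter> (- G'))"
    by (simp only: ennreal_half_twice) (simp add: mult.assoc[symmetric])
  have "of_nat (Suc N) * emeasure \<mu> F = emeasure \<mu> F + of_nat N * emeasure \<mu> F" by (simp add: distrib_right)
  also have "\<dots> \<le> 4 * emeasure M (H \<inter> (- G')) + 4 * emeasure M G'"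
    using inc G(5) by (intro add_mono) (auto simp: G'_def)
  also have "\<dots> = 4 * (emeasure M (H \<inter> (- G')) + emeasure M G')" by (simp add: distrib_left)
  also have "emeasure M (H \<inter> (- G')) + emeasure M G' = emeasure M ((H \<inter> (- G')) \<union> G')"
    using Hb M by (intro plus_emeasure) auto
  also have "(H \<inter> (- G')) \<union> G' = H" using J(4) by (auto simp: H_def)
  finally have "of_nat (Suc N) * emeasure \<mu> F \<le> 4 * emeasure M H" .
  moreover have "len H \<le> 4 ^ Suc N * len F"
    using H4 mult_left_mono[OF G(4), of 4] by (simp add: G'_def mult.assoc)
  ultimately show ?case
    using J(1,2,4) G(3) by (intro exI[of _ \<J>]) (auto simp: H_def G'_def M_def simp del: cint_simps)
qed

text \<open>
  With \<open>N \<ge> 16 A\<close> enlargements available inside \<open>{a..b}\<close>, the bound \<open>A \<mu>{a..b}\<close> for the integral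
  of the local maximal function forces \<open>N \<mu>(F) \<le> 4 A \<mu>{a..b}\<close>.
\<close>

lemma small_union_quarter:
  fixes a b A :: real
  assumes \<mu>: "diffuse_radon \<mu>" and fw: "fw_bound \<mu> A" and A: "0 < A" "16 * A \<le> real N"
    and \<K>: "finite \<K>" "\<And>K. K \<in> \<K> \<Longrightarrow> cint K \<subseteq> {a..b}"
    and F: "F = Cover \<K>"
    and small: "4 ^ N * len F \<le> ennreal (b - a)" and ab: "a < b"
  shows "4 * emeasure \<mu> F \<le> emeasure \<mu> {a..b}"
proof -
  have s\<mu>: "sets \<mu> = sets borel" and fin: "emeasure \<mu> {a..b} < \<infinity>" and pt: "\<And>x. emeasure \<mu> {x} = 0"
    using \<mu> by (auto simp: diffuse_radon_def)
  \<comment> \<open>Degenerate intervals contribute finitely many points and hence no mass.\<close>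
  define \<K>' where "\<K>' = {K\<in>\<K>. fst K < snd K}"
  define F' where "F' = Cover \<K>'"
  have fK': "finite \<K>'" using \<K> by (simp add: \<K>'_def)
  have Fsub: "F' \<subseteq> F" by (auto simp: F F'_def \<K>'_def simp del: cint_simps)
  have Fb: "F \<in> sets borel" "F' \<in> sets borel" using \<K>(1) fK' by (auto simp: F F'_def)
  have "F - F' \<subseteq> fst ` \<K>" by (force simp: F F'_def \<K>'_def)
  then have finD: "finite (F - F')" using \<K>(1) finite_subset by blast
  have "emeasure \<mu> (F - F') = (\<Sum>x\<in>F - F'. emeasure \<mu> {x})"
    using finD s\<mu> by (intro emeasure_eq_sum_singleton) auto
  then have D0: "emeasure \<mu> (F - F') = 0" using pt by simp
  have "emeasure \<mu> F = emeasure \<mu> (F' \<union> (F - F'))" using Fsub by (intro arg_cong[where f="emeasure \<mu>"]) auto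
  also have "\<dots> \<le> emeasure \<mu> F' + emeasure \<mu> (F - F')" using Fb s\<mu> by (intro emeasure_subadditive) auto
  finally have FF': "emeasure \<mu> F \<le> emeasure \<mu> F'" using D0 by simp
  have "len F' \<le> len F" using Fsub Fb by (intro emeasure_mono) auto
  then have small': "4 ^ N * len F' \<le> ennreal (b - a)"
    using small by (meson mult_left_mono order_trans zero_le)
  obtain \<G> where G: "finite \<G>" "\<And>K. K \<in> \<G> \<Longrightarrow> cint K \<subseteq> {a..b}"
     "of_nat N * emeasure \<mu> F' \<le> 4 * emeasure (density lborel (local_maximal \<mu> a b)) (Cover \<G>)"
    using iterated_expansion[OF s\<mu> fK' _ F'_def small'] \<K>(2) by (auto simp: \<K>'_def simp del: cint_simps)
  have [measurable]: "local_maximal \<mu> a b \<in> borel_measurable borel"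
    by (rule borel_measurable_local_maximal[OF s\<mu>])
  have "emeasure (density lborel (local_maximal \<mu> a b)) (Cover \<G>)
      \<le> emeasure (density lborel (local_maximal \<mu> a b)) {a..b}"
    using G(2) by (intro emeasure_mono) auto
  also have "\<dots> = (\<integral>\<^sup>+x\<in>{a..b}. local_maximal \<mu> a b x \<partial>lborel)"
    by (rule emeasure_density) auto
  also have "\<dots> \<le> ennreal A * emeasure \<mu> {a..b}" using fw ab by (simp add: fw_bound_def)
  finally have *: "4 * emeasure (density lborel (local_maximal \<mu> a b)) (Cover \<G>) \<le> 4 * (ennreal A * emeasure \<mu> {a..b})"
    by (intro mult_left_mono) auto
  have F'I: "F' \<subseteq> {a..b}" using \<K>(2) by (auto simp: F'_def \<K>'_def simp del: cint_simps)
  have finF: "emeasure \<mu> F' < \<infinity>" using emeasure_mono[OF F'I, of \<mu>] fin s\<mu> by (simp add: le_less_trans)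
  obtain f where f: "emeasure \<mu> F' = ennreal f" "0 \<le> f"
    using finF by (cases "emeasure \<mu> F'") auto
  obtain i where i: "emeasure \<mu> {a..b} = ennreal i" "0 \<le> i"
    using fin by (cases "emeasure \<mu> {a..b}") auto
  have "ennreal (real N * f) \<le> ennreal (4 * (A * i))"
    using order_trans[OF G(3) *] f i A
    by (simp add: ennreal_mult ennreal_of_nat_eq_real_of_nat)
  then have "real N * f \<le> 4 * (A * i)" using A i by (subst (asm) ennreal_le_iff) auto
  moreover have "16 * A * f \<le> real N * f" using A f by (intro mult_right_mono) auto
  ultimately have "A * (4 * f) \<le> A * i" by simp
  then have "4 * f \<le> i" using A by simp
  then have "ennreal (4 * f) \<le> ennreal i" by (rule ennreal_leI)
  then have "4 * emeasure \<mu> F' \<le> emeasure \<mu> {a..b}" using f i by (simp add: ennreal_mult)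
  then show ?thesis using FF' by (meson mult_left_mono order_trans zero_le)
qed

lemma cint_Int: "cint K \<inter> cint J = cint (max (fst K) (fst J), min (snd K) (snd J))"
  by (auto simp: cint_def)

text \<open>
  Covering \<open>F\<close> by intervals in which it has density \<open>4 ^ -N\<close> and applying \<open>small_union_quarter\<close>
  in each of them gives \<open>4 \<mu>(F) \<le> 2 \<mu>(H)\<close> for the union \<open>H\<close>; the factor \<open>2\<close> is the overlap.
  The length of \<open>H\<close> exceeds that of \<open>F\<close> by a factor at most \<open>2 * 4 ^ N \<le> 4 ^ Suc N\<close>, so the
  argument can be repeated with \<open>H\<close>.
\<close>

lemma small_union_geometric:
  fixes a b A :: real
  assumes \<mu>: "diffuse_radon \<mu>" and fw: "fw_bound \<mu> A" and A: "0 < A" "16 * A \<le> real N" and ab: "a < b"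
    and \<K>: "finite \<K>" "\<And>K. K \<in> \<K> \<Longrightarrow> fst K < snd K \<and> cint K \<subseteq> {a..b}"
    and F: "F = Cover \<K>"
    and small: "4 ^ (Suc N * k) * len F \<le> ennreal (b - a)"
  shows "2 ^ k * emeasure \<mu> F \<le> emeasure \<mu> {a..b}"
  using \<K> F small
proof (induction k arbitrary: \<K> F)
  case 0
  have "F \<subseteq> {a..b}" using 0 by auto
  then show ?case using \<mu> by (auto intro: emeasure_mono simp: diffuse_radon_def)
next
  case (Suc k)
  note \<K> = Suc.prems(1,2) and F = Suc.prems(3) and small = Suc.prems(4)
  have s\<mu>: "sets \<mu> = sets borel" using \<mu> by (auto simp: diffuse_radon_def)
  define \<eta> where "\<eta> = inverse (4 ^ N :: real)"
  have \<eta>: "0 < \<eta>" "\<eta> \<le> 1" by (auto simp: \<eta>_def inverse_le_1_iff)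
  have \<eta>4: "4 ^ N * ennreal \<eta> = 1"
  proof -
    have "(4 ^ N :: ennreal) = ennreal (4 ^ N)" by (simp flip: ennreal_power)
    then show ?thesis using \<eta> by (simp add: \<eta>_def ennreal_mult[symmetric])
  qed
  have "4 ^ N * len F \<le> 4 ^ (Suc N * Suc k) * len F"
    by (intro mult_right_mono power_increasing) auto
  then have sm1: "4 ^ N * len F \<le> ennreal (b - a)" using small by simp
  have le\<eta>: "len F \<le> ennreal (\<eta> * (b - a))"
  proof -
    have "ennreal \<eta> * (4 ^ N * len F) \<le> ennreal \<eta> * ennreal (b - a)"
      using sm1 by (intro mult_left_mono) auto
    moreover have "ennreal \<eta> * (4 ^ N * len F) = len F"
      using \<eta>4 by (metis mult.assoc mult.commute mult_1)
    ultimately show ?thesis using \<eta> ab by (simp add: ennreal_mult)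
  qed
  obtain \<J> where J: "finite \<J>" "\<And>J. J \<in> \<J> \<Longrightarrow> fst J < snd J \<and> cint J \<subseteq> {a..b}"
    "\<And>J. J \<in> \<J> \<Longrightarrow> len (cint J \<inter> F) = ennreal (\<eta> * (snd J - fst J))"
    "F \<subseteq> Cover \<J>" "\<And>x. card {J\<in>\<J>. x \<in> cint J} \<le> 2"
    "ennreal \<eta> * len (Cover \<J>) \<le> 2 * len F"
    by (rule cover_of_given_density[OF \<K> F \<eta> le\<eta>]) blast+
  define H where "H = Cover \<J>"
  have Hb: "H \<in> sets borel" "F \<in> sets borel" using J(1) \<K>(1) by (auto simp: H_def F)
  have piece: "4 * emeasure \<mu> (cint J \<inter> F) \<le> emeasure \<mu> (cint J)" if "J \<in> \<J>" for J
  proof -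
    define \<K>' where "\<K>' = (\<lambda>K. (max (fst J) (fst K), min (snd J) (snd K))) ` \<K>"
    have eq: "cint J \<inter> F = Cover \<K>'"
      unfolding F \<K>'_def image_image cint_Int[symmetric] by blast
    have "4 ^ N * len (cint J \<inter> F) \<le> ennreal (snd J - fst J)"
      using J(2,3)[OF that] \<eta> \<eta>4 by (simp add: ennreal_mult mult.assoc[symmetric])
    then have "4 * emeasure \<mu> (cint J \<inter> F) \<le> emeasure \<mu> {fst J..snd J}"
      using \<K>(1) J(2)[OF that]
      by (intro small_union_quarter[OF \<mu> fw A _ _ eq]) (auto simp: \<K>'_def cint_def)
    then show ?thesis by (simp add: cint_def)
  qed
  have H2: "2 * emeasure \<mu> F \<le> emeasure \<mu> H"
  proof -
    have "emeasure \<mu> F = emeasure \<mu> (\<Union>J\<in>\<J>. cint J \<inter> F)"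
      using J(4) by (intro arg_cong[where f="emeasure \<mu>"]) auto
    also have "\<dots> \<le> (\<Sum>J\<in>\<J>. emeasure \<mu> (cint J \<inter> F))"
      using J(1) Hb by (intro emeasure_subadditive_finite) (auto simp: s\<mu>)
    finally have "4 * emeasure \<mu> F \<le> (\<Sum>J\<in>\<J>. 4 * emeasure \<mu> (cint J \<inter> F))"
      by (simp only: sum_distrib_left[symmetric]) (intro mult_left_mono; simp)
    also have "\<dots> \<le> (\<Sum>J\<in>\<J>. emeasure \<mu> (cint J \<inter> UNIV))" using piece by (intro sum_mono) auto
    also have "\<dots> \<le> 2 * emeasure \<mu> (H \<inter> UNIV)"
      unfolding H_def using J(1,5) s\<mu> by (intro sum_measure_overlap_2) auto
    finally have h: "2 * (2 * emeasure \<mu> F) \<le> 2 * emeasure \<mu> H" by (simp add: mult.assoc[symmetric])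
    have "ennreal (1/2) * (2 * (2 * emeasure \<mu> F)) \<le> ennreal (1/2) * (2 * emeasure \<mu> H)"
      by (rule mult_left_mono[OF h]) simp
    then show ?thesis by (simp only: ennreal_half_twice)
  qed
  have "4 ^ (Suc N * k) * len H \<le> ennreal (b - a)"
  proof -
    have "len H = 4 ^ N * (ennreal \<eta> * len H)"
      using \<eta>4 by (metis mult.assoc mult_1)
    also have "\<dots> \<le> 4 ^ N * (4 * len F)"
    proof (intro mult_left_mono)
      have "2 * len F \<le> 4 * len F" by (intro mult_right_mono) auto
      then show "ennreal \<eta> * len H \<le> 4 * len F" using J(6) by (simp add: H_def)
    qed auto
    also have "\<dots> = 4 ^ Suc N * len F" by (simp add: mult_ac)
    finally have "4 ^ (Suc N * k) * len H \<le> 4 ^ (Suc N * k) * (4 ^ Suc N * len F)"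
      by (intro mult_left_mono) auto
    also have "\<dots> = 4 ^ (Suc N * Suc k) * len F"
      by (simp only: mult.assoc[symmetric] power_add[symmetric]) (simp add: algebra_simps)
    finally show ?thesis using small by (rule order_trans)
  qed
  from Suc.IH[OF J(1,2) H_def this] have "2 ^ k * emeasure \<mu> H \<le> emeasure \<mu> {a..b}" by simp
  moreover have "2 ^ Suc k * emeasure \<mu> F \<le> 2 ^ k * emeasure \<mu> H"
    using mult_left_mono[OF H2, of "2 ^ k"] by (simp add: mult_ac)
  ultimately show ?case by (rule order_trans[rotated])
qed

lemma open_eq_Union_rational_intervals:
  fixes W :: "real set"
  assumes "open W"
  shows "W = (\<Union>J\<in>{J \<in> \<rat> \<times> \<rat>. fst J < snd J \<and> cint J \<subseteq> W}. cint J)"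
proof
  show "W \<subseteq> (\<Union>J\<in>{J \<in> \<rat> \<times> \<rat>. fst J < snd J \<and> cint J \<subseteq> W}. cint J)"
  proof
    fix x assume "x \<in> W"
    then obtain e where e: "e > 0" "cball x e \<subseteq> W" using assms open_contains_cball by blast
    obtain p where p: "p \<in> \<rat>" "x - e < p" "p < x" using Rats_dense_in_real[of "x - e" x] e by auto
    obtain q where q: "q \<in> \<rat>" "x < q" "q < x + e" using Rats_dense_in_real[of x "x + e"] e by auto
    have "cint (p, q) \<subseteq> cball x e" using p q by (auto simp: dist_real_def)
    then show "x \<in> (\<Union>J\<in>{J \<in> \<rat> \<times> \<rat>. fst J < snd J \<and> cint J \<subseteq> W}. cint J)"
      using e p q by (intro UN_I[of "(p, q)"]) auto
  qed
qed auto

lemma emeasure_countable_cover_le: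
  fixes \<P> :: "(real \<times> real) set"
  assumes M: "sets M = sets borel" and P: "countable \<P>"
    and le: "\<And>\<K>. finite \<K> \<Longrightarrow> \<K> \<subseteq> \<P> \<Longrightarrow> emeasure M (Cover \<K>) \<le> c"
  shows "emeasure M (Cover \<P>) \<le> c"
proof (cases "\<P> = {}")
  case True then show ?thesis by simp
next
  case False
  let ?A = "\<lambda>n. \<Union>J\<in>from_nat_into \<P> ` {..<n}. cint J"
  have "Cover \<P> = (\<Union>n. ?A n)"
  proof -
    have "\<P> = (\<Union>n. from_nat_into \<P> ` {..<n})"
      using range_from_nat_into[OF False P] by (auto simp: image_def)
    then show ?thesis by blast
  qed
  also have "emeasure M \<dots> = (SUP n. emeasure M (?A n))"
    by (intro SUP_emeasure_incseq[symmetric]) (fastforce simp: M incseq_def simp del: cint_simps(1) intro!: sets.finite_UN)+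
  also have "\<dots> \<le> c"
    using from_nat_into[OF False] by (intro SUP_least le) auto
  finally show ?thesis .
qed

text \<open>
  The power decay of a measure with Fujii--Wilson constant \<open>A\<close>. The geometric decay for finite unions
  of intervals passes to open sets by monotone limits and to Borel sets by outer regularity of
  Lebesgue measure.
\<close>

lemma small_set_power_decay:
  fixes a b A :: real
  assumes \<mu>: "diffuse_radon \<mu>" and fw: "fw_bound \<mu> A" and A: "1 \<le> A" and ab: "a < b"
    and F: "F \<in> sets borel" "F \<subseteq> {a..b}"
    and \<epsilon>: "0 < \<epsilon>" "\<epsilon> \<le> 1" and small: "len F < ennreal (\<epsilon> * (b - a))"
  shows "emeasure \<mu> F \<le> ennreal (2 * \<epsilon> powr (1 / (36 * A))) * emeasure \<mu> {a..b}"
proof -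
  have s\<mu>: "sets \<mu> = sets borel" and pt: "\<And>x. emeasure \<mu> {x} = 0"
    using \<mu> by (auto simp: diffuse_radon_def)
  define N where "N = nat \<lceil>16 * A\<rceil>"
  have N: "16 * A \<le> real N" "real N \<le> 16 * A + 1" using A by (auto simp: N_def)
  define L where "L = real (Suc N) * ln 4"
  have L: "L > 0" by (simp add: L_def)
  \<comment> \<open>The largest k for which the geometric decay applies to sets of density
    \<open>\<epsilon>\<close>.\<close>
  define k where "k = nat \<lfloor>ln (1 / \<epsilon>) / L\<rfloor>"
  have q0: "ln (1 / \<epsilon>) / L \<ge> 0" using \<epsilon> L by (intro divide_nonneg_pos ln_ge_zero) auto
  have k: "real k \<le> ln (1 / \<epsilon>) / L" "ln (1 / \<epsilon>) / L < real k + 1"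
    using q0 unfolding k_def by (simp_all add: of_nat_nat)
  have e1: "4 ^ (Suc N * k) * \<epsilon> \<le> 1"
  proof -
    have "real k * L \<le> - ln \<epsilon>" using k(1) L \<epsilon> by (simp add: field_simps ln_div)
    then have "exp (real k * L) \<le> exp (- ln \<epsilon>)" by simp
    also have "exp (- ln \<epsilon>) = 1 / \<epsilon>" using \<epsilon> by (simp add: exp_minus field_simps)
    also have "exp (real k * L) = 4 ^ (Suc N * k)"
      unfolding L_def by (subst powr_realpow[symmetric]) (auto simp: powr_def algebra_simps)
    finally show ?thesis using \<epsilon> by (simp add: field_simps)
  qed
  have e2: "inverse (2 ^ k) \<le> 2 * \<epsilon> powr (1 / (36 * A))"
  proof -
    have "- ln \<epsilon> < real (Suc k) * L" using k(2) L \<epsilon> by (simp add: field_simps ln_div)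
    then have "- ln \<epsilon> / (2 * real (Suc N)) < real (Suc k) * ln 2"
      using ln_powr[of 2 2] by (simp add: L_def field_simps)
    \<comment> \<open>Here \<open>Suc N \<le> 18 A\<close>, as \<open>A \<ge> 1\<close>.\<close>
    moreover have "- ln \<epsilon> / (36 * A) \<le> - ln \<epsilon> / (2 * real (Suc N))"
      using \<epsilon> N A by (intro divide_left_mono mult_pos_pos) auto
    ultimately have "- (real (Suc k) * ln 2) \<le> ln \<epsilon> / (36 * A)" by linarith
    then have "exp (- (real (Suc k) * ln 2)) \<le> exp (ln \<epsilon> / (36 * A))" by simp
    also have "exp (- (real (Suc k) * ln 2)) = inverse (2 ^ Suc k)"
      by (subst exp_minus, subst powr_realpow[symmetric]) (auto simp: powr_def)
    also have "exp (ln \<epsilon> / (36 * A)) = \<epsilon> powr (1 / (36 * A))" using \<epsilon> by (simp add: powr_def)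
    finally show ?thesis by simp
  qed
  obtain U where U: "open U" "F \<subseteq> U" "len U < ennreal (\<epsilon> * (b - a))"
  proof -
    obtain f where f: "len F = ennreal f" "0 \<le> f"
      using small by (cases "len F") auto
    have "f < \<epsilon> * (b - a)" using small f by (simp add: ennreal_less_iff)
    then obtain U where U: "open U" "F \<subseteq> U" "len (U - F) < ennreal (\<epsilon> * (b - a) - f)"
      using outer_regular_lborel[of F "\<epsilon> * (b - a) - f"] F by auto
    have "len U = len (F \<union> (U - F))" using U by (intro arg_cong[where f="len"]) auto
    also have "\<dots> \<le> len F + len (U - F)" using F U by (intro emeasure_subadditive) auto
    also have "\<dots> < ennreal f + ennreal (\<epsilon> * (b - a) - f)"
      using U f by (simp add: ennreal_add_left_cancel_less)
    also have "\<dots> = ennreal (\<epsilon> * (b - a))" using \<open>f < _\<close> f by (simp add: ennreal_plus[symmetric])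
    finally show thesis using that U by blast
  qed
  define W where "W = U \<inter> {a<..<b}"
  let ?P = "{J \<in> \<rat> \<times> \<rat>. fst J < snd J \<and> cint J \<subseteq> W}"
  have oW: "open W" using U by (auto simp: W_def)
  have cP: "countable ?P" using countable_rat by (auto intro: countable_subset[of _ "\<rat> \<times> \<rat>"])
  have Wle: "emeasure \<mu> W \<le> ennreal (inverse (2 ^ k)) * emeasure \<mu> {a..b}"
  proof (subst open_eq_Union_rational_intervals[OF oW], rule emeasure_countable_cover_le[OF s\<mu> cP])
    fix \<K> assume K: "finite \<K>" "\<K> \<subseteq> ?P"
    let ?F = "Cover \<K>"
    have "?F \<subseteq> U" using K by (auto simp: W_def simp del: cint_simps)
    then have "len ?F \<le> len U" using U(1) by (intro emeasure_mono) auto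
    then have "len ?F \<le> ennreal (\<epsilon> * (b - a))" using U(3) by (rule order_trans[OF _ less_imp_le])
    then have "4 ^ (Suc N * k) * len ?F \<le> ennreal (4 ^ (Suc N * k)) * ennreal (\<epsilon> * (b - a))"
      by (intro mult_mono) (auto simp flip: ennreal_power)
    also have "\<dots> = ennreal (4 ^ (Suc N * k) * \<epsilon> * (b - a))"
      using \<epsilon> ab by (simp add: ennreal_mult mult.assoc del: power_Suc mult_Suc)
    also have "\<dots> \<le> ennreal (1 * (b - a))" using e1 ab by (intro ennreal_leI mult_right_mono) auto
    finally have "4 ^ (Suc N * k) * len ?F \<le> ennreal (b - a)" by simp
    moreover have "fst J < snd J \<and> cint J \<subseteq> {a..b}" if "J \<in> \<K>" for J
    proof -
      have "fst J < snd J" "cint J \<subseteq> W" using K(2) that by blast+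
      moreover have "W \<subseteq> {a..b}" by (auto simp: W_def)
      ultimately show ?thesis by blast
    qed
    ultimately have "2 ^ k * emeasure \<mu> ?F \<le> emeasure \<mu> {a..b}"
      using A by (intro small_union_geometric[OF \<mu> fw _ N(1) ab K(1) _ refl]) simp_all
    then have "ennreal (inverse (2 ^ k)) * (2 ^ k * emeasure \<mu> ?F) \<le> ennreal (inverse (2 ^ k)) * emeasure \<mu> {a..b}"
      by (intro mult_left_mono) auto
    moreover have "ennreal (inverse (2 ^ k)) * 2 ^ k = 1"
    proof -
      have "(2 ^ k :: ennreal) = ennreal (2 ^ k)" by (simp flip: ennreal_power)
      then show ?thesis by (simp add: ennreal_mult[symmetric])
    qed
    ultimately show "emeasure \<mu> ?F \<le> ennreal (inverse (2 ^ k)) * emeasure \<mu> {a..b}"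
      by (simp add: mult.assoc[symmetric])
  qed
  have "emeasure \<mu> F \<le> emeasure \<mu> (W \<union> {a} \<union> {b})"
    using F U s\<mu> oW by (intro emeasure_mono) (auto simp: W_def)
  also have "\<dots> \<le> emeasure \<mu> W + emeasure \<mu> {a} + emeasure \<mu> {b}"
    using s\<mu> oW by (intro order_trans[OF emeasure_subadditive] add_right_mono emeasure_subadditive) auto
  also have "\<dots> = emeasure \<mu> W" by (simp add: pt)
  also note Wle
  also have "ennreal (inverse (2 ^ k)) * emeasure \<mu> {a..b} \<le> ennreal (2 * \<epsilon> powr (1 / (36 * A))) * emeasure \<mu> {a..b}"
    using e2 by (intro mult_right_mono ennreal_leI) auto
  finally show ?thesis .
qed

section \<open>The Solyanik estimate on the line\<close>

text \<open>
  The set where the maximal function of \<open>indicator E\<close> exceeds \<open>1 - \<delta>\<close>, written with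
  closed intervals. Restricting to rational intervals makes it a countable union, measurable also in parameters.
\<close>

definition density_hull :: "real \<Rightarrow> real set \<Rightarrow> real set" where
  "density_hull \<delta> E = (\<Union>J\<in>{J \<in> \<rat> \<times> \<rat>. fst J < snd J \<and>
      len (cint J - E) < ennreal (\<delta> * (snd J - fst J))}. cint J)"

text \<open>
  The inequality for the density is strict, so it survives a small enlargement of the interval to
  rational endpoints.
\<close>

lemma interval_subset_density_hull:
  assumes E: "E \<in> sets borel" and ab: "a < b" and \<delta>: "0 < \<delta>"
    and d: "len ({a..b} - E) < ennreal (\<delta> * (b - a))"
  shows "{a..b} \<subseteq> density_hull \<delta> E"
proof -
  obtain f where f: "len ({a..b} - E) = ennreal f" "0 \<le> f"
    using d by (cases "len ({a..b} - E)") auto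
  have fl: "f < \<delta> * (b - a)" using d f by (simp add: ennreal_less_iff)
  define e where "e = (\<delta> * (b - a) - f) / 2"
  have e: "e > 0" using fl by (simp add: e_def)
  obtain p where p: "p \<in> \<rat>" "a - e < p" "p < a" using Rats_dense_in_real[of "a - e" a] e by auto
  obtain q where q: "q \<in> \<rat>" "b < q" "q < b + e" using Rats_dense_in_real[of b "b + e"] e by auto
  have "len ({p..q} - E) \<le> len (({a..b} - E) \<union> {p..a} \<union> {b..q})"
    using E by (intro emeasure_mono) auto
  also have "\<dots> \<le> len ({a..b} - E) + len {p..a} + len {b..q}"
    using E by (intro order_trans[OF emeasure_subadditive] add_right_mono emeasure_subadditive) auto
  also have "\<dots> = ennreal (f + (a - p) + (q - b))" using f p q by simp
  also have "\<dots> < ennreal (\<delta> * (q - p))"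
  proof (rule ennreal_lessI)
    have "\<delta> * (b - a) < \<delta> * (q - p)" using \<delta> p q by (intro mult_strict_left_mono) auto
    moreover show "0 < \<delta> * (q - p)" using \<delta> p q ab by (intro mult_pos_pos) auto
    moreover have "f + 2 * e = \<delta> * (b - a)" by (simp add: e_def field_simps)
    ultimately show "f + (a - p) + (q - b) < \<delta> * (q - p)" using p q by linarith
  qed
  finally have "(p, q) \<in> {J \<in> \<rat> \<times> \<rat>. fst J < snd J \<and>
      len (cint J - E) < ennreal (\<delta> * (snd J - fst J))}"
    using p q ab by (simp add: cint_def)
  moreover have "{a..b} \<subseteq> cint (p, q)" using p q by (auto simp: cint_def)
  ultimately show ?thesis unfolding density_hull_def by blast
qed

lemma emeasure_interval_le_integral_local_maximal:
  assumes "sets \<mu> = sets borel" "a < b"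
  shows "emeasure \<mu> {a..b} \<le> (\<integral>\<^sup>+x\<in>{a..b}. local_maximal \<mu> a b x \<partial>lborel)"
proof -
  have "emeasure \<mu> {a..b} = emeasure \<mu> {a..b} / ennreal (b - a) * len {a..b}"
    using assms by (simp add: ennreal_divide_times mult_divide_eq_ennreal)
  also have "\<dots> = (\<integral>\<^sup>+x\<in>{a..b}. emeasure \<mu> {a..b} / ennreal (b - a) \<partial>lborel)"
    by (subst nn_integral_cmult_indicator) auto
  also have "\<dots> \<le> (\<integral>\<^sup>+x\<in>{a..b}. local_maximal \<mu> a b x \<partial>lborel)"
    using assms local_maximal_ge[of a b _ a b \<mu>] by (intro nn_integral_mono) (auto simp: indicator_def)
  finally show ?thesis .
qed

text \<open>
  The local maximal function is at least the average over the whole interval, so a constant below \<open>1\<close>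
  is possible only for the zero measure.
\<close>

lemma fw_bound_less_1_null:
  assumes \<mu>: "diffuse_radon \<mu>" and fw: "fw_bound \<mu> A" and A: "A < 1"
  shows "emeasure \<mu> X = 0"
proof -
  have s\<mu>: "sets \<mu> = sets borel" using \<mu> by (auto simp: diffuse_radon_def)
  have I: "emeasure \<mu> {- real n - 1..real n} = 0" for n
  proof -
    define i where "i = enn2real (emeasure \<mu> {- real n - 1..real n})"
    have i: "emeasure \<mu> {- real n - 1..real n} = ennreal i" "0 \<le> i"
      using \<mu> by (auto simp: diffuse_radon_def i_def less_top)
    have "emeasure \<mu> {- real n - 1..real n} \<le> ennreal A * emeasure \<mu> {- real n - 1..real n}"
    proof -
      have lt: "- real n - 1 < real n" by simp
      show ?thesis
        using order_trans[OF emeasure_interval_le_integral_local_maximal[OF s\<mu> lt]] fw lt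
        unfolding fw_bound_def by blast
    qed
    also have "\<dots> \<le> ennreal (max 0 A) * ennreal i" unfolding i by (intro mult_right_mono ennreal_leI) auto
    finally have "i \<le> max 0 A * i" using i by (simp add: ennreal_mult[symmetric] del: max.absorb1 max.absorb2)
    then have "(1 - max 0 A) * i \<le> 0" by (simp add: algebra_simps)
    then have "i \<le> 0" using A by (simp add: mult_le_0_iff max_def split: if_splits)
    then show ?thesis using i by simp
  qed
  have "emeasure \<mu> UNIV \<le> emeasure \<mu> (\<Union>n. {- real n - 1..real n})"
  proof (intro emeasure_mono subsetI)
    fix x :: real
    obtain n where "\<bar>x\<bar> \<le> real n" using real_arch_simple by blast
    then show "x \<in> (\<Union>n. {- real n - 1..real n})" by (intro UN_I[of n]) auto
  qed (auto simp: s\<mu>)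
  also have "\<dots> = 0"
    using I by (intro emeasure_UN_eq_0) (auto simp: s\<mu>)
  finally have U: "emeasure \<mu> UNIV = 0" by simp
  have "emeasure \<mu> X \<le> emeasure \<mu> UNIV" by (intro emeasure_mono) (auto simp: s\<mu>)
  then show ?thesis using U by simp
qed

text \<open>
  The Solyanik estimate on the line. For a finite subfamily with union \<open>H\<close> and overlap at most \<open>2\<close>,
  the decay gives \<open>\<mu>(H - E) \<le> 4 z \<mu>(H)\<close> with \<open>z = \<delta> powr (1 / (36 A))\<close>, and the range of \<open>\<delta>\<close>
  makes \<open>z \<le> 1/8\<close>, so that this term can be absorbed. The constant \<open>144 = 4 * 36\<close> serves both the
  exponent and the range.
\<close>

lemma emeasure_density_hull_le:
  assumes \<mu>: "diffuse_radon \<mu>" and fw: "fw_bound \<mu> A" and E: "E \<in> sets borel"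
    and \<delta>: "0 < \<delta>" "\<delta> < exp (- (144 * A))"
  shows "emeasure \<mu> (density_hull \<delta> E) \<le> ennreal (1 + 8 * \<delta> powr (inverse (144 * A))) * emeasure \<mu> E"
proof (cases "A < 1")
  case True
  then show ?thesis using fw_bound_less_1_null[OF \<mu> fw] by simp
next
  case False
  then have A: "1 \<le> A" by simp
  have s\<mu>: "sets \<mu> = sets borel" using \<mu> by (auto simp: diffuse_radon_def)
  define z where "z = \<delta> powr (1 / (36 * A))"
  have "exp (- (144 * A)) \<le> 1" using A by simp
  then have \<delta>1: "\<delta> \<le> 1" using \<delta> by linarith
  have z0: "0 \<le> z" by (simp add: z_def)
  have z1: "z \<le> 1/8"
  proof -
    have "z \<le> exp (- (144 * A)) powr (1 / (36 * A))"
      unfolding z_def using \<delta> A by (intro powr_mono2) auto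
    also have "\<dots> = exp (- 4)" using A by (simp add: powr_def)
    also have "\<dots> \<le> 1/8"
    proof -
      have "(2::real) \<le> exp 1" using exp_ge_add_one_self[of 1] by simp
      then have "2 ^ 4 \<le> (exp 1 :: real) ^ 4" by (intro power_mono) auto
      also have "\<dots> = exp 4" by (simp add: exp_of_nat_mult[symmetric])
      finally show ?thesis by (simp add: exp_minus field_simps)
    qed
    finally show ?thesis .
  qed
  have z2: "z \<le> \<delta> powr (inverse (144 * A))"
    unfolding z_def using \<delta> \<delta>1 A by (intro powr_mono') (auto simp: field_simps)
  let ?P = "{J \<in> \<rat> \<times> \<rat>. fst J < snd J \<and> len (cint J - E) < ennreal (\<delta> * (snd J - fst J))}"
  have cP: "countable ?P" using countable_rat by (auto intro: countable_subset[of _ "\<rat> \<times> \<rat>"])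
  have "emeasure \<mu> (density_hull \<delta> E) \<le> ennreal (1 + 8 * z) * emeasure \<mu> E"
    unfolding density_hull_def
  proof (rule emeasure_countable_cover_le[OF s\<mu> cP])
    fix \<K> assume K: "finite \<K>" "\<K> \<subseteq> ?P"
    obtain \<J> where J: "\<J> \<subseteq> \<K>" "Cover \<J> = Cover \<K>"
      "\<And>x. card {J\<in>\<J>. x \<in> cint J} \<le> 2"
      using exists_subcover_overlap_2[OF K(1)] by blast
    have fJ: "finite \<J>" using J(1) K(1) finite_subset by blast
    define H where "H = Cover \<J>"
    have piece: "emeasure \<mu> (cint J - E) \<le> ennreal (2 * z) * emeasure \<mu> (cint J)" if "J \<in> \<J>" for J
    proof -
      have "J \<in> ?P" using J(1) K(2) that by blast
      then show ?thesis
        unfolding z_def using small_set_power_decay[OF \<mu> fw A, of "fst J" "snd J" "cint J - E" \<delta>] E \<delta> \<delta>1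
        by (auto simp: cint_def)
    qed
    have finH: "emeasure \<mu> H < \<infinity>"
    proof -
      have "emeasure \<mu> H \<le> (\<Sum>J\<in>\<J>. emeasure \<mu> (cint J))"
        unfolding H_def using fJ by (intro emeasure_subadditive_finite) (auto simp: s\<mu>)
      also have "\<dots> < \<infinity>" using fJ \<mu> by (auto simp: cint_def diffuse_radon_def)
      finally show ?thesis .
    qed
    have "emeasure \<mu> H \<le> emeasure \<mu> (E \<union> (\<Union>J\<in>\<J>. cint J - E))"
      unfolding s\<mu> using E fJ by (intro emeasure_mono) (auto simp: H_def s\<mu> simp del: UN_simps intro!: sets.Un sets.finite_UN)
    also have "\<dots> \<le> emeasure \<mu> E + emeasure \<mu> (\<Union>J\<in>\<J>. cint J - E)"
      unfolding s\<mu> using E by (intro emeasure_subadditive) (auto simp: s\<mu> simp del: UN_simps intro!: sets.finite_UN[OF fJ])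
    also have "emeasure \<mu> (\<Union>J\<in>\<J>. cint J - E) \<le> (\<Sum>J\<in>\<J>. emeasure \<mu> (cint J - E))"
      using E fJ by (intro emeasure_subadditive_finite) (auto simp: s\<mu>)
    also have "\<dots> \<le> (\<Sum>J\<in>\<J>. ennreal (2 * z) * emeasure \<mu> (cint J \<inter> UNIV))"
      using piece by (intro sum_mono) auto
    also have "\<dots> = ennreal (2 * z) * (\<Sum>J\<in>\<J>. emeasure \<mu> (cint J \<inter> UNIV))" by (rule sum_distrib_left[symmetric])
    also have "\<dots> \<le> ennreal (2 * z) * (2 * emeasure \<mu> (H \<inter> UNIV))"
      unfolding H_def using fJ J(3) s\<mu> by (intro mult_left_mono sum_measure_overlap_2) auto
    finally have main: "emeasure \<mu> H \<le> emeasure \<mu> E + ennreal (2 * z) * (2 * emeasure \<mu> H)"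
      by (simp add: add_left_mono)
    show "emeasure \<mu> (Cover \<K>) \<le> ennreal (1 + 8 * z) * emeasure \<mu> E"
    proof (cases "emeasure \<mu> E = \<infinity>")
      case True
      have "1 + 8 * z > 0" using z0 by linarith
      with True show ?thesis by (simp add: ennreal_mult_top)
    next
      case False
      then obtain e where e: "emeasure \<mu> E = ennreal e" "0 \<le> e" by (cases "emeasure \<mu> E") auto
      obtain h where h: "emeasure \<mu> H = ennreal h" "0 \<le> h" using finH by (cases "emeasure \<mu> H") auto
      have "ennreal h \<le> ennreal (e + 2 * z * (2 * h))"
      proof -
        have "2 * ennreal h = ennreal (2 * h)" using h by (simp add: ennreal_mult)
        then have "emeasure \<mu> E + ennreal (2 * z) * (2 * emeasure \<mu> H) = ennreal (e + 2 * z * (2 * h))"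
          using e h z0 by (simp only: ennreal_mult[symmetric] ennreal_plus[symmetric] mult_nonneg_nonneg zero_le_numeral)
        then show ?thesis using main h by simp
      qed
      then have "h \<le> e + 2 * z * (2 * h)" using e h z0 by (subst (asm) ennreal_le_iff) auto
      \<comment> \<open>Absorption: \<open>h (1 - 4 z) \<le> e\<close>, and \<open>(1 + 8 z) (1 - 4 z) \<ge>
        1\<close> because \<open>z \<le> 1/8\<close>.\<close>
      then have "(1 + 8 * z) * (h * (1 - 4 * z)) \<le> (1 + 8 * z) * e"
        using z0 by (intro mult_left_mono) (auto simp: algebra_simps)
      moreover have "h \<le> (1 + 8 * z) * (h * (1 - 4 * z))"
      proof -
        have "(1 + 8 * z) * (h * (1 - 4 * z)) = h + h * (4 * z * (1 - 8 * z))" by (simp add: algebra_simps)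
        moreover have "0 \<le> h * (4 * z * (1 - 8 * z))" using h z0 z1 by simp
        ultimately show ?thesis by simp
      qed
      ultimately have "ennreal h \<le> ennreal ((1 + 8 * z) * e)" by (intro ennreal_leI) linarith
      then show ?thesis using J(2) h e z0 by (simp add: H_def ennreal_mult)
    qed
  qed
  also have "\<dots> \<le> ennreal (1 + 8 * \<delta> powr (inverse (144 * A))) * emeasure \<mu> E"
    using z2 by (intro mult_right_mono ennreal_leI) auto
  finally show ?thesis .
qed

section \<open>The Fujii--Wilson constant from power decay\<close>

text \<open>
  The weak type inequality in its localised form: the mass on the right is that of the union itself, which
  the decay hypothesis makes small for high levels.
\<close>

lemma overlap_weak_type:
  assumes \<mu>: "sets \<mu> = sets borel" and K: "finite \<K>"
    and big: "\<And>J. J \<in> \<K> \<Longrightarrow> l * len (cint J) \<le> emeasure \<mu> (cint J)"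
  shows "l * len (Cover \<K>) \<le> 2 * emeasure \<mu> (Cover \<K>)"
proof -
  obtain \<J> where J: "\<J> \<subseteq> \<K>" "Cover \<J> = Cover \<K>"
    "\<And>x. card {J\<in>\<J>. x \<in> cint J} \<le> 2"
    using exists_subcover_overlap_2[OF K] by blast
  have fJ: "finite \<J>" using J(1) K finite_subset by blast
  have "l * len (Cover \<J>) \<le> l * (\<Sum>J\<in>\<J>. len (cint J))"
    using fJ by (intro mult_left_mono emeasure_subadditive_finite) auto
  also have "\<dots> = (\<Sum>J\<in>\<J>. l * len (cint J))" by (rule sum_distrib_left)
  also have "\<dots> \<le> (\<Sum>J\<in>\<J>. emeasure \<mu> (cint J \<inter> UNIV))"
    using big J(1) by (intro sum_mono) auto
  also have "\<dots> \<le> 2 * emeasure \<mu> (Cover \<J> \<inter> UNIV)"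
    using fJ J(3) \<mu> by (intro sum_measure_overlap_2) auto
  finally show ?thesis by (simp add: J(2))
qed

text \<open>
  A dyadic layer-cake bound. If \<open>m\<close> lies between two consecutive levels, the levels below it sum
  to at least \<open>m - 2 l\<close>; for infinite \<open>m\<close> the series diverges.
\<close>

lemma dyadic_layers_le:
  fixes l :: real and m :: ennreal
  assumes l: "0 < l"
  shows "m \<le> ennreal (2 * l) + (\<Sum>k. ennreal (2 ^ Suc k * l) * (if ennreal (2 ^ Suc k * l) < m then 1 else 0))"
    (is "_ \<le> _ + suminf ?f")
proof -
  have part: "min m (ennreal (2 ^ Suc N * l)) \<le> ennreal (2 * l) + (\<Sum>k<N. ?f k)" for N
  proof (induction N)
    case (Suc N)
    show ?case
    proof (cases "ennreal (2 ^ Suc N * l) < m")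
      case True
      have "min m (ennreal (2 ^ Suc (Suc N) * l)) \<le> ennreal (2 ^ Suc N * l + 2 ^ Suc N * l)"
        by (simp add: algebra_simps)
      also have "\<dots> = ennreal (2 ^ Suc N * l) + ennreal (2 ^ Suc N * l)"
        using l by (intro ennreal_plus) auto
      also have "\<dots> = min m (ennreal (2 ^ Suc N * l)) + ?f N" using True by simp
      also have "\<dots> \<le> (ennreal (2 * l) + (\<Sum>k<N. ?f k)) + ?f N" by (intro add_right_mono Suc)
      finally show ?thesis by (simp add: add.assoc del: power_Suc)
    next
      case False
      then have "min m (ennreal (2 ^ Suc (Suc N) * l)) \<le> min m (ennreal (2 ^ Suc N * l))" by simp
      from order_trans[OF this Suc] show ?thesis using False by (simp del: power_Suc)
    qed
  qed simp
  let ?S = "ennreal (2 * l) + suminf ?f"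
  have le: "min m (ennreal (2 ^ Suc N * l)) \<le> ?S" for N
    using part[of N] by (rule order_trans) (intro add_left_mono sum_le_suminf, auto)
  show ?thesis
  proof (rule ccontr)
    assume n: "\<not> m \<le> ?S"
    have "?S \<noteq> top" using n by (metis top_greatest)
    then obtain s where s: "?S = ennreal s" "0 \<le> s" by (cases ?S) auto
    obtain N where N: "s / l < 2 ^ N" using real_arch_pow[of 2 "s / l"] by auto
    also have "(2::real) ^ N \<le> 2 ^ Suc N" by simp
    finally have "s < 2 ^ Suc N * l" using l by (simp add: field_simps)
    then have "?S < ennreal (2 ^ Suc N * l)" unfolding s using s by (simp add: ennreal_less_iff)
    with n le[of N] show False by (simp add: min_le_iff_disj del: power_Suc)
  qed
qed

lemma local_maximal_level_set_cover:
  assumes \<mu>: "sets \<mu> = sets borel" and ab: "a \<in> \<rat>" "b \<in> \<rat>" "a < b"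
    and x: "x \<in> {a..b}" "l < local_maximal \<mu> a b x"
  shows "\<exists>J\<in>\<rat> \<times> \<rat>. fst J < snd J \<and> cint J \<subseteq> {a..b} \<and> l * len (cint J) \<le> emeasure \<mu> (cint J) \<and> x \<in> cint J"
proof -
  obtain p q where pq: "p \<in> \<rat>" "q \<in> \<rat>" "p < x" "x < q" "l * ennreal (q - p) < emeasure \<mu> ({a..b} \<inter> {p..q})"
    using x(2) unfolding local_maximal_greater_iff[OF \<mu>] by blast
  let ?J = "(max a p, min b q)"
  have eq: "cint ?J = {a..b} \<inter> {p..q}" by (auto simp: cint_def)
  have lt: "max a p < min b q" using ab pq x(1) by auto
  have "l * len (cint ?J) = l * ennreal (min b q - max a p)" using lt by (simp add: cint_def)
  also have "\<dots> \<le> l * ennreal (q - p)" by (intro mult_left_mono ennreal_leI) auto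
  also have "\<dots> \<le> emeasure \<mu> (cint ?J)" using pq(5) unfolding eq by (rule less_imp_le)
  finally show ?thesis using ab pq lt eq x(1)
    by (intro bexI[of _ ?J]) (auto simp: max_def min_def)
qed

text \<open>
  The sum of the geometric series with ratio \<open>2 powr (- 1 / \<beta>)\<close> is of order \<open>\<beta>\<close>. This is where the
  linear dependence of the final bound on \<open>\<beta>\<close> comes from.
\<close>

lemma inverse_one_minus_two_powr_le:
  fixes \<beta> :: real
  assumes "\<beta> > 1"
  shows "inverse (1 - 2 powr (- (1 / \<beta>))) \<le> 3 * \<beta>"
proof -
  define y where "y = ln 2 / \<beta>"
  have ln2: "ln 2 \<ge> (1/2 :: real)" using ln2_ge_two_thirds by linarith
  have y: "y > 0" using assms by (simp add: y_def)
  have "2 powr (- (1 / \<beta>)) = inverse (exp y)" by (simp add: powr_def y_def exp_minus)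
  also have "\<dots> \<le> inverse (1 + y)" using y exp_ge_add_one_self[of y] by (intro le_imp_inverse_le) auto
  finally have "1 - inverse (1 + y) \<le> 1 - 2 powr (- (1 / \<beta>))" by simp
  moreover have "1 - inverse (1 + y) = y / (1 + y)" using y by (simp add: field_simps)
  ultimately have "inverse (1 - 2 powr (- (1 / \<beta>))) \<le> inverse (y / (1 + y))"
    using y by (intro le_imp_inverse_le) (auto intro: divide_pos_pos)
  also have "\<dots> = 1 + \<beta> / ln 2" using y assms by (simp add: y_def field_simps)
  also have "\<dots> \<le> 1 + \<beta> / (1/2)" using ln2 assms by (intro add_left_mono divide_left_mono) auto
  finally show ?thesis using assms by simp
qed

lemma local_maximal_null:
  assumes "sets \<mu> = sets borel" "emeasure \<mu> {a..b} = 0"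
  shows "local_maximal \<mu> a b x = 0"
proof -
  have "emeasure \<mu> ({a..b} \<inter> {p..q}) = 0" for p q
    using emeasure_mono[of "{a..b} \<inter> {p..q}" "{a..b}" \<mu>] assms by (simp del: Int_atLeastAtMost)
  then have "local_maximal \<mu> a b x \<le> 0"
    unfolding local_maximal_def by (intro SUP_least) auto
  then show ?thesis by simp
qed

text \<open>
  From the decay to the Fujii--Wilson bound on one interval. With \<open>l\<close> the average of \<open>\<mu>\<close>, the level
  set at height \<open>2 ^ Suc k * l\<close> has density at most \<open>2 ^ -k\<close>. For \<open>k \<le> K0\<close> its contribution is bounded by
  \<open>2 \<mu>{a..b}\<close> through the weak type inequality alone; beyond \<open>K0\<close> the decay applies and the contributions
  form a geometric series. The decay is assumed for countably many sets and scales, because for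
  a slice of a weight each instance of it will be known only outside a null set of slices.
\<close>

lemma integral_local_maximal_le:
  fixes a b B \<beta> \<gamma> :: real
  assumes \<mu>: "diffuse_radon \<mu>" and ab: "a \<in> \<rat>" "b \<in> \<rat>" "a < b"
    and B: "B > 1" and \<beta>: "\<beta> > 1" and \<gamma>: "\<gamma> > 0"
    and decay: "\<And>\<K> m. finite \<K> \<Longrightarrow> \<K> \<subseteq> {J \<in> \<rat> \<times> \<rat>. fst J < snd J \<and> cint J \<subseteq> {a..b}} \<Longrightarrow>
       (1/2) ^ m < exp (- \<gamma>) \<Longrightarrow>
       len (Cover \<K>) < ennreal ((1/2) ^ m * (b - a)) \<Longrightarrow>
       emeasure \<mu> (Cover \<K>) \<le> ennreal (B * ((1/2) ^ m) powr (1 / \<beta>)) * emeasure \<mu> {a..b}"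
  shows "(\<integral>\<^sup>+x\<in>{a..b}. local_maximal \<mu> a b x \<partial>lborel) \<le>
     ennreal (12 * \<beta> * (1 + max (\<gamma> / \<beta>) (ln B))) * emeasure \<mu> {a..b}"
proof -
  have s\<mu>: "sets \<mu> = sets borel" using \<mu> by (auto simp: diffuse_radon_def)
  have [measurable]: "local_maximal \<mu> a b \<in> borel_measurable borel"
    by (rule borel_measurable_local_maximal[OF s\<mu>])
  obtain i where i: "emeasure \<mu> {a..b} = ennreal i" "0 \<le> i"
  proof -
    have "emeasure \<mu> {a..b} < \<infinity>" using \<mu> by (auto simp: diffuse_radon_def)
    then show ?thesis using that by (cases "emeasure \<mu> {a..b}") auto
  qed
  show ?thesis
  proof (cases "i = 0")
    case True
    then have "local_maximal \<mu> a b x = 0" for x using i by (intro local_maximal_null s\<mu>) simp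
    then show ?thesis by simp
  next
    case False
    then have i0: "i > 0" using i by simp
    define l where "l = i / (b - a)"
    have l: "l > 0" using i0 ab by (simp add: l_def)
    define s where "s = max \<gamma> (\<beta> * ln B)"
    have s0: "s > 0" using \<gamma> by (simp add: s_def)
    \<comment> \<open>A scale with \<open>2 powr (- K0) < exp (- \<gamma>)\<close> and \<open>B * 2 powr (- K0
      / \<beta>) \<le> 1\<close>.\<close>
    define K0 where "K0 = nat \<lfloor>s / ln 2\<rfloor> + 1"
    have ln2: "ln 2 \<ge> (1/2 :: real)" using ln2_ge_two_thirds by linarith
    have K0: "s / ln 2 < real K0" "real K0 \<le> 2 * s + 1"
    proof -
      show "s / ln 2 < real K0" unfolding K0_def by linarith
      have "real K0 \<le> s / ln 2 + 1" unfolding K0_def using s0 by (simp add: of_nat_nat)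
      also have "s / ln 2 \<le> s / (1/2)" using ln2 s0 by (intro divide_left_mono) auto
      finally show "real K0 \<le> 2 * s + 1" by simp
    qed
    define r where "r = 2 powr (- (1 / \<beta>))"
    have r: "0 < r" "r < 1" using \<beta> powr_less_mono[of "- (1 / \<beta>)" 0 2] by (auto simp: r_def)
    define c where "c k = (if k \<le> K0 then 2 else 2 * r ^ (k - Suc K0))" for k :: nat
    have level: "ennreal (2 ^ Suc k * l) * len {x\<in>{a..b}. ennreal (2 ^ Suc k * l) < local_maximal \<mu> a b x}
       \<le> ennreal (c k) * ennreal i" for k
    proof -
      define \<theta> where "\<theta> = 2 ^ Suc k * l"
      have \<theta>: "\<theta> > 0" using l by (simp add: \<theta>_def)
      let ?U = "{x\<in>{a..b}. ennreal \<theta> < local_maximal \<mu> a b x}"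
      let ?P = "{J\<in>\<rat> \<times> \<rat>. fst J < snd J \<and> cint J \<subseteq> {a..b} \<and> ennreal \<theta> * len (cint J) \<le> emeasure \<mu> (cint J)}"
      have cP: "countable ?P" using countable_rat by (auto intro: countable_subset[of _ "\<rat> \<times> \<rat>"])
      have fin: "len (Cover \<K>) \<le> ennreal (c k * i / \<theta>)" if K: "finite \<K>" "\<K> \<subseteq> ?P" for \<K>
      proof -
        let ?F = "Cover \<K>"
        have "?F \<subseteq> {a..b}" using K by blast
        then have m1: "emeasure \<mu> ?F \<le> ennreal i" "len ?F \<le> len {a..b}"
          unfolding i(1)[symmetric] by (auto intro!: emeasure_mono simp: s\<mu>)
        then obtain f where f: "len ?F = ennreal f" "0 \<le> f"
          using ab by (cases "len ?F") (auto simp: top_unique)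
        obtain m where m: "emeasure \<mu> ?F = ennreal m" "0 \<le> m"
          using m1(1) by (cases "emeasure \<mu> ?F") (auto simp: top_unique)
        have mi: "m \<le> i" using m1(1) m i by simp
        have "ennreal \<theta> * len ?F \<le> 2 * emeasure \<mu> ?F"
          using K by (intro overlap_weak_type[OF s\<mu>]) auto
        then have "ennreal (\<theta> * f) \<le> ennreal (2 * m)" using f m \<theta> by (simp add: ennreal_mult)
        then have fm: "\<theta> * f \<le> 2 * m" using m by (subst (asm) ennreal_le_iff) auto
        have "\<theta> * f \<le> c k * i"
        proof (cases "k \<le> K0")
          case True then show ?thesis using fm mi by (simp add: c_def)
        next
          case False
          \<comment> \<open>The density is at most \<open>2 ^ -k\<close>, hence strictly below \<open>2 ^
            -n\<close>, as the decay hypothesis requires.\<close>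
          define n where "n = k - 1"
          have n: "k = Suc n" "K0 \<le> n" "n - K0 = k - Suc K0" using False by (auto simp: n_def)
          have "s < real K0 * ln 2" using K0(1) by (simp add: field_simps)
          also have "\<dots> \<le> real n * ln 2" using n by (intro mult_right_mono) auto
          finally have sn: "s < real n * ln 2" .
          have half: "(1/2) ^ n = exp (- (real n * ln 2))"
            by (subst exp_minus, subst powr_realpow[symmetric]) (auto simp: powr_def power_one_over inverse_eq_divide exp_of_nat_mult)
          have g: "(1/2) ^ n < exp (- \<gamma>)" unfolding half using sn by (simp add: s_def)
          have "\<theta> * f \<le> 2 * i" using fm mi by simp
          then have "f \<le> 2 * i / \<theta>" using \<theta> by (simp add: field_simps)
          also have "\<dots> = (1/2) ^ k * (b - a)" using i0 ab by (simp add: \<theta>_def l_def field_simps power_one_over)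
          also have "\<dots> < (1/2) ^ n * (b - a)" using ab by (simp add: n)
          finally have "len ?F < ennreal ((1/2) ^ n * (b - a))" using f by (simp add: ennreal_less_iff)
          from decay[OF K(1) _ g this] K(2)
          have "ennreal m \<le> ennreal (B * ((1/2) ^ n) powr (1 / \<beta>) * i)"
            using B i m by (auto simp: ennreal_mult)
          then have "m \<le> B * ((1/2) ^ n) powr (1 / \<beta>) * i"
            using B i by (subst (asm) ennreal_le_iff) auto
          also have "\<dots> \<le> r ^ (n - K0) * i"
          proof (intro mult_right_mono)
            have rn: "((1/2) ^ n) powr (1 / \<beta>) = r ^ n"
              by (simp add: half r_def powr_def exp_of_nat_mult[symmetric])
            have "B * r ^ K0 \<le> 1"
            proof -
              have "\<beta> * ln B \<le> real K0 * ln 2" using K0(1) ln2 by (simp add: s_def field_simps)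
              then have "ln B \<le> real K0 * ln 2 / \<beta>" using \<beta> by (simp add: field_simps)
              then have "B \<le> exp (real K0 * ln 2 / \<beta>)" using B by (metis exp_le_cancel_iff exp_ln less_trans zero_less_one)
              moreover have "r ^ K0 = exp (- (real K0 * ln 2 / \<beta>))"
                by (simp add: r_def powr_def exp_of_nat_mult[symmetric])
              ultimately have "B * r ^ K0 \<le> exp (real K0 * ln 2 / \<beta>) * exp (- (real K0 * ln 2 / \<beta>))"
                by (simp add: mult_right_mono)
              then show ?thesis by (simp add: exp_minus)
            qed
            then have "B * r ^ K0 * r ^ (n - K0) \<le> 1 * r ^ (n - K0)" using r by (intro mult_right_mono) auto
            moreover have "r ^ n = r ^ K0 * r ^ (n - K0)" using n by (simp flip: power_add)
            ultimately show "B * ((1/2) ^ n) powr (1 / \<beta>) \<le> r ^ (n - K0)" unfolding rn by (simp add: mult.assoc)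
          qed (use i in simp)
          finally have "m \<le> r ^ (n - K0) * i" .
          moreover have "c k = 2 * r ^ (n - K0)" unfolding n(3) using False by (simp add: c_def)
          ultimately show ?thesis using fm by simp
        qed
        then have "f \<le> c k * i / \<theta>" using \<theta> by (simp add: field_simps)
        then show ?thesis unfolding f by (rule ennreal_leI)
      qed
      have "len ?U \<le> len (\<Union>J\<in>?P. cint J)"
      proof (intro emeasure_mono subsetI)
        fix x assume "x \<in> ?U"
        then show "x \<in> (\<Union>J\<in>?P. cint J)"
          using local_maximal_level_set_cover[OF s\<mu> ab, of x "ennreal \<theta>"] by blast
      qed (use cP in \<open>auto intro!: sets.countable_UN' simp del: UN_simps\<close>)
      also have "\<dots> \<le> ennreal (c k * i / \<theta>)" by (rule emeasure_countable_cover_le[OF _ cP fin]) auto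
      finally have "ennreal \<theta> * len ?U \<le> ennreal \<theta> * ennreal (c k * i / \<theta>)"
        by (intro mult_left_mono) auto
      also have "\<dots> = ennreal (c k) * ennreal i"
        using \<theta> i r by (simp add: ennreal_mult[symmetric] c_def)
      finally show ?thesis unfolding \<theta>_def .
    qed
    have csums: "c sums (2 * inverse (1 - r) + 2 * real (Suc K0))"
    proof -
      have "(\<lambda>k. c (k + Suc K0)) = (\<lambda>k. 2 * r ^ k)" by (simp add: c_def)
      moreover have "(\<lambda>k. 2 * r ^ k) sums (2 * (1 / (1 - r)))"
        using r by (intro sums_mult geometric_sums) auto
      ultimately have "c sums (2 * (1 / (1 - r)) + (\<Sum>k<Suc K0. c k))"
        using sums_iff_shift[of c "Suc K0" "2 * (1 / (1 - r))"] by (simp only:)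
      moreover have "(\<Sum>k<Suc K0. c k) = (\<Sum>k<Suc K0. 2)" by (intro sum.cong) (auto simp: c_def)
      moreover have "(\<Sum>k<Suc K0. 2) = 2 * real (Suc K0)" by simp
      ultimately show ?thesis by (simp only: inverse_eq_divide mult_1_left times_divide_eq_right mult_1_right)
    qed
    have "(\<integral>\<^sup>+x\<in>{a..b}. local_maximal \<mu> a b x \<partial>lborel) \<le>
      (\<integral>\<^sup>+x. ennreal (2 * l) * indicator {a..b} x +
         (\<Sum>k. ennreal (2 ^ Suc k * l) * indicator {x\<in>{a..b}. ennreal (2 ^ Suc k * l) < local_maximal \<mu> a b x} x) \<partial>lborel)"
    proof (rule nn_integral_mono)
      fix x :: real
      show "local_maximal \<mu> a b x * indicator {a..b} x \<le> ennreal (2 * l) * indicator {a..b} x +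
         (\<Sum>k. ennreal (2 ^ Suc k * l) * indicator {x\<in>{a..b}. ennreal (2 ^ Suc k * l) < local_maximal \<mu> a b x} x)"
        using dyadic_layers_le[OF l, of "local_maximal \<mu> a b x"]
        by (cases "x \<in> {a..b}") (auto simp: indicator_def of_bool_def simp del: power_Suc cong: if_cong)
    qed
    also have "\<dots> = ennreal (2 * l) * len {a..b} +
       (\<Sum>k. ennreal (2 ^ Suc k * l) * len {x\<in>{a..b}. ennreal (2 ^ Suc k * l) < local_maximal \<mu> a b x})"
      by (subst nn_integral_add, simp, simp, subst nn_integral_suminf, simp)
         (simp add: nn_integral_cmult_indicator del: power_Suc)
    also have "\<dots> \<le> ennreal (2 * l) * len {a..b} + (\<Sum>k. ennreal (c k) * ennreal i)"
      by (intro add_left_mono suminf_le level) auto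
    also have "ennreal (2 * l) * len {a..b} = ennreal 2 * ennreal i"
      using ab i by (simp add: l_def ennreal_mult[symmetric] del: ennreal_numeral)
    also have "(\<Sum>k. ennreal (c k) * ennreal i) = (\<Sum>k. ennreal (c k)) * ennreal i" by simp
    also have "(\<Sum>k. ennreal (c k)) = ennreal (2 * inverse (1 - r) + 2 * real (Suc K0))"
      using r by (intro suminf_ennreal_eq csums) (auto simp: c_def)
    also have "ennreal 2 * ennreal i + ennreal (2 * inverse (1 - r) + 2 * real (Suc K0)) * ennreal i =
      ennreal (2 + (2 * inverse (1 - r) + 2 * real (Suc K0))) * ennreal i"
      using r by (subst ennreal_plus) (auto simp: distrib_right)
    also have "\<dots> \<le> ennreal (12 * \<beta> * (1 + max (\<gamma> / \<beta>) (ln B))) * ennreal i"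
    proof (intro mult_right_mono ennreal_leI)
      have "inverse (1 - r) \<le> 3 * \<beta>" unfolding r_def by (rule inverse_one_minus_two_powr_le[OF \<beta>])
      moreover have "\<beta> * max (\<gamma> / \<beta>) (ln B) = s"
        using \<beta> by (simp add: s_def max_mult_distrib_left)
      ultimately show "2 + (2 * inverse (1 - r) + 2 * real (Suc K0)) \<le> 12 * \<beta> * (1 + max (\<gamma> / \<beta>) (ln B))"
        using K0(2) \<beta> s0 by (simp add: algebra_simps)
    qed auto
    finally show ?thesis unfolding i(1) .
  qed
qed

section \<open>The Fujii--Wilson constant through rational intervals\<close>

text \<open>
  Approximate \<open>{a..b}\<close> from outside by rational intervals: the integral of the local maximal function
  only grows, and the mass converges.
\<close>

lemma fw_bound_of_rational:
  assumes \<mu>: "diffuse_radon \<mu>"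
    and rat: "\<And>a b. a \<in> \<rat> \<Longrightarrow> b \<in> \<rat> \<Longrightarrow> a < b \<Longrightarrow>
      (\<integral>\<^sup>+x\<in>{a..b}. local_maximal \<mu> a b x \<partial>lborel) \<le> ennreal A * emeasure \<mu> {a..b}"
  shows "fw_bound \<mu> A"
  unfolding fw_bound_def
proof (intro allI impI)
  fix a b :: real assume ab: "a < b"
  have s\<mu>: "sets \<mu> = sets borel" and fin: "\<And>a b. emeasure \<mu> {a..b} \<noteq> \<infinity>"
    using \<mu> by (auto simp: diffuse_radon_def less_top)
  define I where "I n = {a - inverse (real (Suc n))..b + inverse (real (Suc n))}" for n
  have dec: "decseq I"
    unfolding decseq_def I_def
  proof (intro allI impI)
    fix m n :: nat assume "m \<le> n"
    then have "inverse (real (Suc n)) \<le> inverse (real (Suc m))" by (intro le_imp_inverse_le) auto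
    then show "{a - inverse (real (Suc n))..b + inverse (real (Suc n))} \<subseteq> {a - inverse (real (Suc m))..b + inverse (real (Suc m))}"
      by auto
  qed
  have "(\<Inter>n. I n) = {a..b}"
  proof
    show "(\<Inter>n. I n) \<subseteq> {a..b}"
    proof
      fix x assume x: "x \<in> (\<Inter>n. I n)"
      have "a \<le> x"
      proof (rule ccontr)
        assume "\<not> a \<le> x"
        then obtain n where "inverse (real (Suc n)) < a - x" using reals_Archimedean[of "a - x"] by auto
        moreover have "x \<in> I n" using x by blast
        ultimately show False by (simp add: I_def)
      qed
      moreover have "x \<le> b"
      proof (rule ccontr)
        assume "\<not> x \<le> b"
        then obtain n where "inverse (real (Suc n)) < x - b" using reals_Archimedean[of "x - b"] by auto
        moreover have "x \<in> I n" using x by blast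
        ultimately show False by (simp add: I_def)
      qed
      ultimately show "x \<in> {a..b}" by simp
    qed
    show "{a..b} \<subseteq> (\<Inter>n. I n)"
    proof (intro INT_greatest subsetI)
      fix n x assume "x \<in> {a..b}"
      moreover have "0 < inverse (real (Suc n))" by simp
      ultimately show "x \<in> I n" unfolding I_def atLeastAtMost_iff by linarith
    qed
  qed
  then have inf: "(INF n. emeasure \<mu> (I n)) = emeasure \<mu> {a..b}"
  proof -
    have "range I \<subseteq> sets \<mu>" "\<And>n. emeasure \<mu> (I n) \<noteq> \<infinity>" using fin by (auto simp: I_def s\<mu>)
    from INF_emeasure_decseq[OF this(1) dec this(2)] show ?thesis unfolding \<open>(\<Inter>n. I n) = {a..b}\<close> .
  qed
  let ?L = "\<integral>\<^sup>+x\<in>{a..b}. local_maximal \<mu> a b x \<partial>lborel"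
  have each: "?L \<le> ennreal A * emeasure \<mu> (I n)" for n
  proof -
    define e where "e = inverse (real (Suc n))"
    have e: "e > 0" by (simp add: e_def)
    obtain p where p: "p \<in> \<rat>" "a - e < p" "p < a" using Rats_dense_in_real[of "a - e" a] e by auto
    obtain q where q: "q \<in> \<rat>" "b < q" "q < b + e" using Rats_dense_in_real[of b "b + e"] e by auto
    have "?L \<le> (\<integral>\<^sup>+x\<in>{p..q}. local_maximal \<mu> p q x \<partial>lborel)"
    proof (intro nn_integral_mono mult_mono)
      fix x
      show "local_maximal \<mu> a b x \<le> local_maximal \<mu> p q x"
        unfolding local_maximal_def
      proof (rule SUP_mono)
        fix J :: "real \<times> real" assume J: "J \<in> {(p, q). p < q \<and> x \<in> {p..q}}"
        have "emeasure \<mu> ({a..b} \<inter> {fst J..snd J}) \<le> emeasure \<mu> ({p..q} \<inter> {fst J..snd J})"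
          using p q by (intro emeasure_mono) (auto simp: s\<mu>)
        then show "\<exists>m\<in>{(p, q). p < q \<and> x \<in> {p..q}}.
            (case J of (pa, qa) \<Rightarrow> emeasure \<mu> ({a..b} \<inter> {pa..qa}) / ennreal (qa - pa))
            \<le> (case m of (pa, qa) \<Rightarrow> emeasure \<mu> ({p..q} \<inter> {pa..qa}) / ennreal (qa - pa))"
          using J by (intro bexI[of _ J]) (auto intro: divide_right_mono_ennreal split: prod.splits simp del: Int_atLeastAtMost)
      qed
    qed (use p q in \<open>auto simp: indicator_def\<close>)
    also have "\<dots> \<le> ennreal A * emeasure \<mu> {p..q}" using p q ab by (intro rat) auto
    also have "\<dots> \<le> ennreal A * emeasure \<mu> (I n)"
      using p q by (intro mult_left_mono emeasure_mono) (auto simp: I_def e_def s\<mu>)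
    finally show ?thesis .
  qed
  show "?L \<le> ennreal A * emeasure \<mu> {a..b}"
  proof (cases "ennreal A = 0")
    case True
    then show ?thesis using each[of 0] by simp
  next
    case False
    have "?L / ennreal A \<le> emeasure \<mu> {a..b}"
      unfolding inf[symmetric]
      using each False by (intro INF_greatest divide_le_posI_ennreal) (auto simp: mult.commute zero_less_iff_neq_zero)
    then have "ennreal A * (?L / ennreal A) \<le> ennreal A * emeasure \<mu> {a..b}" by (intro mult_left_mono) auto
    moreover have "ennreal A * (?L / ennreal A) = ?L"
      using False by (metis ennreal_neq_top ennreal_times_divide mult.commute mult_divide_eq_ennreal)
    ultimately show ?thesis by simp
  qed
qed

lemma local_maximal_eq_countable_SUP:
  assumes \<mu>: "sets \<mu> = sets borel"
  shows "local_maximal \<mu> a b x =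
    (SUP J\<in>{J\<in>\<rat> \<times> \<rat>. fst J < snd J}. emeasure \<mu> ({a..b} \<inter> cint J) / ennreal (snd J - fst J) * indicator {fst J<..<snd J} x)"
    (is "_ = ?R")
proof -
  have *: "l < local_maximal \<mu> a b x \<longleftrightarrow> l < ?R" for l
  proof -
    have "l < ?R \<longleftrightarrow> (\<exists>J\<in>{J\<in>\<rat> \<times> \<rat>. fst J < snd J}. fst J < x \<and> x < snd J \<and>
       l < emeasure \<mu> ({a..b} \<inter> cint J) / ennreal (snd J - fst J))"
      unfolding less_SUP_iff
    proof (intro bex_cong refl)
      fix J :: "real \<times> real"
      show "l < emeasure \<mu> ({a..b} \<inter> cint J) / ennreal (snd J - fst J) * indicator {fst J<..<snd J} x \<longleftrightarrow>
        fst J < x \<and> x < snd J \<and> l < emeasure \<mu> ({a..b} \<inter> cint J) / ennreal (snd J - fst J)"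
        by (cases "x \<in> {fst J<..<snd J}") auto
    qed
    also have "\<dots> \<longleftrightarrow> (\<exists>J\<in>{J\<in>\<rat> \<times> \<rat>. fst J < snd J}. fst J < x \<and> x < snd J \<and>
       l * ennreal (snd J - fst J) < emeasure \<mu> ({a..b} \<inter> cint J))"
      by (intro bex_cong refl conj_cong less_divide_ennreal_iff) auto
    also have "\<dots> \<longleftrightarrow> l < local_maximal \<mu> a b x"
    proof
      assume "\<exists>J\<in>{J\<in>\<rat> \<times> \<rat>. fst J < snd J}. fst J < x \<and> x < snd J \<and>
         l * ennreal (snd J - fst J) < emeasure \<mu> ({a..b} \<inter> cint J)"
      then obtain J where "J \<in> \<rat> \<times> \<rat>" "fst J < x" "x < snd J"
        "l * ennreal (snd J - fst J) < emeasure \<mu> ({a..b} \<inter> cint J)" by blast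
      then show "l < local_maximal \<mu> a b x"
        unfolding local_maximal_greater_iff[OF \<mu>]
        by (intro bexI[of _ "fst J"] bexI[of _ "snd J"]) (simp_all add: mem_Times_iff cint_def del: Int_atLeastAtMost)
    next
      assume "l < local_maximal \<mu> a b x"
      then obtain p q where "p \<in> \<rat>" "q \<in> \<rat>" "p < x" "x < q" "l * ennreal (q - p) < emeasure \<mu> ({a..b} \<inter> {p..q})"
        unfolding local_maximal_greater_iff[OF \<mu>] by blast
      then show "\<exists>J\<in>{J\<in>\<rat> \<times> \<rat>. fst J < snd J}. fst J < x \<and> x < snd J \<and>
         l * ennreal (snd J - fst J) < emeasure \<mu> ({a..b} \<inter> cint J)"
        by (intro bexI[of _ "(p, q)"]) (simp_all add: cint_def del: Int_atLeastAtMost)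
    qed
    finally show ?thesis by simp
  qed
  have "\<not> local_maximal \<mu> a b x < ?R" "\<not> ?R < local_maximal \<mu> a b x"
    unfolding *[of "local_maximal \<mu> a b x", symmetric] *[of ?R] by (rule less_irrefl)+
  then show ?thesis by (intro antisym) (simp_all only: not_less)
qed

definition fw_quotient :: "real measure \<Rightarrow> real \<times> real \<Rightarrow> ennreal" where
  "fw_quotient \<mu> J = (\<integral>\<^sup>+x\<in>cint J. local_maximal \<mu> (fst J) (snd J) x \<partial>lborel) / emeasure \<mu> (cint J)"

text \<open>
  The division convention at a null interval is harmless because the local maximal function vanishes
  there.
\<close>

lemma fw_quotient_le_iff:
  assumes \<mu>: "diffuse_radon \<mu>" and A: "0 \<le> A"
  shows "fw_quotient \<mu> (a, b) \<le> ennreal A \<longleftrightarrow>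
    (\<integral>\<^sup>+x\<in>{a..b}. local_maximal \<mu> a b x \<partial>lborel) \<le> ennreal A * emeasure \<mu> {a..b}"
proof (cases "emeasure \<mu> {a..b} = 0")
  case True
  then show ?thesis using \<mu> local_maximal_null[of \<mu> a b]
    by (simp add: fw_quotient_def cint_def diffuse_radon_def)
next
  case False
  have "emeasure \<mu> {a..b} < \<infinity>" using \<mu> by (simp add: diffuse_radon_def)
  then obtain i where i: "emeasure \<mu> {a..b} = ennreal i" "0 < i"
    using False by (cases "emeasure \<mu> {a..b}") (auto simp: ennreal_eq_0_iff)
  show ?thesis
    using less_divide_ennreal_iff[OF i(2), of "ennreal A" "\<integral>\<^sup>+x\<in>{a..b}. local_maximal \<mu> a b x \<partial>lborel"]
    by (simp add: fw_quotient_def cint_def i(1) flip: not_less)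
qed

lemma SUP_fw_quotient_le_iff:
  assumes \<mu>: "diffuse_radon \<mu>" and A: "0 \<le> A"
  shows "(SUP J\<in>{J. fst J < snd J}. fw_quotient \<mu> J) \<le> ennreal A \<longleftrightarrow> fw_bound \<mu> A"
  unfolding SUP_le_iff fw_bound_def fw_quotient_le_iff[OF \<mu> A, symmetric] by auto

lemma SUP_fw_quotient_rational:
  assumes \<mu>: "diffuse_radon \<mu>"
  shows "(SUP J\<in>{J. fst J < snd J}. fw_quotient \<mu> J) = (SUP J\<in>{J\<in>\<rat> \<times> \<rat>. fst J < snd J}. fw_quotient \<mu> J)"
    (is "?A = ?B")
proof (rule antisym)
  show "?B \<le> ?A" by (rule SUP_subset_mono) auto
  show "?A \<le> ?B"
  proof (cases ?B)
    case (real A)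
    have "fw_bound \<mu> A"
    proof (rule fw_bound_of_rational[OF \<mu>])
      fix a b :: real assume ab: "a \<in> \<rat>" "b \<in> \<rat>" "a < b"
      have "fw_quotient \<mu> (a, b) \<le> ?B" using ab by (intro SUP_upper) auto
      then show "(\<integral>\<^sup>+x\<in>{a..b}. local_maximal \<mu> a b x \<partial>lborel) \<le> ennreal A * emeasure \<mu> {a..b}"
        unfolding real(2) fw_quotient_le_iff[OF \<mu> real(1)] .
    qed
    then show ?thesis unfolding real(2) SUP_fw_quotient_le_iff[OF \<mu> real(1)] .
  next
    case top
    then show ?thesis by (metis top_greatest)
  qed
qed

lemma fujii_wilson_eq_SUP_fw_quotient:
  assumes v: "v \<in> borel_measurable borel" "\<And>t. 0 \<le> v t"
  shows "fujii_wilson v = (SUP J\<in>{J. fst J < snd J}. fw_quotient (density lborel (\<lambda>t. ennreal (v t))) J)"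
proof -
  define \<mu> where "\<mu> = density lborel (\<lambda>t. ennreal (v t))"
  have e\<mu>: "emeasure \<mu> S = (\<integral>\<^sup>+t\<in>S. ennreal (v t) \<partial>lborel)" if "S \<in> sets borel" for S
    unfolding \<mu>_def using v that by (intro emeasure_density) auto
  have max: "maximal1 (\<lambda>t. v t * indicator {a..b} t) x = local_maximal \<mu> a b x" for a b x
    unfolding maximal1_def local_maximal_def
  proof (intro SUP_cong refl)
    fix J :: "real \<times> real" assume "J \<in> {(a, b). a < b \<and> x \<in> {a..b}}"
    show "(case J of (p, q) \<Rightarrow> (\<integral>\<^sup>+y\<in>{p..q}. ennreal \<bar>v y * indicator {a..b} y\<bar> \<partial>lebesgue) / ennreal (q - p)) =
      (case J of (p, q) \<Rightarrow> emeasure \<mu> ({a..b} \<inter> {p..q}) / ennreal (q - p))"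
    proof (cases J)
      case (Pair p q)
      have "(\<integral>\<^sup>+y\<in>{p..q}. ennreal \<bar>v y * indicator {a..b} y\<bar> \<partial>lebesgue) = (\<integral>\<^sup>+y\<in>{a..b} \<inter> {p..q}. ennreal (v y) \<partial>lborel)"
        unfolding nn_integral_completion using v(2)
        by (intro nn_integral_cong) (auto simp: indicator_def)
      then show ?thesis using Pair by (simp add: e\<mu> del: Int_atLeastAtMost)
    qed
  qed
  show ?thesis
    unfolding fujii_wilson_def max nn_integral_completion \<mu>_def[symmetric]
    by (intro arg_cong[where f=Sup] image_cong) (auto simp: fw_quotient_def e\<mu> cint_def)
qed

text \<open>
  Only lower integrals over a completion enter \<open>fujii_wilson\<close>, and these ignore null sets for arbitrary
  functions.
\<close>

lemma fujii_wilson_cong_AE: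
  assumes "AE t in lborel. v t = v' t"
  shows "fujii_wilson v = fujii_wilson v'"
proof -
  have max: "maximal1 (\<lambda>t. v t * indicator {a..b} t) = maximal1 (\<lambda>t. v' t * indicator {a..b} t)" for a b :: real
  proof
    fix x
    have "(\<integral>\<^sup>+y\<in>{p..q}. ennreal \<bar>v y * indicator {a..b} y\<bar> \<partial>lebesgue) = (\<integral>\<^sup>+y\<in>{p..q}. ennreal \<bar>v' y * indicator {a..b} y\<bar> \<partial>lebesgue)" for p q
      unfolding nn_integral_completion using assms by (intro nn_integral_cong_AE) auto
    then show "maximal1 (\<lambda>t. v t * indicator {a..b} t) x = maximal1 (\<lambda>t. v' t * indicator {a..b} t) x"
      by (simp add: maximal1_def)
  qed
  have "(\<integral>\<^sup>+x\<in>{a..b}. ennreal (v x) \<partial>lebesgue) = (\<integral>\<^sup>+x\<in>{a..b}. ennreal (v' x) \<partial>lebesgue)" for a b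
    unfolding nn_integral_completion using assms by (intro nn_integral_cong_AE) auto
  then show ?thesis by (simp add: fujii_wilson_def max)
qed

section \<open>Slices and directional enlargement\<close>

interpretation lborel_prod: product_sigma_finite "\<lambda>_::nat. lborel :: real measure"
  by standard

abbreviation leb_prod :: "nat set \<Rightarrow> (nat \<Rightarrow> real) measure" where
  "leb_prod J \<equiv> Pi\<^sub>M J (\<lambda>_. lborel)"

abbreviation pbox :: "nat set \<Rightarrow> (nat \<Rightarrow> real) \<Rightarrow> (nat \<Rightarrow> real) \<Rightarrow> (nat \<Rightarrow> real) set" where
  "pbox J a b \<equiv> Pi\<^sub>E J (\<lambda>i. {a i..b i})"

abbreviation maximal_level :: "nat \<Rightarrow> (nat \<Rightarrow> real) set \<Rightarrow> real \<Rightarrow> (nat \<Rightarrow> real) set" where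
  "maximal_level n E \<alpha> \<equiv> {x \<in> space (leb {..<n}). strong_maximal n (indicator E) x > ennreal \<alpha>}"

lemma measurable_upd_leb_prod [measurable]:
  "j \<in> J \<Longrightarrow> (\<lambda>z. (fst z)(j := snd z)) \<in> leb_prod J \<Otimes>\<^sub>M lborel \<rightarrow>\<^sub>M leb_prod J"
  by (rule measurable_fun_upd[where J=J]) (auto simp: insert_absorb)

lemma measurable_upd_leb_prod_minus [measurable]:
  assumes "j \<in> J"
  shows "(\<lambda>z. (fst z)(j := snd z)) \<in> leb_prod (J - {j}) \<Otimes>\<^sub>M lborel \<rightarrow>\<^sub>M leb_prod J"
  using assms by (intro measurable_fun_upd[where J="J - {j}"]) auto

lemma space_upd: "j \<in> J \<Longrightarrow> x \<in> space (leb_prod J) \<Longrightarrow> x(j := t) \<in> space (leb_prod J)"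
  by (auto simp: space_PiM PiE_def extensional_def)

lemma space_upd_minus: "j \<in> J \<Longrightarrow> y \<in> space (leb_prod (J - {j})) \<Longrightarrow> y(j := t) \<in> space (leb_prod J)"
  by (auto simp: space_PiM PiE_def extensional_def)

lemma measurable_slice:
  assumes "j \<in> J" "f \<in> leb_prod J \<rightarrow>\<^sub>M N" "y \<in> space (leb_prod (J - {j}))"
  shows "(\<lambda>t. f (y(j := t))) \<in> borel \<rightarrow>\<^sub>M N"
proof -
  have "(\<lambda>t. (y, t)) \<in> lborel \<rightarrow>\<^sub>M leb_prod (J - {j}) \<Otimes>\<^sub>M lborel" using assms(3) by simp
  from measurable_compose[OF measurable_compose[OF this measurable_upd_leb_prod_minus[OF assms(1)]] assms(2)]
  show ?thesis by simp
qed

lemma sets_slice: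
  assumes "j \<in> J" "E \<in> sets (leb_prod J)" "x \<in> space (leb_prod J)"
  shows "{t. x(j := t) \<in> E} \<in> sets borel"
proof -
  have "(\<lambda>t. (x, t)) \<in> lborel \<rightarrow>\<^sub>M leb_prod J \<Otimes>\<^sub>M lborel" using assms(3) by simp
  from measurable_compose[OF this measurable_upd_leb_prod[OF assms(1)]]
  have "(\<lambda>t. x(j := t)) \<in> lborel \<rightarrow>\<^sub>M leb_prod J" by simp
  from measurable_sets[OF this assms(2)] show ?thesis by (simp add: vimage_def)
qed

lemma sets_slice_minus:
  assumes "j \<in> J" "E \<in> sets (leb_prod J)" "y \<in> space (leb_prod (J - {j}))"
  shows "{t. y(j := t) \<in> E} \<in> sets borel"
  using sets_slice[OF assms(1,2) space_upd_minus[OF assms(1,3), of 0]] by simp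

lemma nn_integral_leb_prod_slice:
  assumes "finite J" "j \<in> J" "f \<in> borel_measurable (leb_prod J)"
  shows "integral\<^sup>N (leb_prod J) f = (\<integral>\<^sup>+y. (\<integral>\<^sup>+t. f (y(j := t)) \<partial>lborel) \<partial>leb_prod (J - {j}))"
  using lborel_prod.product_nn_integral_insert[of "J - {j}" j f] assms by (simp add: insert_absorb)

definition slice_measure :: "nat \<Rightarrow> ((nat \<Rightarrow> real) \<Rightarrow> real) \<Rightarrow> (nat \<Rightarrow> real) \<Rightarrow> real measure" where
  "slice_measure j w y = density lborel (\<lambda>t. ennreal (w (y(j := t))))"

lemma emeasure_slice_measure:
  assumes "j \<in> J" "w \<in> borel_measurable (leb_prod J)" "y \<in> space (leb_prod (J - {j}))" "S \<in> sets borel"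
  shows "emeasure (slice_measure j w y) S = (\<integral>\<^sup>+t\<in>S. ennreal (w (y(j := t))) \<partial>lborel)"
  unfolding slice_measure_def using assms measurable_slice[OF assms(1-3)]
  by (intro emeasure_density) auto

definition directional_hull :: "nat set \<Rightarrow> real \<Rightarrow> nat \<Rightarrow> (nat \<Rightarrow> real) set \<Rightarrow> (nat \<Rightarrow> real) set" where
  "directional_hull J \<delta> j E = {x \<in> space (leb_prod J). x j \<in> density_hull \<delta> {t. x(j := t) \<in> E}}"

lemma measurable_emeasure_slice:
  assumes j: "j \<in> J" and E: "E \<in> sets (leb_prod J)" and S: "S \<in> sets borel"
  shows "(\<lambda>x. len (S - {t. x(j := t) \<in> E})) \<in> borel_measurable (leb_prod J)"
proof -
  have "(\<lambda>x. \<integral>\<^sup>+t. indicator S t * (1 - indicator E (x(j := t))) \<partial>lborel) \<in> borel_measurable (leb_prod J)"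
  proof (rule lborel.borel_measurable_nn_integral)
    have [measurable]: "(indicator E :: _ \<Rightarrow> ennreal) \<in> borel_measurable (leb_prod J)" using E by simp
    have "(\<lambda>z. indicator E ((fst z)(j := snd z)) :: ennreal) \<in> borel_measurable (leb_prod J \<Otimes>\<^sub>M lborel)"
      by (rule measurable_compose[OF measurable_upd_leb_prod[OF j]]) measurable
    moreover have "(\<lambda>z. indicator S (snd z) :: ennreal) \<in> borel_measurable (leb_prod J \<Otimes>\<^sub>M lborel)"
      using S by (intro measurable_compose[OF measurable_snd]) auto
    ultimately show "(\<lambda>(x, t). indicator S t * (1 - indicator E (x(j := t))) :: ennreal) \<in> borel_measurable (leb_prod J \<Otimes>\<^sub>M lborel)"
      by (simp add: case_prod_beta')
  qed
  moreover have "(\<integral>\<^sup>+t. indicator S t * (1 - indicator E (x(j := t))) \<partial>lborel) = len (S - {t. x(j := t) \<in> E})"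
    if "x \<in> space (leb_prod J)" for x
  proof -
    have "(\<integral>\<^sup>+t. indicator S t * (1 - indicator E (x(j := t))) \<partial>lborel) = (\<integral>\<^sup>+t. indicator (S - {t. x(j := t) \<in> E}) t \<partial>lborel)"
      by (intro nn_integral_cong) (auto simp: indicator_def)
    also have "\<dots> = len (S - {t. x(j := t) \<in> E})"
      using S sets_slice[OF j E that] by (intro nn_integral_indicator) auto
    finally show ?thesis .
  qed
  ultimately show ?thesis by (simp cong: measurable_cong)
qed

lemma sets_directional_hull:
  assumes j: "j \<in> J" and E: "E \<in> sets (leb_prod J)"
  shows "directional_hull J \<delta> j E \<in> sets (leb_prod J)"
proof -
  let ?Q = "{I \<in> \<rat> \<times> \<rat>. fst I < (snd I :: real)}"
  have cQ: "countable ?Q" using countable_rat by (auto intro: countable_subset[of _ "\<rat> \<times> \<rat>"])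
  have "directional_hull J \<delta> j E = (\<Union>I\<in>?Q. {x \<in> space (leb_prod J). x j \<in> cint I \<and>
      len (cint I - {t. x(j := t) \<in> E}) < ennreal (\<delta> * (snd I - fst I))})"
    unfolding directional_hull_def density_hull_def by blast
  also have "\<dots> \<in> sets (leb_prod J)"
  proof (rule sets.countable_UN'[OF cQ], rule image_subsetI)
    fix I :: "real \<times> real"
    have comp: "(\<lambda>x. x j) \<in> borel_measurable (leb_prod J)"
      using j measurable_component_singleton[of j J "\<lambda>_. lborel :: real measure"] by simp
    have "{x \<in> space (leb_prod J). x j \<in> cint I \<and>
        len (cint I - {t. x(j := t) \<in> E}) < ennreal (\<delta> * (snd I - fst I))} =
      ((\<lambda>x. x j) -` cint I \<inter> space (leb_prod J)) \<inter> {x \<in> space (leb_prod J).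
        len (cint I - {t. x(j := t) \<in> E}) < ennreal (\<delta> * (snd I - fst I))}"
      by blast
    also have "\<dots> \<in> sets (leb_prod J)"
      by (intro sets.Int measurable_sets[OF comp] borel_measurable_less[OF measurable_emeasure_slice[OF j E]]) simp_all
    finally show "{x \<in> space (leb_prod J). x j \<in> cint I \<and>
      len (cint I - {t. x(j := t) \<in> E}) < ennreal (\<delta> * (snd I - fst I))} \<in> sets (leb_prod J)" .
  qed
  finally show ?thesis .
qed

lemma measurable_slice_mass:
  assumes j: "j \<in> J" and w: "w \<in> borel_measurable (leb_prod J)" and D: "D \<in> sets (leb_prod J)"
  shows "(\<lambda>y. emeasure (slice_measure j w y) {t. y(j := t) \<in> D}) \<in> borel_measurable (leb_prod (J - {j}))"
proof -
  have "(\<lambda>y. \<integral>\<^sup>+t. ennreal (w (y(j := t))) * indicator D (y(j := t)) \<partial>lborel) \<in> borel_measurable (leb_prod (J - {j}))"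
  proof (rule lborel.borel_measurable_nn_integral)
    have "(\<lambda>x. ennreal (w x) * indicator D x) \<in> borel_measurable (leb_prod J)" using w D by simp
    from measurable_compose[OF measurable_upd_leb_prod_minus[OF j] this]
    show "(\<lambda>(y, t). ennreal (w (y(j := t))) * indicator D (y(j := t))) \<in> borel_measurable (leb_prod (J - {j}) \<Otimes>\<^sub>M lborel)"
      by (simp add: case_prod_beta')
  qed
  moreover have "(\<integral>\<^sup>+t. ennreal (w (y(j := t))) * indicator D (y(j := t)) \<partial>lborel) =
      emeasure (slice_measure j w y) {t. y(j := t) \<in> D}" if y: "y \<in> space (leb_prod (J - {j}))" for y
    using emeasure_slice_measure[OF j w y sets_slice_minus[OF j D y]] by (simp add: indicator_def)
  ultimately show ?thesis by (simp cong: measurable_cong)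
qed

lemma nn_integral_slice_mass:
  assumes J: "finite J" "j \<in> J" and w: "w \<in> borel_measurable (leb_prod J)" and D: "D \<in> sets (leb_prod J)"
  shows "(\<integral>\<^sup>+x\<in>D. ennreal (w x) \<partial>leb_prod J) =
     (\<integral>\<^sup>+y. emeasure (slice_measure j w y) {t. y(j := t) \<in> D} \<partial>leb_prod (J - {j}))"
proof -
  have "(\<integral>\<^sup>+x\<in>D. ennreal (w x) \<partial>leb_prod J) =
     (\<integral>\<^sup>+y. (\<integral>\<^sup>+t. ennreal (w (y(j := t))) * indicator D (y(j := t)) \<partial>lborel) \<partial>leb_prod (J - {j}))"
    using w D by (subst nn_integral_leb_prod_slice[OF J]) auto
  also have "\<dots> = (\<integral>\<^sup>+y. emeasure (slice_measure j w y) {t. y(j := t) \<in> D} \<partial>leb_prod (J - {j}))"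
  proof (rule nn_integral_cong)
    fix y assume y: "y \<in> space (leb_prod (J - {j}))"
    show "(\<integral>\<^sup>+t. ennreal (w (y(j := t))) * indicator D (y(j := t)) \<partial>lborel) =
      emeasure (slice_measure j w y) {t. y(j := t) \<in> D}"
      using emeasure_slice_measure[OF J(2) w y sets_slice_minus[OF J(2) D y]]
      by (simp add: indicator_def)
  qed
  finally show ?thesis .
qed

text \<open>
  The estimate on the line, integrated over all lines in direction \<open>j\<close>.
\<close>

lemma weight_directional_hull_le:
  fixes w :: "(nat \<Rightarrow> real) \<Rightarrow> real"
  assumes J: "finite J" "j \<in> J" and w: "w \<in> borel_measurable (leb_prod J)"
    and E: "E \<in> sets (leb_prod J)"
    and \<delta>: "0 < \<delta>" "\<delta> < exp (- (144 * A))"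
    and fw: "AE y in leb_prod (J - {j}). diffuse_radon (slice_measure j w y) \<and> fw_bound (slice_measure j w y) A"
  shows "(\<integral>\<^sup>+x\<in>directional_hull J \<delta> j E. ennreal (w x) \<partial>leb_prod J)
    \<le> ennreal (1 + 8 * \<delta> powr (inverse (144 * A))) * (\<integral>\<^sup>+x\<in>E. ennreal (w x) \<partial>leb_prod J)"
proof -
  let ?c = "ennreal (1 + 8 * \<delta> powr (inverse (144 * A)))"
  have "(\<integral>\<^sup>+x\<in>directional_hull J \<delta> j E. ennreal (w x) \<partial>leb_prod J) =
    (\<integral>\<^sup>+y. emeasure (slice_measure j w y) {t. y(j := t) \<in> directional_hull J \<delta> j E} \<partial>leb_prod (J - {j}))"
    by (rule nn_integral_slice_mass[OF J w sets_directional_hull[OF J(2) E]])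
  also have "\<dots> \<le> (\<integral>\<^sup>+y. ?c * emeasure (slice_measure j w y) {t. y(j := t) \<in> E} \<partial>leb_prod (J - {j}))"
  proof (rule nn_integral_mono_AE)
    show "AE y in leb_prod (J - {j}). emeasure (slice_measure j w y) {t. y(j := t) \<in> directional_hull J \<delta> j E}
      \<le> ?c * emeasure (slice_measure j w y) {t. y(j := t) \<in> E}"
      using fw AE_space
    proof eventually_elim
      case (elim y)
      have "{t. y(j := t) \<in> directional_hull J \<delta> j E} = density_hull \<delta> {t. y(j := t) \<in> E}"
        using space_upd_minus[OF J(2) elim(2)] by (auto simp: directional_hull_def)
      then show ?case
        using emeasure_density_hull_le[of "slice_measure j w y" A "{t. y(j := t) \<in> E}" \<delta>] elim \<delta>
          sets_slice_minus[OF J(2) E elim(2)] by simp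
    qed
  qed
  also have "\<dots> = ?c * (\<integral>\<^sup>+y. emeasure (slice_measure j w y) {t. y(j := t) \<in> E} \<partial>leb_prod (J - {j}))"
    by (rule nn_integral_cmult[OF measurable_slice_mass[OF J(2) w E]])
  finally show ?thesis unfolding nn_integral_slice_mass[OF J w E] .
qed

primrec iterated_hull :: "nat set \<Rightarrow> real \<Rightarrow> (nat \<Rightarrow> real) set \<Rightarrow> nat \<Rightarrow> (nat \<Rightarrow> real) set" where
  "iterated_hull J \<delta> E 0 = E"
| "iterated_hull J \<delta> E (Suc k) = directional_hull J \<delta> k (iterated_hull J \<delta> E k)"

lemma sets_iterated_hull:
  assumes "E \<in> sets (leb_prod {..<n})" "k \<le> n"
  shows "iterated_hull {..<n} \<delta> E k \<in> sets (leb_prod {..<n})"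
  using assms(2) by (induction k) (auto intro: assms(1) sets_directional_hull)

lemma weight_iterated_hull_le:
  fixes w :: "(nat \<Rightarrow> real) \<Rightarrow> real"
  assumes w: "w \<in> borel_measurable (leb_prod {..<n})" and E: "E \<in> sets (leb_prod {..<n})"
    and \<delta>: "0 < \<delta>" "\<delta> < exp (- (144 * A))"
    and fw: "\<And>j. j < n \<Longrightarrow> AE y in leb_prod ({..<n} - {j}). diffuse_radon (slice_measure j w y) \<and> fw_bound (slice_measure j w y) A"
    and k: "k \<le> n"
  shows "(\<integral>\<^sup>+x\<in>iterated_hull {..<n} \<delta> E k. ennreal (w x) \<partial>leb_prod {..<n})
    \<le> ennreal ((1 + 8 * \<delta> powr (inverse (144 * A))) ^ k) * (\<integral>\<^sup>+x\<in>E. ennreal (w x) \<partial>leb_prod {..<n})"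
  using k
proof (induction k)
  case (Suc k)
  let ?c = "1 + 8 * \<delta> powr (inverse (144 * A))"
  have c: "?c \<ge> 0" by (simp add: add_nonneg_nonneg)
  have "(\<integral>\<^sup>+x\<in>iterated_hull {..<n} \<delta> E (Suc k). ennreal (w x) \<partial>leb_prod {..<n})
    \<le> ennreal ?c * (\<integral>\<^sup>+x\<in>iterated_hull {..<n} \<delta> E k. ennreal (w x) \<partial>leb_prod {..<n})"
    unfolding iterated_hull.simps using Suc.prems
    by (intro weight_directional_hull_le w \<delta> fw sets_iterated_hull E) auto
  also have "\<dots> \<le> ennreal ?c * (ennreal (?c ^ k) * (\<integral>\<^sup>+x\<in>E. ennreal (w x) \<partial>leb_prod {..<n}))"
    using Suc by (intro mult_left_mono) auto
  also have "\<dots> = ennreal (?c ^ Suc k) * (\<integral>\<^sup>+x\<in>E. ennreal (w x) \<partial>leb_prod {..<n})"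
    using c by (simp only: mult.assoc[symmetric] ennreal_mult[symmetric] zero_le_power power_Suc)
  finally show ?case .
qed simp

text \<open>
  Replacing the first \<open>k\<close> coordinates of \<open>x\<close> by those of \<open>y\<close> parametrises the \<open>k\<close>-dimensional plane
  through \<open>x\<close>; this is what the induction over the dimension runs on.
\<close>

definition overlay :: "nat \<Rightarrow> (nat \<Rightarrow> real) \<Rightarrow> (nat \<Rightarrow> real) \<Rightarrow> nat \<Rightarrow> real" where
  "overlay k y x = (\<lambda>i. if i < k then y i else x i)"

lemma measurable_overlay:
  assumes "x \<in> space (leb_prod {..<n})" "k \<le> n"
  shows "(\<lambda>y. overlay k y x) \<in> leb_prod {..<k} \<rightarrow>\<^sub>M leb_prod {..<n}"
proof (rule measurable_PiM_single')
  fix i assume "i \<in> {..<n}"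
  show "(\<lambda>y. overlay k y x i) \<in> leb_prod {..<k} \<rightarrow>\<^sub>M lborel"
  proof (cases "i < k")
    case True
    then have "(\<lambda>y. overlay k y x i) = (\<lambda>y. y i)" by (simp add: overlay_def)
    then show ?thesis using measurable_component_singleton[of i "{..<k}" "\<lambda>_. lborel :: real measure"] True by simp
  next
    case False
    then have "(\<lambda>y. overlay k y x i) = (\<lambda>y. x i)" by (simp add: overlay_def)
    then show ?thesis by simp
  qed
next
  show "(\<lambda>y. overlay k y x) \<in> space (leb_prod {..<k}) \<rightarrow> {..<n} \<rightarrow>\<^sub>E space lborel"
    using assms by (auto simp: overlay_def space_PiM PiE_def extensional_def)
qed

text \<open>
  By induction over \<open>k\<close>: if \<open>E\<close> misses less than the proportion \<open>\<delta> ^ Suc k\<close> of a \<open>Suc k\<close>-dimensional box,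
  then by Chebyshev's inequality all but a proportion \<open>\<delta>\<close> of its \<open>k\<close>-dimensional sections have less than
  \<open>\<delta> ^ k\<close> missing. By the induction hypothesis these sections lie in the first \<open>k\<close> hulls, and the last
  hull fills the remaining direction.
\<close>

lemma dense_box_subset_iterated_hull:
  fixes a b :: "nat \<Rightarrow> real"
  assumes E: "E \<in> sets (leb_prod {..<n})" and \<delta>: "0 < \<delta>"
    and ab: "\<And>i. i < n \<Longrightarrow> a i < b i" and k: "k \<le> n"
    and x: "x \<in> space (leb_prod {..<n})" "\<And>i. i < k \<Longrightarrow> x i \<in> {a i..b i}"
    and d: "emeasure (leb_prod {..<k}) {y \<in> pbox {..<k} a b. overlay k y x \<notin> E}
      < ennreal (\<delta> ^ k * (\<Prod>i<k. b i - a i))"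
  shows "x \<in> iterated_hull {..<n} \<delta> E k"
  using k x d
proof (induction k arbitrary: x)
  case 0
  show ?case
  proof (rule ccontr)
    assume "x \<notin> iterated_hull {..<n} \<delta> E 0"
    then have "{y \<in> pbox {..<0::nat} a b. overlay 0 y x \<notin> E} = space (leb_prod {..<0})"
      by (auto simp: overlay_def space_PiM)
    then have "emeasure (leb_prod {..<0}) {y \<in> pbox {..<0::nat} a b. overlay 0 y x \<notin> E} = 1"
      by (simp add: space_PiM_empty PiM_empty)
    with 0 show False by simp
  qed
next
  case (Suc k)
  define m where "m t = emeasure (leb_prod {..<k}) {y \<in> pbox {..<k} a b. overlay k y (x(k := t)) \<notin> E}" for t
  define P where "P = (\<Prod>i<k. b i - a i)"
  have P: "P > 0" unfolding P_def using ab Suc.prems(1) by (intro prod_pos) auto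
  have kn: "k < n" using Suc.prems(1) by simp
  let ?S = "{y \<in> pbox {..<Suc k} a b. overlay (Suc k) y x \<notin> E}"
  have Sm: "?S \<in> sets (leb_prod {..<Suc k})"
  proof -
    have "?S = pbox {..<Suc k} a b - ((\<lambda>y. overlay (Suc k) y x) -` E \<inter> space (leb_prod {..<Suc k}))"
      by (auto simp: space_PiM)
    also have "\<dots> \<in> sets (leb_prod {..<Suc k})"
      using measurable_sets[OF measurable_overlay[OF Suc.prems(2,1)] E]
      by (intro sets.Diff sets_PiM_I_finite) auto
    finally show ?thesis .
  qed
  have sec: "{y \<in> pbox {..<k} a b. overlay k y (x(k := t)) \<notin> E} \<in> sets (leb_prod {..<k})" for t
  proof -
    have xt: "x(k := t) \<in> space (leb_prod {..<n})" using space_upd[of k "{..<n}" x] kn Suc.prems(2) by simp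
    have "{y \<in> pbox {..<k} a b. overlay k y (x(k := t)) \<notin> E} = 
       pbox {..<k} a b - ((\<lambda>y. overlay k y (x(k := t))) -` E \<inter> space (leb_prod {..<k}))"
      by (auto simp: space_PiM)
    also have "\<dots> \<in> sets (leb_prod {..<k})"
      using measurable_sets[OF measurable_overlay[OF xt] E, of k] kn
      by (intro sets.Diff sets_PiM_I_finite) auto
    finally show ?thesis .
  qed
  have ind: "indicator ?S (y(k := t)) = (indicator {a k..b k} t * indicator {y \<in> pbox {..<k} a b. overlay k y (x(k := t)) \<notin> E} y :: ennreal)"
    if "y \<in> space (leb_prod {..<k})" for y t
  proof -
    have "overlay (Suc k) (y(k := t)) x = overlay k y (x(k := t))" by (auto simp: overlay_def)
    moreover have "y(k := t) \<in> pbox {..<Suc k} a b \<longleftrightarrow> t \<in> {a k..b k} \<and> y \<in> pbox {..<k} a b"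
      using that by (auto simp: space_PiM PiE_def Pi_def extensional_def less_Suc_eq)
    ultimately show ?thesis by (simp add: indicator_def)
  qed
  have "emeasure (leb_prod {..<Suc k}) ?S = (\<integral>\<^sup>+x. indicator ?S x \<partial>leb_prod (insert k {..<k}))"
    using Sm by (simp add: lessThan_Suc)
  also have "\<dots> = (\<integral>\<^sup>+t. (\<integral>\<^sup>+y. indicator ?S (y(k := t)) \<partial>leb_prod {..<k}) \<partial>lborel)"
    using Sm by (intro lborel_prod.product_nn_integral_insert_rev) (auto simp: lessThan_Suc)
  also have "\<dots> = (\<integral>\<^sup>+t. indicator {a k..b k} t * m t \<partial>lborel)"
  proof (rule nn_integral_cong)
    fix t :: real
    have "(\<integral>\<^sup>+y. indicator ?S (y(k := t)) \<partial>leb_prod {..<k}) = (\<integral>\<^sup>+y. indicator {a k..b k} t * indicator {y \<in> pbox {..<k} a b. overlay k y (x(k := t)) \<notin> E} y \<partial>leb_prod {..<k})"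
      by (intro nn_integral_cong ind)
    also have "\<dots> = indicator {a k..b k} t * m t"
      unfolding m_def by (rule nn_integral_cmult_indicator[OF sec])
    finally show "(\<integral>\<^sup>+y. indicator ?S (y(k := t)) \<partial>leb_prod {..<k}) = indicator {a k..b k} t * m t" .
  qed
  finally have Seq: "emeasure (leb_prod {..<Suc k}) ?S = (\<integral>\<^sup>+t. indicator {a k..b k} t * m t \<partial>lborel)" .
  \<comment> \<open>The parameters of those sections to which the induction hypothesis does not apply.\<close>
  define B where "B = {a k..b k} - {t. x(k := t) \<in> iterated_hull {..<n} \<delta> E k}"
  have Bm: "B \<in> sets borel"
    unfolding B_def using sets_slice[OF _ sets_iterated_hull[OF E] Suc.prems(2), of k k \<delta>] kn by auto
  have big: "ennreal (\<delta> ^ k * P) \<le> m t" if "t \<in> B" for t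
  proof (rule ccontr)
    assume "\<not> ennreal (\<delta> ^ k * P) \<le> m t"
    then have "x(k := t) \<in> iterated_hull {..<n} \<delta> E k"
    proof (intro Suc.IH)
      show "x(k := t) \<in> space (leb_prod {..<n})" using space_upd[of k "{..<n}" x t] kn Suc.prems(2) by simp
      show "(x(k := t)) i \<in> {a i..b i}" if "i < k" for i using Suc.prems(3)[of i] that by simp
    qed (use kn in \<open>simp_all add: m_def P_def not_le del: fun_upd_apply\<close>)
    then show False using that by (simp add: B_def)
  qed
  have "ennreal (\<delta> ^ k * P) * len B = (\<integral>\<^sup>+t. ennreal (\<delta> ^ k * P) * indicator B t \<partial>lborel)"
    using Bm by (simp add: nn_integral_cmult_indicator)
  also have "\<dots> \<le> (\<integral>\<^sup>+t. indicator {a k..b k} t * m t \<partial>lborel)"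
    using big by (intro nn_integral_mono) (auto simp: indicator_def B_def)
  also have "\<dots> < ennreal (\<delta> ^ Suc k * (\<Prod>i<Suc k. b i - a i))"
    using Suc.prems(4) unfolding Seq .
  also have "\<dots> = ennreal (\<delta> ^ k * P) * ennreal (\<delta> * (b k - a k))"
    using \<delta> P ab[OF kn] by (simp add: P_def ennreal_mult[symmetric] mult_ac)
  finally have "len B < ennreal (\<delta> * (b k - a k))"
    by (metis linorder_not_less mult_left_mono zero_le)
  then have "{a k..b k} \<subseteq> density_hull \<delta> {t. x(k := t) \<in> iterated_hull {..<n} \<delta> E k}"
    unfolding B_def using \<delta> ab[OF kn] sets_slice[OF _ sets_iterated_hull[OF E] Suc.prems(2), of k k \<delta>] kn
    by (intro interval_subset_density_hull) auto
  then show ?case using Suc.prems(2,3) by (auto simp: directional_hull_def)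
qed

section \<open>The upper bound for the Tauberian constant\<close>

lemma leb_space [simp]: "space (leb J) = space (leb_prod J)"
  by (simp add: leb_def)

lemma nn_integral_leb: "integral\<^sup>N (leb J) f = integral\<^sup>N (leb_prod J) f"
  by (simp add: leb_def nn_integral_completion)

lemma AE_leb_iff: "(AE x in leb J. P x) \<longleftrightarrow> (AE x in leb_prod J. P x)"
  unfolding leb_def by (rule AE_completion_iff)

lemma sets_leb: "E \<in> sets (leb_prod J) \<Longrightarrow> E \<in> sets (leb J)"
  by (simp add: leb_def sets_completionI_sets)

lemma emeasure_leb: "E \<in> sets (leb_prod J) \<Longrightarrow> emeasure (leb J) E = emeasure (leb_prod J) E"
  by (simp add: leb_def)

lemma sets_box: "finite J \<Longrightarrow> (\<And>i. i \<in> J \<Longrightarrow> X i \<in> sets borel) \<Longrightarrow> Pi\<^sub>E J X \<in> sets (leb_prod J)"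
  by (intro sets_PiM_I_finite) auto

lemma emeasure_box:
  "finite J \<Longrightarrow> (\<And>i. i \<in> J \<Longrightarrow> X i \<in> sets borel) \<Longrightarrow>
   emeasure (leb_prod J) (Pi\<^sub>E J X) = (\<Prod>i\<in>J. len (X i))"
  by (intro lborel_prod.emeasure_PiM) auto

lemma emeasure_cbox_leb_prod:
  assumes "finite J" "\<And>i. i \<in> J \<Longrightarrow> a i \<le> b i"
  shows "emeasure (leb_prod J) (pbox J a b) = ennreal (\<Prod>i\<in>J. b i - a i)"
  using assms by (subst emeasure_box) (auto simp: prod_ennreal)

lemma strong_maximal_level_subset_iterated_hull:
  assumes E: "E \<in> sets (leb_prod {..<n})" and n: "n \<ge> 1" and \<alpha>: "0 < \<alpha>" "\<alpha> < 1"
  shows "maximal_level n E \<alpha>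
    \<subseteq> iterated_hull {..<n} ((1 - \<alpha>) powr (1 / real n)) E n"
proof
  let ?M = "leb_prod {..<n}"
  fix x assume "x \<in> maximal_level n E \<alpha>"
  then have xs: "x \<in> space ?M" and sm: "strong_maximal n (indicator E) x > ennreal \<alpha>" by auto
  define \<delta> where "\<delta> = (1 - \<alpha>) powr (1 / real n)"
  have \<delta>: "0 < \<delta>" "\<delta> ^ n = 1 - \<alpha>"
  proof -
    show p: "0 < \<delta>" using \<alpha> by (simp add: \<delta>_def)
    have "\<delta> ^ n = \<delta> powr real n" using p by (simp add: powr_realpow)
    also have "\<dots> = 1 - \<alpha>" unfolding \<delta>_def powr_powr using n \<alpha> by simp
    finally show "\<delta> ^ n = 1 - \<alpha>" .
  qed
  obtain R where R: "R \<in> rectangles n" "x \<in> R"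
    "ennreal \<alpha> < (\<integral>\<^sup>+y\<in>R. ennreal \<bar>indicator E y\<bar> \<partial>leb {..<n}) / emeasure (leb {..<n}) R"
    using sm unfolding strong_maximal_def less_SUP_iff by blast
  obtain a b where ab: "R = pbox {..<n} a b" "\<And>i. i < n \<Longrightarrow> a i < b i"
    using R(1) by (auto simp: rectangles_def)
  define P where "P = (\<Prod>i<n. b i - a i)"
  have P: "P > 0" unfolding P_def using ab(2) by (intro prod_pos) auto
  have Rm: "R \<in> sets ?M" unfolding ab(1) by (intro sets_box) auto
  have eR: "emeasure ?M R = ennreal P"
    unfolding ab(1) P_def using ab(2) by (intro emeasure_cbox_leb_prod) (auto intro: less_imp_le)
  have "(\<integral>\<^sup>+y\<in>R. ennreal \<bar>indicator E y\<bar> \<partial>leb {..<n}) = (\<integral>\<^sup>+y. indicator (R \<inter> E) y \<partial>?M)"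
    unfolding nn_integral_leb by (intro nn_integral_cong) (auto simp: indicator_def)
  also have "\<dots> = emeasure ?M (R \<inter> E)" using Rm E by simp
  finally have "ennreal \<alpha> < emeasure ?M (R \<inter> E) / ennreal P"
    using R(3) Rm eR by (simp add: emeasure_leb)
  then have big: "ennreal (\<alpha> * P) < emeasure ?M (R \<inter> E)"
    using P \<alpha> by (simp add: less_divide_ennreal_iff ennreal_mult)
  have fin: "emeasure ?M (R \<inter> E) \<le> ennreal P"
    unfolding eR[symmetric] using Rm by (intro emeasure_mono) auto
  then obtain g where g: "emeasure ?M (R \<inter> E) = ennreal g" "0 \<le> g"
    by (cases "emeasure ?M (R \<inter> E)") (auto simp: top_unique)
  have "emeasure ?M (R - E) = emeasure ?M (R - (R \<inter> E))" by (intro arg_cong[where f="emeasure ?M"]) auto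
  also have "\<dots> = ennreal P - ennreal g"
    using Rm E g eR by (subst emeasure_Diff) auto
  also have "\<dots> = ennreal (P - g)" using g by (simp add: ennreal_minus)
  also have "\<dots> < ennreal (\<delta> ^ n * P)"
  proof (rule ennreal_lessI)
    have "\<alpha> * P < g" using big g \<alpha> P by (simp add: ennreal_less_iff)
    then show "P - g < \<delta> ^ n * P" unfolding \<delta>(2) by (simp add: algebra_simps)
  qed (use \<delta>(1) P in simp)
  finally have small: "emeasure ?M (R - E) < ennreal (\<delta> ^ n * P)" .
  let ?B = "pbox {..<n} a b"
  have ov: "overlay n y x = y" if "y \<in> ?B" for y
  proof
    fix i
    show "overlay n y x i = y i"
    proof (cases "i < n")
      case False
      then have "y i = undefined" using PiE_arb[OF that, of i] by simp
      moreover have "x i = undefined" using xs False by (intro PiE_arb[of x "{..<n}" "\<lambda>_. UNIV"]) (simp_all add: space_PiM)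
      ultimately show ?thesis by (simp add: overlay_def)
    qed (simp add: overlay_def)
  qed
  have "{y \<in> ?B. overlay n y x \<notin> E} = R - E"
  proof (rule set_eqI)
    fix y
    show "y \<in> {y \<in> ?B. overlay n y x \<notin> E} \<longleftrightarrow> y \<in> R - E"
      using ov[of y] unfolding ab(1) by (cases "y \<in> ?B") simp_all
  qed
  then have d1: "emeasure (leb_prod {..<n}) {y \<in> pbox {..<n} a b. overlay n y x \<notin> E}
      < ennreal (\<delta> ^ n * (\<Prod>i<n. b i - a i))"
    using small by (simp add: P_def)
  have d2: "x i \<in> {a i..b i}" if "i < n" for i
    using PiE_mem[OF R(2)[unfolded ab(1)], of i] that by simp
  show "x \<in> iterated_hull {..<n} ((1 - \<alpha>) powr (1 / real n)) E n"
    unfolding \<delta>_def[symmetric]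
    by (rule dense_box_subset_iterated_hull[OF E \<delta>(1) ab(2) order_refl xs d2 d1])
qed

lemma compact_cbox_PiE:
  fixes a b :: "nat \<Rightarrow> real"
  shows "compact (pbox J a b)"
proof -
  have eq: "pbox J a b = Pi\<^sub>E UNIV (\<lambda>i. if i \<in> J then {a i..b i} else {undefined})"
    by (auto simp: PiE_def Pi_def extensional_def split: if_splits)
  have "compactin (product_topology (\<lambda>_. euclidean :: real topology) UNIV)
     (Pi\<^sub>E UNIV (\<lambda>i. if i \<in> J then {a i..b i} else {undefined}))"
    unfolding compactin_PiE by auto
  then show ?thesis unfolding eq euclidean_product_topology by simp
qed

lemma weight_box_finite:
  assumes w: "weight n w"
  shows "(\<integral>\<^sup>+x\<in>pbox {..<n} a b. ennreal (w x) \<partial>leb_prod {..<n}) < \<infinity>"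
proof -
  let ?K = "pbox {..<n} a b"
  have "set_integrable (leb {..<n}) ?K w"
    using w compact_cbox_PiE[of "{..<n}" a b] by (auto simp: weight_def space_PiM)
  then have "(\<integral>\<^sup>+x. ennreal (norm (indicator ?K x *\<^sub>R w x)) \<partial>leb {..<n}) < \<infinity>"
    by (simp add: set_integrable_def integrable_iff_bounded)
  moreover have "(\<integral>\<^sup>+x. ennreal (norm (indicator ?K x *\<^sub>R w x)) \<partial>leb {..<n}) = (\<integral>\<^sup>+x\<in>?K. ennreal (w x) \<partial>leb_prod {..<n})"
    unfolding nn_integral_leb
  proof (rule nn_integral_cong)
    fix x assume "x \<in> space (leb_prod {..<n})"
    then have "0 \<le> w x" using w by (simp add: weight_def)
    then show "ennreal (norm (indicator ?K x *\<^sub>R w x)) = ennreal (w x) * indicator ?K x"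
      by (auto simp: indicator_def)
  qed
  ultimately show ?thesis by simp
qed

text \<open>
  A Borel representative, nonnegative everywhere, so that all slices are measurable and nonnegative.
\<close>

lemma weight_borel_version:
  assumes wt: "weight n w"
  obtains w' where "w' \<in> borel_measurable (leb_prod {..<n})" "\<And>x. 0 \<le> w' x"
    "AE x in leb_prod {..<n}. w x = w' x"
    "\<And>a b. (\<integral>\<^sup>+x\<in>pbox {..<n} a b. ennreal (w' x) \<partial>leb_prod {..<n}) < \<infinity>"
proof -
  have "w \<in> borel_measurable (completion (leb_prod {..<n}))"
    using wt by (simp add: weight_def leb_def)
  from completion_ex_borel_measurable_real[OF this]
  obtain g where g: "g \<in> borel_measurable (leb_prod {..<n})" "AE x in leb_prod {..<n}. w x = g x" by blast
  have eq: "AE x in leb_prod {..<n}. w x = max 0 (g x)"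
    using g(2) AE_space
  proof eventually_elim
    case (elim x)
    have "0 \<le> w x" using wt elim(2) by (simp add: weight_def)
    then show ?case using elim by simp
  qed
  show thesis
  proof (rule that[OF _ _ eq])
    fix a b :: "nat \<Rightarrow> real"
    let ?K = "pbox {..<n} a b"
    have "(\<integral>\<^sup>+x\<in>?K. ennreal (max 0 (g x)) \<partial>leb_prod {..<n}) = (\<integral>\<^sup>+x\<in>?K. ennreal (w x) \<partial>leb_prod {..<n})"
      using eq by (intro nn_integral_cong_AE) (auto elim!: eventually_mono)
    then show "(\<integral>\<^sup>+x\<in>?K. ennreal (max 0 (g x)) \<partial>leb_prod {..<n}) < \<infinity>"
      using weight_box_finite[OF wt] by simp
  qed (use g in auto)
qed

lemma AE_slices:
  assumes J: "finite J" "j \<in> J" and P: "AE x in leb_prod J. P x"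
  shows "AE y in leb_prod (J - {j}). AE t in lborel. P (y(j := t))"
proof -
  obtain N where N: "{x \<in> space (leb_prod J). \<not> P x} \<subseteq> N" "N \<in> sets (leb_prod J)" "emeasure (leb_prod J) N = 0"
    using P by (auto elim!: AE_E)
  have Nb: "(indicator N :: _ \<Rightarrow> ennreal) \<in> borel_measurable (leb_prod J)" using N(2) by simp
  have "(\<integral>\<^sup>+y. (\<integral>\<^sup>+t. indicator N (y(j := t)) \<partial>lborel) \<partial>leb_prod (J - {j})) = 0"
    using nn_integral_leb_prod_slice[OF J Nb] N by simp
  moreover have "(\<lambda>y. \<integral>\<^sup>+t. indicator N (y(j := t)) \<partial>lborel) \<in> borel_measurable (leb_prod (J - {j}))"
    using measurable_compose[OF measurable_upd_leb_prod_minus[OF J(2)] Nb]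
    by (intro lborel.borel_measurable_nn_integral) (simp add: case_prod_beta')
  ultimately have "AE y in leb_prod (J - {j}). (\<integral>\<^sup>+t. indicator N (y(j := t)) \<partial>lborel) = 0"
    by (simp add: nn_integral_0_iff_AE)
  then show ?thesis using AE_space
  proof eventually_elim
    case (elim y)
    have "(\<lambda>t. indicator N (y(j := t)) :: ennreal) \<in> borel_measurable lborel"
      using measurable_slice[OF J(2) Nb elim(2)] by simp
    from elim(1) have "AE t in lborel. indicator N (y(j := t)) = (0 :: ennreal)"
      unfolding nn_integral_0_iff_AE[OF \<open>_ \<in> borel_measurable lborel\<close>] .
    then show ?case
    proof eventually_elim
      case (elim t)
      have "y(j := t) \<notin> N" using elim by (simp add: indicator_eq_0_iff)
      then show ?case using N(1) space_upd_minus[OF J(2) \<open>y \<in> _\<close>] by blast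
    qed
  qed
qed

text \<open>
  Integrability over the cubes of side \<open>2 m\<close> gives, by Fubini's theorem, finite mass of almost every slice
  on bounded intervals.
\<close>

lemma AE_diffuse_radon_slice:
  assumes J: "finite J" "j \<in> J" and w: "w \<in> borel_measurable (leb_prod J)"
    and fin: "\<And>a b. (\<integral>\<^sup>+x\<in>pbox J a b. ennreal (w x) \<partial>leb_prod J) < \<infinity>"
  shows "AE y in leb_prod (J - {j}). diffuse_radon (slice_measure j w y)"
proof -
  define K where "K m = Pi\<^sub>E J (\<lambda>i. {- real m..real m})" for m
  have Km: "K m \<in> sets (leb_prod J)" for m unfolding K_def using J by (intro sets_box) auto
  have "AE y in leb_prod (J - {j}). (\<integral>\<^sup>+t. ennreal (w (y(j := t))) * indicator (K m) (y(j := t)) \<partial>lborel) \<noteq> \<infinity>" for m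
  proof (rule nn_integral_PInf_AE)
    have f: "(\<lambda>x. ennreal (w x) * indicator (K m) x) \<in> borel_measurable (leb_prod J)" using w Km by simp
    show "(\<lambda>y. \<integral>\<^sup>+t. ennreal (w (y(j := t))) * indicator (K m) (y(j := t)) \<partial>lborel) \<in> borel_measurable (leb_prod (J - {j}))"
      using measurable_compose[OF measurable_upd_leb_prod_minus[OF J(2)] f]
      by (intro lborel.borel_measurable_nn_integral) (simp add: case_prod_beta')
    show "(\<integral>\<^sup>+y. (\<integral>\<^sup>+t. ennreal (w (y(j := t))) * indicator (K m) (y(j := t)) \<partial>lborel) \<partial>leb_prod (J - {j})) \<noteq> \<infinity>"
      unfolding nn_integral_leb_prod_slice[OF J f, symmetric]
      using fin[of "\<lambda>_. - real m" "\<lambda>_. real m"] by (simp add: K_def less_top)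
  qed
  then have "AE y in leb_prod (J - {j}). \<forall>m. (\<integral>\<^sup>+t. ennreal (w (y(j := t))) * indicator (K m) (y(j := t)) \<partial>lborel) \<noteq> \<infinity>"
    by (simp add: AE_all_countable)
  then show ?thesis using AE_space
  proof eventually_elim
    case (elim y)
    note em = emeasure_slice_measure[OF J(2) w elim(2)]
    have "emeasure (slice_measure j w y) {a..b} < \<infinity>" for a b
    proof -
      let ?S = "insert \<bar>a\<bar> (insert \<bar>b\<bar> ((\<lambda>i. \<bar>y i\<bar>) ` (J - {j})))"
      obtain m where m: "Max ?S \<le> real m" using real_arch_simple by blast
      have S: "z \<le> real m" if "z \<in> ?S" for z
        using order_trans[OF Max_ge[of ?S z] m] J that by blast
      have bnd: "\<bar>a\<bar> \<le> real m" "\<bar>b\<bar> \<le> real m" "\<And>i. i \<in> J - {j} \<Longrightarrow> \<bar>y i\<bar> \<le> real m"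
        by (rule S; simp)+
      have ysp: "y \<in> extensional (J - {j})" using elim(2) by (simp add: space_PiM PiE_def)
      have "y(j := t) \<in> K m" if "t \<in> {a..b}" for t
        unfolding K_def
      proof (rule PiE_I)
        fix i assume "i \<in> J"
        then show "(y(j := t)) i \<in> {- real m..real m}"
          using bnd(1,2) bnd(3)[of i] that by (cases "i = j") (auto simp: abs_le_iff)
      next
        fix i assume "i \<notin> J"
        then show "(y(j := t)) i = undefined" using ysp J(2) by (auto simp: extensional_def)
      qed
      then have "(\<integral>\<^sup>+t\<in>{a..b}. ennreal (w (y(j := t))) \<partial>lborel) \<le>
        (\<integral>\<^sup>+t. ennreal (w (y(j := t))) * indicator (K m) (y(j := t)) \<partial>lborel)"
        by (intro nn_integral_mono) (auto simp: indicator_def)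
      also have "\<dots> < \<infinity>" using elim(1) by (simp add: less_top)
      finally show ?thesis by (simp add: em)
    qed
    moreover have "emeasure (slice_measure j w y) {t} = 0" for t
    proof -
      have "(\<integral>\<^sup>+s\<in>{t}. ennreal (w (y(j := s))) \<partial>lborel) = 0"
        by (intro nn_integral_null_set) auto
      then show ?thesis by (simp add: em)
    qed
    ultimately show ?case by (simp add: diffuse_radon_def slice_measure_def)
  qed
qed

lemma fujii_wilson_slice:
  assumes "j \<in> J" "w \<in> borel_measurable (leb_prod J)" "\<And>x. 0 \<le> w x" "y \<in> space (leb_prod (J - {j}))"
  shows "fujii_wilson (\<lambda>t. w (y(j := t))) = (SUP I\<in>{I. fst I < snd I}. fw_quotient (slice_measure j w y) I)"
  unfolding slice_measure_def
  using measurable_slice[OF assms(1,2,4)] assms(3) by (intro fujii_wilson_eq_SUP_fw_quotient)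

lemma wmeas_borel_version:
  assumes "AE x in leb_prod {..<n}. w x = w' x"
  shows "wmeas n w E = (\<integral>\<^sup>+x\<in>E. ennreal (w' x) \<partial>leb_prod {..<n})"
  unfolding wmeas_def nn_integral_leb using assms by (intro nn_integral_cong_AE) (auto elim!: eventually_mono)

text \<open>
  Convexity of the left side in \<open>z\<close>, which takes the values \<open>1\<close> and \<open>9 ^ n\<close> at the ends.
\<close>

lemma power_one_plus_le:
  fixes z :: real
  assumes "0 \<le> z" "z \<le> 1"
  shows "(1 + 8 * z) ^ n \<le> 1 + 9 ^ n * z"
proof -
  have "(1 + 8 * z) ^ n \<le> 1 + (9 ^ n - 1) * z"
  proof (induction n)
    case (Suc n)
    have "(1 + 8 * z) ^ Suc n \<le> (1 + 8 * z) * (1 + (9 ^ n - 1) * z)"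
      using Suc assms by (simp add: mult_left_mono)
    also have "\<dots> = 1 + (8 + (9 ^ n - 1)) * z + 8 * (9 ^ n - 1) * (z * z)" by (simp add: algebra_simps)
    also have "\<dots> \<le> 1 + (8 + (9 ^ n - 1)) * z + 8 * (9 ^ n - 1) * z"
      using assms mult_right_mono[of z 1 z] by (intro add_left_mono mult_left_mono) auto
    also have "\<dots> = 1 + (9 ^ Suc n - 1) * z" by (simp add: algebra_simps)
    finally show ?case .
  qed simp
  then show ?thesis using assms by (simp add: algebra_simps)
qed

text \<open>
  A measurable set may be replaced by a Borel set that agrees with it up to a null set; this changes neither
  the maximal function nor the masses. With \<open>\<delta> ^ n = 1 - \<alpha>\<close> the range of \<open>\<alpha>\<close> becomes the range of
  \<open>\<delta>\<close> in the estimate on the line, which explains the factor \<open>n\<close> in both places.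
\<close>

theorem tauberian_le_of_strong_Ainf:
  assumes n: "n \<ge> 1" and w: "w \<in> strong_Ainf n"
    and A: "A = enn2real (strong_Ainf_const n w)"
    and \<alpha>: "\<alpha> < 1" "\<alpha> > 1 - exp (- (144 * real n * A))"
  shows "tauberian n w \<alpha> - 1 \<le> ennreal (9 ^ n * (1 - \<alpha>) powr inverse (144 * real n * A))"
proof -
  have wt: "weight n w" and fin: "strong_Ainf_const n w < \<infinity>" using w by (auto simp: strong_Ainf_def)
  have A0: "0 \<le> A" by (simp add: A)
  have Ae: "strong_Ainf_const n w = ennreal A" using fin by (simp add: A less_top)
  obtain w' where w': "w' \<in> borel_measurable (leb_prod {..<n})" "\<And>x. 0 \<le> w' x"
    "AE x in leb_prod {..<n}. w x = w' x"
    and boxfin: "\<And>a b. (\<integral>\<^sup>+x\<in>pbox {..<n} a b. ennreal (w' x) \<partial>leb_prod {..<n}) < \<infinity>"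
    by (rule weight_borel_version[OF wt]) (rule that)
  have fw: "AE y in leb_prod ({..<n} - {j}). diffuse_radon (slice_measure j w' y) \<and> fw_bound (slice_measure j w' y) A"
    if j: "j < n" for j
  proof -
    have jn: "finite {..<n}" "j \<in> {..<n}" using j by auto
    have "esssup (leb ({..<n} - {j})) (\<lambda>y. fujii_wilson (\<lambda>t. w (y(j := t)))) \<le> ennreal A"
      unfolding Ae[symmetric] strong_Ainf_const_def using j by (intro SUP_upper) auto
    then have "AE y in leb ({..<n} - {j}). fujii_wilson (\<lambda>t. w (y(j := t))) \<le> ennreal A"
      using esssup_AE[of "\<lambda>y. fujii_wilson (\<lambda>t. w (y(j := t)))" "leb ({..<n} - {j})"]
      by (auto elim!: eventually_mono)
    then have "AE y in leb_prod ({..<n} - {j}). fujii_wilson (\<lambda>t. w (y(j := t))) \<le> ennreal A"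
      by (simp add: AE_leb_iff)
    then show ?thesis using AE_diffuse_radon_slice[OF jn w'(1) boxfin] AE_slices[OF jn w'(3)] AE_space
    proof eventually_elim
      case (elim y)
      have "fujii_wilson (\<lambda>t. w (y(j := t))) = fujii_wilson (\<lambda>t. w' (y(j := t)))"
        by (rule fujii_wilson_cong_AE[OF elim(3)])
      then show ?case
        using elim(1,2) fujii_wilson_slice[OF jn(2) w'(1,2) elim(4)] SUP_fw_quotient_le_iff[OF elim(2) A0] by simp
    qed
  qed
  define \<delta> where "\<delta> = (1 - \<alpha>) powr (1 / real n)"
  have \<alpha>0: "0 < \<alpha>"
  proof -
    have "exp (- (144 * real n * A)) \<le> 1" using A0 by simp
    then show ?thesis using \<alpha> by linarith
  qed
  have \<delta>0: "0 < \<delta>" using \<alpha> by (simp add: \<delta>_def)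
  have \<delta>1: "\<delta> < exp (- (144 * A))"
  proof -
    have "\<delta> < exp (- (144 * real n * A)) powr (1 / real n)"
      unfolding \<delta>_def using \<alpha> n by (intro powr_less_mono2) auto
    also have "\<dots> = exp (- (144 * A))" using n by (simp add: powr_def)
    finally show ?thesis .
  qed
  define z where "z = (1 - \<alpha>) powr inverse (144 * real n * A)"
  have zd: "\<delta> powr inverse (144 * A) = z"
    unfolding \<delta>_def z_def powr_powr using n by (intro arg_cong[where f="(powr) (1 - \<alpha>)"]) (simp add: field_simps)
  have z: "0 \<le> z" "z \<le> 1"
  proof -
    show "0 \<le> z" by (simp add: z_def)
    have "0 \<le> inverse (144 * real n * A)" using A0 by simp
    then show "z \<le> 1" unfolding z_def using \<alpha>(1) \<alpha>0 by (intro powr_le1) linarith+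
  qed
  have "tauberian n w \<alpha> \<le> ennreal ((1 + 8 * z) ^ n)"
    unfolding tauberian_def
  proof (rule SUP_least)
    fix E assume E: "E \<in> {E \<in> sets (leb {..<n}). 0 < wmeas n w E \<and> wmeas n w E < \<infinity>}"
    let ?M = "leb_prod {..<n}"
    define E0 where "E0 = main_part ?M E"
    have Ec: "E \<in> sets (completion ?M)" using E by (simp add: leb_def)
    have E0: "E0 \<in> sets ?M" unfolding E0_def by (rule main_part_sets[OF Ec])
    have E0E: "AE x in ?M. x \<in> E \<longleftrightarrow> x \<in> E0" unfolding E0_def using AE_in_main_part[OF Ec] by auto
    have wE: "wmeas n w E = (\<integral>\<^sup>+x\<in>E0. ennreal (w' x) \<partial>?M)"
      unfolding wmeas_borel_version[OF w'(3)] using E0E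
      by (intro nn_integral_cong_AE) (auto elim!: eventually_mono simp: indicator_def)
    have sm: "strong_maximal n (indicator E) x = strong_maximal n (indicator E0) x" for x
    proof -
      have "(\<integral>\<^sup>+y\<in>R. ennreal \<bar>indicator E y\<bar> \<partial>leb {..<n}) = (\<integral>\<^sup>+y\<in>R. ennreal \<bar>indicator E0 y\<bar> \<partial>leb {..<n})" for R
        unfolding nn_integral_leb using E0E
        by (intro nn_integral_cong_AE) (auto elim!: eventually_mono simp: indicator_def)
      then show ?thesis by (simp add: strong_maximal_def)
    qed
    have "wmeas n w (maximal_level n E \<alpha>)
      \<le> (\<integral>\<^sup>+x\<in>iterated_hull {..<n} \<delta> E0 n. ennreal (w' x) \<partial>?M)"
      unfolding wmeas_borel_version[OF w'(3)] sm \<delta>_def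
      by (intro nn_integral_mono mult_left_mono indicator_leI
          subsetD[OF strong_maximal_level_subset_iterated_hull[OF E0 n \<alpha>0 \<alpha>(1)]]) simp_all
    also have "\<dots> \<le> ennreal ((1 + 8 * z) ^ n) * wmeas n w E"
      unfolding wE zd[symmetric] by (intro weight_iterated_hull_le w'(1) E0 \<delta>0 \<delta>1 fw order_refl)
    finally show "wmeas n w (maximal_level n E \<alpha>) / wmeas n w E
      \<le> ennreal ((1 + 8 * z) ^ n)"
      using E by (intro divide_le_posI_ennreal) (auto simp: mult.commute)
  qed
  also have "\<dots> \<le> ennreal (1 + 9 ^ n * z)" using power_one_plus_le[OF z] by (rule ennreal_leI)
  also have "\<dots> = 1 + ennreal (9 ^ n * z)" using z by (subst ennreal_plus) auto
  finally have "tauberian n w \<alpha> - 1 \<le> (1 + ennreal (9 ^ n * z)) - 1" by (rule ennreal_minus_mono) simp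
  also have "\<dots> = ennreal (9 ^ n * z)" by (simp add: ennreal_add_diff_cancel_left)
  finally show ?thesis by (simp add: z_def)
qed

section \<open>Test sets that are products\<close>

text \<open>
  Openness expressed through closed boxes, since these are the sets over which the strong maximal function
  averages.
\<close>

definition box_open :: "nat set \<Rightarrow> (nat \<Rightarrow> real) set \<Rightarrow> bool" where
  "box_open J S \<longleftrightarrow> (\<forall>y\<in>S. \<exists>a b. (\<forall>i\<in>J. a i < b i) \<and>
     y \<in> pbox J a b \<and> pbox J a b \<subseteq> S)"

text \<open>
  The product of \<open>T\<close> in the coordinate \<open>j\<close> and \<open>S\<close> in the other coordinates.
\<close>

definition cylinder :: "nat set \<Rightarrow> nat \<Rightarrow> real set \<Rightarrow> (nat \<Rightarrow> real) set \<Rightarrow> (nat \<Rightarrow> real) set" where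
  "cylinder J j T S = {x \<in> space (leb_prod J). x j \<in> T \<and> restrict x (J - {j}) \<in> S}"

lemma sets_cylinder:
  assumes "j \<in> J" "T \<in> sets borel" "S \<in> sets (leb_prod (J - {j}))"
  shows "cylinder J j T S \<in> sets (leb_prod J)"
proof -
  have 1: "(\<lambda>x. x j) \<in> leb_prod J \<rightarrow>\<^sub>M lborel"
    using assms(1) by (rule measurable_component_singleton)
  have 2: "(\<lambda>x. restrict x (J - {j})) \<in> leb_prod J \<rightarrow>\<^sub>M leb_prod (J - {j})"
    by (rule measurable_restrict_subset) auto
  have "cylinder J j T S = ((\<lambda>x. x j) -` T \<inter> space (leb_prod J)) \<inter>
     ((\<lambda>x. restrict x (J - {j})) -` S \<inter> space (leb_prod J))"
    by (auto simp: cylinder_def)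
  also have "\<dots> \<in> sets (leb_prod J)"
    using assms by (intro sets.Int measurable_sets[OF 1] measurable_sets[OF 2]) simp_all
  finally show ?thesis .
qed

text \<open>
  The Tauberian hypothesis as it is used: it speaks only about sets of positive finite mass.
\<close>

lemma weight_level_le_of_tauberian:
  assumes H: "\<And>\<alpha>. \<alpha> < 1 \<Longrightarrow> \<alpha> > 1 - exp (- \<gamma>) \<Longrightarrow>
      tauberian n w \<alpha> - 1 \<le> ennreal (B * (1 - \<alpha>) powr (1 / \<beta>))"
    and B: "B > 0" and E: "E \<in> sets (leb_prod {..<n})" "0 < wmeas n w E" "wmeas n w E < \<infinity>"
    and \<epsilon>: "0 < \<epsilon>" "\<epsilon> < exp (- \<gamma>)"
  shows "wmeas n w (maximal_level n E (1 - \<epsilon>))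
    \<le> ennreal (1 + B * \<epsilon> powr (1 / \<beta>)) * wmeas n w E"
proof -
  let ?X = "wmeas n w (maximal_level n E (1 - \<epsilon>))"
  have "?X / wmeas n w E \<le> tauberian n w (1 - \<epsilon>)"
    unfolding tauberian_def using E by (intro SUP_upper2[of E]) (auto simp: sets_leb)
  also have "\<dots> \<le> 1 + ennreal (B * \<epsilon> powr (1 / \<beta>))"
    using H[of "1 - \<epsilon>"] \<epsilon> by (simp add: ennreal_minus_le_iff)
  also have "\<dots> = ennreal (1 + B * \<epsilon> powr (1 / \<beta>))" using B by (subst ennreal_plus) auto
  finally have *: "?X / wmeas n w E \<le> ennreal (1 + B * \<epsilon> powr (1 / \<beta>))" .
  obtain e where e: "wmeas n w E = ennreal e" "0 < e"
    using E(2,3) by (cases "wmeas n w E") auto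
  show ?thesis
    using * less_divide_ennreal_iff[OF e(2), of "ennreal (1 + B * \<epsilon> powr (1 / \<beta>))" ?X]
    unfolding e(1) by (simp flip: not_less)
qed

text \<open>
  A point of \<open>I \<times> S\<close> lies in a box \<open>I \<times> Q\<close> with \<open>Q \<subseteq> S\<close>, and in this box \<open>E\<close> has density at least
  \<open>1 - |F| / |I|\<close>. As \<open>S\<close> is open, this holds at every point and differentiation theorems are avoided.
\<close>

lemma cylinder_subset_strong_maximal_level:
  assumes j: "j < n" and ab: "a < b" and F: "F \<in> sets borel" "F \<subseteq> {a..b}"
    and small: "len F < ennreal (\<epsilon> * (b - a))" and \<epsilon>: "0 < \<epsilon>" "\<epsilon> < 1"
    and S: "box_open ({..<n} - {j}) S"
    and E: "E \<in> sets (leb_prod {..<n})" "cylinder {..<n} j ({a..b} - F) S \<subseteq> E"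
  shows "cylinder {..<n} j {a..b} S \<subseteq>
    maximal_level n E (1 - \<epsilon>)"
proof
  let ?N = "{..<n}" and ?J = "{..<n} - {j}"
  fix x assume "x \<in> cylinder ?N j {a..b} S"
  then have x: "x \<in> space (leb_prod ?N)" "x j \<in> {a..b}" "restrict x ?J \<in> S" by (auto simp: cylinder_def)
  obtain p q where pq0: "(\<forall>i\<in>?J. p i < q i) \<and> restrict x ?J \<in> pbox ?J p q \<and>
      pbox ?J p q \<subseteq> S"
    using bspec[OF S[unfolded box_open_def] x(3)] by (elim exE) (rule that)
  have pq: "\<And>i. i \<in> ?J \<Longrightarrow> p i < q i" "restrict x ?J \<in> pbox ?J p q"
    "pbox ?J p q \<subseteq> S"
    by (fact bspec[OF conjunct1[OF pq0]] conjunct1[OF conjunct2[OF pq0]] conjunct2[OF conjunct2[OF pq0]])+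
  define p' where "p' = p(j := a)"
  define q' where "q' = q(j := b)"
  define R where "R = pbox ?N p' q'"
  define X where "X i = (if i = j then {a..b} - F else {p i..q i})" for i
  have lt: "p' i < q' i" if "i < n" for i using pq(1)[of i] ab that by (auto simp: p'_def q'_def)
  have Rr: "R \<in> rectangles n" unfolding rectangles_def R_def using lt by blast
  have xR: "x \<in> R"
    unfolding R_def
  proof (rule PiE_I)
    fix i assume "i \<in> ?N"
    then show "x i \<in> {p' i..q' i}"
      using PiE_mem[OF pq(2), of i] x(2) by (cases "i = j") (auto simp: p'_def q'_def)
  next
    fix i assume "i \<notin> ?N"
    then show "x i = undefined" using x(1) by (simp add: space_PiM PiE_def extensional_def)
  qed
  have PX: "Pi\<^sub>E ?N X \<subseteq> R \<inter> E"
  proof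
    fix z assume z: "z \<in> Pi\<^sub>E ?N X"
    have zj: "z j \<in> {a..b} - F" using PiE_mem[OF z, of j] j by (simp add: X_def)
    have zi: "z i \<in> {p i..q i}" if "i \<in> ?J" for i using PiE_mem[OF z, of i] that by (simp add: X_def)
    have zu: "z i = undefined" if "i \<notin> ?N" for i using PiE_arb[OF z that] .
    have "restrict z ?J \<in> pbox ?J p q" using zi by auto
    then have "restrict z ?J \<in> S" using pq(3) by blast
    moreover have "z \<in> space (leb_prod ?N)" using zu by (simp add: space_PiM PiE_def extensional_def)
    ultimately have "z \<in> E" using E(2) zj by (auto simp: cylinder_def)
    moreover have "z \<in> R"
      unfolding R_def
    proof (rule PiE_I)
      fix i assume "i \<in> ?N"
      then show "z i \<in> {p' i..q' i}" using zi[of i] zj by (cases "i = j") (auto simp: p'_def q'_def)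
    qed (use zu in auto)
    ultimately show "z \<in> R \<inter> E" by blast
  qed
  define V where "V = (\<Prod>i\<in>?J. q i - p i)"
  have V: "V > 0" unfolding V_def using pq(1) by (intro prod_pos) auto
  have N: "?N = insert j ?J" using j by auto
  have jJ: "j \<notin> ?J" "finite ?J" by auto
  have Rm: "R \<in> sets (leb_prod ?N)" unfolding R_def by (intro sets_box) auto
  have eR: "emeasure (leb_prod ?N) R = ennreal ((b - a) * V)"
  proof -
    have "emeasure (leb_prod ?N) R = ennreal (\<Prod>i\<in>?N. q' i - p' i)"
      unfolding R_def using lt by (intro emeasure_cbox_leb_prod) (auto intro: less_imp_le)
    also have "(\<Prod>i\<in>?N. q' i - p' i) = (q' j - p' j) * (\<Prod>i\<in>?J. q' i - p' i)"
      by (subst N, subst prod.insert[OF jJ(2,1)]) simp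
    also have "(\<Prod>i\<in>?J. q' i - p' i) = V" unfolding V_def by (intro prod.cong) (auto simp: p'_def q'_def)
    finally show ?thesis by (simp add: p'_def q'_def)
  qed
  obtain f where f: "len F = ennreal f" "0 \<le> f"
    using small by (cases "len F") auto
  have fl: "f < \<epsilon> * (b - a)" using small f by (simp add: ennreal_less_iff)
  have eD: "len ({a..b} - F) = ennreal (b - a - f)"
    using F ab f by (subst emeasure_Diff) (auto simp: ennreal_minus)
  have eX: "emeasure (leb_prod ?N) (Pi\<^sub>E ?N X) = ennreal ((b - a - f) * V)"
  proof -
    have "emeasure (leb_prod ?N) (Pi\<^sub>E ?N X) = (\<Prod>i\<in>?N. len (X i))"
      using F(1) by (intro emeasure_box) (auto simp: X_def)
    also have "\<dots> = len (X j) * (\<Prod>i\<in>?J. len (X i))"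
      by (subst N, subst prod.insert[OF jJ(2,1)]) simp
    also have "(\<Prod>i\<in>?J. len (X i)) = (\<Prod>i\<in>?J. ennreal (q i - p i))"
      using pq(1) by (intro prod.cong) (auto simp: X_def less_imp_le)
    also have "\<dots> = ennreal V" unfolding V_def using pq(1) by (intro prod_ennreal) (auto intro: less_imp_le)
    also have "len (X j) = ennreal (b - a - f)" using eD by (simp add: X_def)
    finally show ?thesis using V by (subst ennreal_mult'') auto
  qed
  have "ennreal (1 - \<epsilon>) * ennreal ((b - a) * V) = ennreal ((1 - \<epsilon>) * ((b - a) * V))"
    using \<epsilon> ab V by (intro ennreal_mult[symmetric]) auto
  also have "\<dots> < ennreal ((b - a - f) * V)"
  proof (rule ennreal_lessI)
    have "\<epsilon> * (b - a) < 1 * (b - a)" using \<epsilon> ab by (intro mult_strict_right_mono) auto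
    then show "0 < (b - a - f) * V" using fl V by (intro mult_pos_pos) auto
    have "((1 - \<epsilon>) * (b - a)) * V < (b - a - f) * V"
      using fl V by (intro mult_strict_right_mono) (auto simp: algebra_simps)
    then show "(1 - \<epsilon>) * ((b - a) * V) < (b - a - f) * V" by (simp add: mult.assoc)
  qed
  also have "\<dots> \<le> emeasure (leb_prod ?N) (R \<inter> E)"
    unfolding eX[symmetric] using PX Rm E(1) by (intro emeasure_mono) auto
  finally have "ennreal (1 - \<epsilon>) < emeasure (leb_prod ?N) (R \<inter> E) / ennreal ((b - a) * V)"
    using ab V by (subst less_divide_ennreal_iff) auto
  also have "emeasure (leb_prod ?N) (R \<inter> E) = (\<integral>\<^sup>+y. indicator (R \<inter> E) y \<partial>leb_prod ?N)" using Rm E(1) by simp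
  also have "\<dots> = (\<integral>\<^sup>+y\<in>R. ennreal \<bar>indicator E y\<bar> \<partial>leb ?N)"
    unfolding nn_integral_leb by (intro nn_integral_cong) (auto simp: indicator_def)
  also have "(\<integral>\<^sup>+y\<in>R. ennreal \<bar>indicator E y\<bar> \<partial>leb ?N) / ennreal ((b - a) * V) \<le> strong_maximal n (indicator E) x"
    unfolding strong_maximal_def using Rr xR Rm eR
    by (intro SUP_upper2[of R]) (auto simp: emeasure_leb)
  finally show "x \<in> maximal_level n E (1 - \<epsilon>)"
    using x(1) by simp
qed

text \<open>
  The distribution function of a measure without atoms is continuous, so it takes every small value.
\<close>

lemma exists_small_positive_lower_part:
  fixes \<nu> :: "real measure"
  assumes \<nu>: "sets \<nu> = sets borel" "emeasure \<nu> UNIV < \<infinity>" "\<And>t. emeasure \<nu> {t} = 0"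
    and pos: "0 < emeasure \<nu> UNIV" and \<eta>: "0 < \<eta>"
  shows "\<exists>s. 0 < emeasure \<nu> {..s} \<and> emeasure \<nu> {..s} < ennreal \<eta>"
proof -
  have sp: "space \<nu> = UNIV" using sets_eq_imp_space_eq[OF \<nu>(1)] by simp
  interpret finite_borel_measure \<nu>
    by (intro finite_borel_measure.intro finite_measureI finite_borel_measure_axioms.intro)
       (use \<nu>(1,2) in \<open>simp_all add: sp less_top\<close>)
  have m: "measure \<nu> UNIV > 0"
    using pos \<nu>(2) by (simp add: measure_def enn2real_positive_iff)
  have cont: "isCont (cdf \<nu>) x" for x unfolding isCont_cdf using \<nu>(3) by (simp add: measure_def)
  define v where "v = min (\<eta> / 2) (measure \<nu> UNIV / 2)"
  have v: "0 < v" "v < \<eta>" "v < measure \<nu> UNIV" using m \<eta> by (auto simp: v_def)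
  have "eventually (\<lambda>i. cdf \<nu> (- real i) < v) sequentially"
    using cdf_lim_neg_infty v(1) by (rule order_tendstoD)
  moreover have "eventually (\<lambda>i. cdf \<nu> (real i) > v) sequentially"
    using cdf_lim_infty v(3) unfolding sp by (rule order_tendstoD)
  ultimately have "eventually (\<lambda>i. cdf \<nu> (- real i) < v \<and> cdf \<nu> (real i) > v) sequentially"
    by (rule eventually_conj)
  then obtain i :: nat where i: "cdf \<nu> (- real i) < v" "cdf \<nu> (real i) > v"
    by (auto simp: eventually_sequentially)
  have "\<exists>s\<ge>- real i. s \<le> real i \<and> cdf \<nu> s = v"
    using i cont by (intro IVT) auto
  then obtain s where s: "cdf \<nu> s = v" by blast
  have "emeasure \<nu> {..s} = ennreal v" using s by (simp add: cdf_def emeasure_eq_measure)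
  then show ?thesis using v by (intro exI[of _ s]) (simp add: ennreal_less_iff)
qed

text \<open>
  If \<open>(I - F) \<times> S\<close> has positive mass, it is a test set and the conclusion is the test inequality after
  subtracting its mass from both sides. If it has mass \<open>0\<close>, the test sets are obtained by adding a slab
  \<open>(I \<inter> {..s}) \<times> S\<close> of arbitrarily small positive mass; they show that \<open>I \<times> S\<close> has mass \<open>0\<close> too.
\<close>

lemma weight_thin_cylinder_le:
  fixes M :: "(nat \<Rightarrow> real) measure"
  assumes j: "j < n" and ab: "a < b" and F: "F \<in> sets borel" "F \<subseteq> {a..b}"
    and small: "len F < ennreal (\<epsilon> * (b - a))" and \<epsilon>: "0 < \<epsilon>" "\<epsilon> < 1" and c: "0 \<le> c"
    and S: "box_open ({..<n} - {j}) S" "S \<in> sets (leb_prod ({..<n} - {j}))"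
    and M: "sets M = sets (leb_prod {..<n})"
    and fin: "emeasure M (cylinder {..<n} j {a..b} S) < \<infinity>"
    and diffuse: "\<And>t. emeasure M (cylinder {..<n} j {t} S) = 0"
    and test: "\<And>E X. E \<in> sets M \<Longrightarrow> 0 < emeasure M E \<Longrightarrow> emeasure M E < \<infinity> \<Longrightarrow> X \<in> sets M \<Longrightarrow>
      X \<subseteq> maximal_level n E (1 - \<epsilon>) \<Longrightarrow>
      emeasure M X \<le> ennreal (1 + c) * emeasure M E"
  shows "emeasure M (cylinder {..<n} j F S) \<le> ennreal c * emeasure M (cylinder {..<n} j {a..b} S)"
proof -
  let ?C = "\<lambda>T. cylinder {..<n} j T S"
  have Cm: "?C T \<in> sets M" if "T \<in> sets borel" for T
    unfolding M using j that S(2) by (intro sets_cylinder) auto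
  have Cmono: "emeasure M (?C T) \<le> emeasure M (?C T')" if "T \<subseteq> T'" "T' \<in> sets borel" for T T'
    using that Cm[OF that(2)] by (intro emeasure_mono) (auto simp: cylinder_def)
  have Cun: "emeasure M (?C (T \<union> T')) \<le> emeasure M (?C T) + emeasure M (?C T')" if "T \<in> sets borel" "T' \<in> sets borel" for T T'
  proof -
    have "?C (T \<union> T') = ?C T \<union> ?C T'" by (auto simp: cylinder_def)
    then show ?thesis using emeasure_subadditive[OF Cm[OF that(1)] Cm[OF that(2)]] by simp
  qed
  have testC: "emeasure M (?C {a..b}) \<le> ennreal (1 + c) * emeasure M (?C T)"
    if T: "T \<in> sets borel" "{a..b} - F \<subseteq> T" "T \<subseteq> {a..b}" and pos: "0 < emeasure M (?C T)" for T
  proof (rule test)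
    show "emeasure M (?C T) < \<infinity>" using Cmono[OF T(3)] fin by (auto intro: le_less_trans)
    show "?C {a..b} \<subseteq> maximal_level n (?C T) (1 - \<epsilon>)"
      using T(2) Cm[OF T(1)] M
      by (intro cylinder_subset_strong_maximal_level[OF j ab F small \<epsilon> S(1)]) (auto simp: cylinder_def)
  qed (use Cm T pos in auto)
  show ?thesis
  proof (cases "emeasure M (?C ({a..b} - F)) = 0")
    case False
    have "?C {a..b} = ?C F \<union> ?C ({a..b} - F)" using F(2) by (auto simp: cylinder_def)
    moreover have "?C F \<inter> ?C ({a..b} - F) = {}" by (auto simp: cylinder_def)
    ultimately have add: "emeasure M (?C {a..b}) = emeasure M (?C F) + emeasure M (?C ({a..b} - F))"
      using Cm F(1) by (simp add: plus_emeasure)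
    have fin': "emeasure M (?C ({a..b} - F)) < \<infinity>" using Cmono[of "{a..b} - F" "{a..b}"] fin by (auto intro: le_less_trans)
    have "emeasure M (?C F) + emeasure M (?C ({a..b} - F)) \<le> ennreal (1 + c) * emeasure M (?C ({a..b} - F))"
      unfolding add[symmetric] using F False by (intro testC) (auto simp: zero_less_iff_neq_zero)
    also have "\<dots> = ennreal c * emeasure M (?C ({a..b} - F)) + emeasure M (?C ({a..b} - F))"
      using c by (simp add: ennreal_plus distrib_right add.commute)
    finally have "emeasure M (?C F) \<le> ennreal c * emeasure M (?C ({a..b} - F))"
      using fin' by (auto simp: ennreal_add_left_cancel_le add.commute)
    also have "\<dots> \<le> ennreal c * emeasure M (?C {a..b})" by (intro mult_left_mono Cmono) auto
    finally show ?thesis .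
  next
    case True
    have "emeasure M (?C {a..b}) = 0"
    proof (rule ccontr)
      assume n0: "emeasure M (?C {a..b}) \<noteq> 0"
      obtain m where m: "emeasure M (?C {a..b}) = ennreal m" "0 < m"
        using n0 fin by (cases "emeasure M (?C {a..b})") (auto simp: less_le)
      define \<nu> where "\<nu> = distr (density M (indicator (?C {a..b}))) borel (\<lambda>x. x j)"
      have comp: "(\<lambda>x. x j) \<in> borel_measurable M"
        using measurable_component_singleton[of j "{..<n}" "\<lambda>_. lborel :: real measure"] j
        by (simp cong: measurable_cong_sets add: M)
      have e\<nu>: "emeasure \<nu> T = emeasure M (?C ({a..b} \<inter> T))" if T: "T \<in> sets borel" for T
      proof -
        have T': "(\<lambda>x. x j) -` T \<inter> space M \<in> sets M" using measurable_sets[OF comp T] .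
        have "emeasure \<nu> T = emeasure (density M (indicator (?C {a..b}))) ((\<lambda>x. x j) -` T \<inter> space M)"
          unfolding \<nu>_def using comp T by (subst emeasure_distr) auto
        also have "\<dots> = (\<integral>\<^sup>+x. indicator (?C {a..b}) x * indicator ((\<lambda>x. x j) -` T \<inter> space M) x \<partial>M)"
          using T' Cm[of "{a..b}"] by (intro emeasure_density) auto
        also have "\<dots> = (\<integral>\<^sup>+x. indicator (?C ({a..b} \<inter> T)) x \<partial>M)"
          by (intro nn_integral_cong) (auto simp: indicator_def cylinder_def)
        also have "\<dots> = emeasure M (?C ({a..b} \<inter> T))" using Cm[of "{a..b} \<inter> T"] T by simp
        finally show ?thesis .
      qed
      have "\<exists>s. 0 < emeasure \<nu> {..s} \<and> emeasure \<nu> {..s} < ennreal (m / (1 + c))"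
      proof (rule exists_small_positive_lower_part)
        show "emeasure \<nu> {t} = 0" for t
          using Cmono[of "{a..b} \<inter> {t}" "{t}"] diffuse[of t] by (simp add: e\<nu> del: Int_insert_right)
      qed (use fin m c in \<open>auto simp: e\<nu> \<nu>_def[THEN arg_cong[where f=sets]]\<close>)
      then obtain s where s: "0 < emeasure \<nu> {..s}" "emeasure \<nu> {..s} < ennreal (m / (1 + c))" by blast
      let ?T = "({a..b} - F) \<union> ({a..b} \<inter> {..s})"
      have Tle: "emeasure M (?C ?T) \<le> emeasure \<nu> {..s}"
        using Cun[of "{a..b} - F" "{a..b} \<inter> {..s}"] F(1) True by (simp add: e\<nu>)
      have Tge: "emeasure \<nu> {..s} \<le> emeasure M (?C ?T)"
        using F(1) by (subst e\<nu>) (auto intro!: Cmono)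
      have "emeasure M (?C {a..b}) \<le> ennreal (1 + c) * emeasure M (?C ?T)"
        using F(1) s(1) Tge by (intro testC) (auto intro: less_le_trans)
      also have "\<dots> \<le> ennreal (1 + c) * emeasure \<nu> {..s}" by (intro mult_left_mono Tle) simp
      also have "\<dots> < ennreal (1 + c) * ennreal (m / (1 + c))"
      proof (rule ennreal_mult_strict_left_mono[OF s(2)])
        show "0 < ennreal (1 + c)" using c by (subst ennreal_less_zero_iff) linarith
      qed simp
      also have "\<dots> = ennreal ((1 + c) * (m / (1 + c)))" using c m by (intro ennreal_mult[symmetric]) auto
      also have "(1 + c) * (m / (1 + c)) = m" using c by (intro nonzero_mult_div_cancel_left[of "1 + c" m, unfolded times_divide_eq_right[symmetric]]) linarith
      finally show False using m by simp
    qed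
    then show ?thesis using Cmono[OF F(2)] by simp
  qed
qed

section \<open>From open products to almost every slice\<close>

lemma slice_cylinder:
  assumes "j \<in> J" "y \<in> space (leb_prod (J - {j}))"
  shows "{t. y(j := t) \<in> cylinder J j T S} = (if y \<in> S then T else {})"
proof -
  have "restrict (y(j := t)) (J - {j}) = y" for t
  proof
    fix i show "restrict (y(j := t)) (J - {j}) i = y i"
      using assms(2) by (auto simp: space_PiM PiE_def extensional_def restrict_def)
  qed
  then show ?thesis using space_upd_minus[OF assms] by (auto simp: cylinder_def)
qed

lemma measurable_emeasure_slice_measure:
  assumes j: "j \<in> J" and w: "w \<in> borel_measurable (leb_prod J)" and T: "T \<in> sets borel"
  shows "(\<lambda>y. emeasure (slice_measure j w y) T) \<in> borel_measurable (leb_prod (J - {j}))"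
  using measurable_slice_mass[OF j w sets_cylinder[OF j T sets.top]] slice_cylinder[OF j, of _ T]
  by (simp cong: measurable_cong)

lemma emeasure_cylinder:
  assumes J: "finite J" "j \<in> J" and w: "w \<in> borel_measurable (leb_prod J)" and T: "T \<in> sets borel"
    and S: "S \<in> sets (leb_prod (J - {j}))"
  shows "emeasure (density (leb_prod J) (\<lambda>x. ennreal (w x))) (cylinder J j T S) =
    (\<integral>\<^sup>+y\<in>S. emeasure (slice_measure j w y) T \<partial>leb_prod (J - {j}))"
proof -
  have C: "cylinder J j T S \<in> sets (leb_prod J)" by (rule sets_cylinder[OF J(2) T S])
  have "emeasure (density (leb_prod J) (\<lambda>x. ennreal (w x))) (cylinder J j T S) =
      (\<integral>\<^sup>+x\<in>cylinder J j T S. ennreal (w x) \<partial>leb_prod J)"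
    using w C by (intro emeasure_density) auto
  also have "\<dots> = (\<integral>\<^sup>+y\<in>S. emeasure (slice_measure j w y) T \<partial>leb_prod (J - {j}))"
    unfolding nn_integral_slice_mass[OF J w C]
    by (intro nn_integral_cong) (simp add: slice_cylinder[OF J(2)])
  finally show ?thesis .
qed

text \<open>
  Points of the space indexed by \<open>J\<close> are functions on all of \<open>nat\<close>, so measures on it can be viewed as Borel
  measures on the Polish space \<open>nat \<Rightarrow> real\<close>, where outer regularity is available.
\<close>

lemma measurable_leb_prod_borel: "(\<lambda>x. x) \<in> leb_prod J \<rightarrow>\<^sub>M (borel :: (nat \<Rightarrow> real) measure)"
proof (rule measurable_coordinatewise_then_product)
  fix i
  show "(\<lambda>x. x i) \<in> borel_measurable (leb_prod J)"
  proof (cases "i \<in> J")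
    case True
    then show ?thesis using measurable_component_singleton[of i J "\<lambda>_. lborel :: real measure"] by simp
  next
    case False
    then have "x i = undefined" if "x \<in> space (leb_prod J)" for x
      using that by (simp add: space_PiM PiE_def extensional_def)
    then have "(\<lambda>x. x i) \<in> borel_measurable (leb_prod J) \<longleftrightarrow> (\<lambda>_. undefined :: real) \<in> borel_measurable (leb_prod J)"
      by (intro measurable_cong)
    then show ?thesis by simp
  qed
qed

lemma measurable_restrict_borel: "(\<lambda>x. restrict x J) \<in> (borel :: (nat \<Rightarrow> real) measure) \<rightarrow>\<^sub>M leb_prod J"
proof -
  have "(\<lambda>x. restrict x J) \<in> Pi\<^sub>M UNIV (\<lambda>_::nat. borel :: real measure) \<rightarrow>\<^sub>M Pi\<^sub>M J (\<lambda>_. borel :: real measure)"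
    by (rule measurable_restrict_subset) auto
  moreover have "sets (Pi\<^sub>M J (\<lambda>_. borel :: real measure)) = sets (leb_prod J)"
    by (rule sets_PiM_cong) auto
  ultimately show ?thesis
    by (simp cong: measurable_cong_sets add: sets_PiM_equal_borel)
qed

definition open_cube :: "nat set \<Rightarrow> nat \<Rightarrow> (nat \<Rightarrow> real) set" where
  "open_cube J m = Pi\<^sub>E J (\<lambda>_. {- real m<..<real m})"

text \<open>
  Outside \<open>J\<close> all points of the space have the value \<open>undefined\<close>, so a basic open neighbourhood restricts only
  coordinates in \<open>J\<close>. The cube is there to keep masses finite.
\<close>

lemma box_open_Int_cube:
  fixes U :: "(nat \<Rightarrow> real) set"
  assumes "open U"
  shows "box_open J (U \<inter> open_cube J m)"
  unfolding box_open_def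
proof
  fix y assume y: "y \<in> U \<inter> open_cube J m"
  have "openin (product_topology (\<lambda>_. euclidean :: real topology) UNIV) U"
    using assms by (simp add: euclidean_product_topology)
  from product_topology_open_contains_basis[OF this, of y] y
  obtain X where X: "y \<in> Pi\<^sub>E UNIV X" "\<And>i. open (X i)" "Pi\<^sub>E UNIV X \<subseteq> U" by auto
  have "\<exists>e>0. cball (y i) e \<subseteq> X i \<inter> {- real m<..<real m}" if "i \<in> J" for i
  proof -
    have "y i \<in> X i \<inter> {- real m<..<real m}" using X(1) y that by (auto simp: open_cube_def)
    moreover have "open (X i \<inter> {- real m<..<real m})" using X(2) by auto
    ultimately show ?thesis using open_contains_cball by blast
  qed
  then obtain e where e: "\<And>i. i \<in> J \<Longrightarrow> e i > 0" "\<And>i. i \<in> J \<Longrightarrow> cball (y i) (e i) \<subseteq> X i \<inter> {- real m<..<real m}"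
    by metis
  have sub: "z i \<in> X i \<inter> {- real m<..<real m}" if "z i \<in> {y i - e i..y i + e i}" "i \<in> J" for i and z :: "nat \<Rightarrow> real"
    using that e(2)[OF that(2)] by (auto simp: cball_eq_atLeastAtMost)
  have ext: "y i = undefined" if "i \<notin> J" for i using y that by (auto simp: open_cube_def)
  show "\<exists>a b. (\<forall>i\<in>J. a i < b i) \<and> y \<in> pbox J a b \<and> pbox J a b \<subseteq> U \<inter> open_cube J m"
  proof (rule exI[of _ "\<lambda>i. y i - e i"], rule exI[of _ "\<lambda>i. y i + e i"], intro conjI ballI)
    show "y i - e i < y i + e i" if "i \<in> J" for i using e(1)[OF that] by simp
    show "y \<in> Pi\<^sub>E J (\<lambda>i. {y i - e i..y i + e i})"
      using e(1) ext by (intro PiE_I) (auto simp: less_imp_le)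
    show "Pi\<^sub>E J (\<lambda>i. {y i - e i..y i + e i}) \<subseteq> U \<inter> open_cube J m"
    proof
      fix z assume z: "z \<in> Pi\<^sub>E J (\<lambda>i. {y i - e i..y i + e i})"
      have zi: "z i \<in> X i \<inter> {- real m<..<real m}" if "i \<in> J" for i using sub[of z i] PiE_mem[OF z that] that by blast
      have "z i \<in> X i" for i
      proof (cases "i \<in> J")
        case False
        then have "z i = y i" using PiE_arb[OF z] ext by simp
        then show ?thesis using X(1) by auto
      qed (use zi in blast)
      then have "z \<in> U" using X(3) by auto
      moreover have "z \<in> open_cube J m" unfolding open_cube_def using zi PiE_arb[OF z] by (intro PiE_I) blast+
      ultimately show "z \<in> U \<inter> open_cube J m" by blast
    qed
  qed
qed

text \<open>
  The test inequality for open sets \<open>S\<close> in the remaining variables extends to Borel sets \<open>S\<close> by outer regularity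
  of the measure \<open>S \<mapsto> w(I \<times> S)\<close>, localised to a cube. Applied to the set where the claimed inequality
  between slices fails, it shows that this set is null.
\<close>

lemma AE_slice_thin_le:
  fixes w :: "(nat \<Rightarrow> real) \<Rightarrow> real"
  assumes j: "j < n" and w: "w \<in> borel_measurable (leb_prod {..<n})"
    and fin: "\<And>a b. (\<integral>\<^sup>+x\<in>pbox {..<n} a b. ennreal (w x) \<partial>leb_prod {..<n}) < \<infinity>"
    and ab: "a < b" and F: "F \<in> sets borel" "F \<subseteq> {a..b}"
    and small: "len F < ennreal (\<epsilon> * (b - a))" and \<epsilon>: "0 < \<epsilon>" "\<epsilon> < 1" and c: "0 < c"
    and M: "M = density (leb_prod {..<n}) (\<lambda>x. ennreal (w x))"
    and test: "\<And>E X. E \<in> sets M \<Longrightarrow> 0 < emeasure M E \<Longrightarrow> emeasure M E < \<infinity> \<Longrightarrow> X \<in> sets M \<Longrightarrow>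
      X \<subseteq> maximal_level n E (1 - \<epsilon>) \<Longrightarrow>
      emeasure M X \<le> ennreal (1 + c) * emeasure M E"
  shows "AE y in leb_prod ({..<n} - {j}).
    emeasure (slice_measure j w y) F \<le> ennreal c * emeasure (slice_measure j w y) {a..b}"
proof -
  let ?N = "{..<n}" and ?J = "{..<n} - {j}"
  let ?L = "leb_prod ({..<n} - {j})"
  have jn: "finite ?N" "j \<in> ?N" using j by auto
  define f where "f y = emeasure (slice_measure j w y) F" for y
  define g where "g y = emeasure (slice_measure j w y) {a..b}" for y
  have fm: "f \<in> borel_measurable ?L" and gm: "g \<in> borel_measurable ?L"
    unfolding f_def g_def using F(1) by (auto intro!: measurable_emeasure_slice_measure jn w)
  have sM: "sets M = sets (leb_prod ?N)" by (simp add: M)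
  have cyl: "emeasure M (cylinder ?N j T S) = (\<integral>\<^sup>+y\<in>S. emeasure (slice_measure j w y) T \<partial>?L)"
    if "T \<in> sets borel" "S \<in> sets ?L" for T S
    unfolding M by (rule emeasure_cylinder[OF jn w that])
  have cube: "open_cube ?J m \<in> sets ?L" for m unfolding open_cube_def by (intro sets_box) auto
  have openm: "U \<inter> open_cube ?J m \<in> sets ?L" if "open U" for U m
  proof -
    have "(\<lambda>x. x) -` U \<inter> space ?L \<in> sets ?L"
      using that by (intro measurable_sets[OF measurable_leb_prod_borel]) auto
    then have "((\<lambda>x. x) -` U \<inter> space ?L) \<inter> open_cube ?J m \<in> sets ?L" using cube by (rule sets.Int)
    moreover have "((\<lambda>x. x) -` U \<inter> space ?L) \<inter> open_cube ?J m = U \<inter> open_cube ?J m"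
      using sets.sets_into_space[OF cube[of m]] by auto
    ultimately show ?thesis by simp
  qed
  have cubefin: "emeasure M (cylinder ?N j {a..b} (open_cube ?J m)) < \<infinity>" for m
  proof -
    let ?B = "Pi\<^sub>E ?N (\<lambda>i. {((\<lambda>_. - real m)(j := a)) i..((\<lambda>_. real m)(j := b)) i})"
    have "cylinder ?N j {a..b} (open_cube ?J m) \<subseteq> ?B"
    proof
      fix x assume x: "x \<in> cylinder ?N j {a..b} (open_cube ?J m)"
      show "x \<in> ?B"
      proof (rule PiE_I)
        fix i assume i: "i \<in> ?N"
        have "restrict x ?J \<in> open_cube ?J m" using x by (simp add: cylinder_def)
        then have "x i \<in> {- real m<..<real m}" if "i \<noteq> j"
          using PiE_mem[of "restrict x ?J" ?J _ i] i that unfolding open_cube_def by fastforce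
        then show "x i \<in> {((\<lambda>_. - real m)(j := a)) i..((\<lambda>_. real m)(j := b)) i}"
          using x by (cases "i = j") (auto simp: cylinder_def)
      next
        fix i assume "i \<notin> ?N"
        then show "x i = undefined" using x by (simp add: cylinder_def space_PiM PiE_def extensional_def)
      qed
    qed
    moreover have Bm: "?B \<in> sets (leb_prod ?N)" by (intro sets_box) auto
    ultimately have "emeasure M (cylinder ?N j {a..b} (open_cube ?J m)) \<le> emeasure M ?B"
      by (intro emeasure_mono) (simp_all add: sM)
    also have "emeasure M ?B = (\<integral>\<^sup>+x\<in>?B. ennreal (w x) \<partial>leb_prod ?N)"
      unfolding M using w Bm by (intro emeasure_density) auto
    also have "\<dots> < \<infinity>" by (rule fin)
    finally show ?thesis .
  qed
  have main: "AE y in ?L. y \<in> open_cube ?J m \<longrightarrow> f y \<le> ennreal c * g y" for m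
  proof -
    define S where "S = {y \<in> space ?L. y \<in> open_cube ?J m \<and> ennreal c * g y < f y}"
    have Sm: "S \<in> sets ?L"
    proof -
      have "S = open_cube ?J m \<inter> {y \<in> space ?L. ennreal c * g y < f y}" by (auto simp: S_def)
      also have "\<dots> \<in> sets ?L" using cube fm gm by (intro sets.Int borel_measurable_less) auto
      finally show ?thesis .
    qed
    \<comment> \<open>The measure \<open>S \<mapsto> w({a..b} \<times> S)\<close> on the cube, pushed to the
      Polish space of all functions.\<close>
    define P where "P = distr (density ?L (\<lambda>y. g y * indicator (open_cube ?J m) y)) borel (\<lambda>x. x)"
    have eP: "emeasure P V = (\<integral>\<^sup>+y. (g y * indicator (open_cube ?J m) y) * indicator V y \<partial>?L)"
      if V: "V \<in> sets borel" for V
    proof -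
      have idm: "(\<lambda>x. x) \<in> density ?L (\<lambda>y. g y * indicator (open_cube ?J m) y) \<rightarrow>\<^sub>M borel"
        using measurable_leb_prod_borel by simp
      have V': "(\<lambda>x. x) -` V \<inter> space ?L \<in> sets ?L" using measurable_sets[OF measurable_leb_prod_borel V] .
      have "emeasure P V = emeasure (density ?L (\<lambda>y. g y * indicator (open_cube ?J m) y)) ((\<lambda>x. x) -` V \<inter> space ?L)"
        unfolding P_def by (subst emeasure_distr[OF idm V]) simp
      also have "\<dots> = (\<integral>\<^sup>+y. (g y * indicator (open_cube ?J m) y) * indicator ((\<lambda>x. x) -` V \<inter> space ?L) y \<partial>?L)"
        using gm cube V' by (intro emeasure_density) auto
      also have "\<dots> = (\<integral>\<^sup>+y. (g y * indicator (open_cube ?J m) y) * indicator V y \<partial>?L)"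
        by (intro nn_integral_cong) (auto simp: indicator_def)
      finally show ?thesis .
    qed
    have Pg: "emeasure P U = emeasure M (cylinder ?N j {a..b} (U \<inter> open_cube ?J m))" if "open U" for U
      using that openm[OF that]
      by (subst eP, simp, subst cyl, simp, simp) (auto intro!: nn_integral_cong simp: g_def indicator_def)
    have Pfin: "emeasure P (space P) \<noteq> \<infinity>"
      using Pg[of UNIV] cubefin[of m] by (simp add: P_def)
    define S' where "S' = (\<lambda>x. restrict x ?J) -` S"
    have S': "S' \<in> sets borel"
      using measurable_sets[OF measurable_restrict_borel Sm] by (simp add: S'_def)
    have S'S: "y \<in> S' \<longleftrightarrow> y \<in> S" if "y \<in> space ?L" for y
    proof -
      have "restrict y ?J = y" using that by (intro extensional_restrict) (simp add: space_PiM PiE_def)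
      then show ?thesis by (simp add: S'_def)
    qed
    have fS: "(\<integral>\<^sup>+y\<in>S. f y \<partial>?L) \<le> ennreal c * emeasure P U" if U: "S' \<subseteq> U" "open U" for U
    proof -
      have "(\<integral>\<^sup>+y\<in>S. f y \<partial>?L) \<le> (\<integral>\<^sup>+y\<in>U \<inter> open_cube ?J m. f y \<partial>?L)"
      proof (intro nn_integral_mono mult_left_mono indicator_leI)
        fix y assume y: "y \<in> space ?L" "y \<in> S"
        then have "y \<in> S'" using S'S by blast
        then show "y \<in> U \<inter> open_cube ?J m" using U(1) y by (auto simp: S_def)
      qed simp
      also have "\<dots> = emeasure M (cylinder ?N j F (U \<inter> open_cube ?J m))"
        using cyl[OF F(1) openm[OF U(2)]] by (simp add: f_def)
      also have "\<dots> \<le> ennreal c * emeasure M (cylinder ?N j {a..b} (U \<inter> open_cube ?J m))"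
      proof (rule weight_thin_cylinder_le[OF j ab F small \<epsilon> less_imp_le[OF c] box_open_Int_cube[OF U(2)] openm[OF U(2)] sM _ _ test])
        have "emeasure M (cylinder ?N j {a..b} (U \<inter> open_cube ?J m)) \<le> emeasure M (cylinder ?N j {a..b} (open_cube ?J m))"
          using sets_cylinder[OF jn(2), of "{a..b}", OF _ cube] by (intro emeasure_mono) (auto simp: cylinder_def sM)
        then show "emeasure M (cylinder ?N j {a..b} (U \<inter> open_cube ?J m)) < \<infinity>" using cubefin by (rule le_less_trans)
        fix t :: real
        have "emeasure (slice_measure j w y) {t} = 0" if "y \<in> space ?L" for y
        proof -
          have "(\<integral>\<^sup>+s\<in>{t}. ennreal (w (y(j := s))) \<partial>lborel) = 0"
            by (intro nn_integral_null_set) auto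
          then show ?thesis using emeasure_slice_measure[OF jn(2) w that, of "{t}"] by simp
        qed
        then have "(\<integral>\<^sup>+y\<in>U \<inter> open_cube ?J m. emeasure (slice_measure j w y) {t} \<partial>?L) = (\<integral>\<^sup>+y. 0 \<partial>?L)"
          by (intro nn_integral_cong) simp
        then show "emeasure M (cylinder ?N j {t} (U \<inter> open_cube ?J m)) = 0"
          using cyl[OF _ openm[OF U(2)], of "{t}"] by simp
      qed
      also have "\<dots> = ennreal c * emeasure P U" by (simp add: Pg[OF U(2)])
      finally show ?thesis .
    qed
    have "(\<integral>\<^sup>+y\<in>S. f y \<partial>?L) / ennreal c \<le> emeasure P S'"
    proof -
      have "emeasure P S' = (INF U\<in>{U. S' \<subseteq> U \<and> open U}. emeasure P U)"
        using Pfin S' by (intro outer_regular) (auto simp: P_def)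
      also have "\<dots> \<ge> (\<integral>\<^sup>+y\<in>S. f y \<partial>?L) / ennreal c"
        using fS c by (intro INF_greatest divide_le_posI_ennreal) (auto simp: mult.commute)
      finally show ?thesis .
    qed
    then have "\<not> emeasure P S' < (\<integral>\<^sup>+y\<in>S. f y \<partial>?L) / ennreal c" by (simp only: not_less)
    then have "\<not> emeasure P S' * ennreal c < (\<integral>\<^sup>+y\<in>S. f y \<partial>?L)"
      unfolding less_divide_ennreal_iff[OF c] .
    then have le: "(\<integral>\<^sup>+y\<in>S. f y \<partial>?L) \<le> ennreal c * emeasure P S'" by (simp add: not_less mult.commute)
    have PS: "ennreal c * emeasure P S' = (\<integral>\<^sup>+y\<in>S. ennreal c * g y \<partial>?L)"
    proof -
      have "emeasure P S' = (\<integral>\<^sup>+y. g y * indicator S y \<partial>?L)"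
        unfolding eP[OF S'] using S'S by (intro nn_integral_cong) (auto simp: indicator_def S_def)
      also have "ennreal c * \<dots> = (\<integral>\<^sup>+y. ennreal c * (g y * indicator S y) \<partial>?L)"
        using gm Sm by (intro nn_integral_cmult[symmetric]) auto
      finally show ?thesis by (simp add: mult.assoc)
    qed
    have Pfin': "ennreal c * emeasure P S' < \<infinity>"
    proof -
      have "emeasure P S' \<le> emeasure P (space P)" by (rule emeasure_space)
      then have "emeasure P S' < \<infinity>" using Pfin by (simp add: less_top top.not_eq_extremum le_less_trans)
      then show ?thesis by (simp add: ennreal_mult_less_top)
    qed
    have "(\<integral>\<^sup>+y. f y * indicator S y - ennreal c * g y * indicator S y \<partial>?L) =
      (\<integral>\<^sup>+y\<in>S. f y \<partial>?L) - (\<integral>\<^sup>+y\<in>S. ennreal c * g y \<partial>?L)"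
    proof (rule nn_integral_diff)
      show "(\<integral>\<^sup>+y\<in>S. ennreal c * g y \<partial>?L) \<noteq> \<infinity>" using Pfin' by (simp add: PS)
    qed (use fm gm Sm in \<open>auto simp: indicator_def S_def\<close>)
    also have "\<dots> = 0"
      using le Pfin' unfolding PS by (simp add: diff_eq_0_iff_ennreal)
    finally have "AE y in ?L. f y * indicator S y - ennreal c * g y * indicator S y = 0"
      using fm gm Sm by (subst (asm) nn_integral_0_iff_AE) auto
    then show ?thesis using AE_space
    proof eventually_elim
      case (elim y)
      show ?case
      proof (intro impI, rule ccontr)
        assume "y \<in> open_cube ?J m" "\<not> f y \<le> ennreal c * g y"
        then have "y \<in> S" "ennreal c * g y < f y" using elim(2) by (auto simp: S_def)
        then show False using elim(1) by (auto simp: diff_eq_0_iff_ennreal)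
      qed
    qed
  qed
  have "AE y in ?L. \<forall>m. y \<in> open_cube ?J m \<longrightarrow> f y \<le> ennreal c * g y"
    unfolding AE_all_countable by (intro allI main)
  then show ?thesis using AE_space
  proof eventually_elim
    case (elim y)
    obtain m where m: "Max (insert 0 ((\<lambda>i. \<bar>y i\<bar>) ` ?J)) < real m" using reals_Archimedean2 by blast
    have bnd: "\<bar>y i\<bar> < real m" if "i \<in> ?J" for i
      using le_less_trans[OF Max_ge[of "insert 0 ((\<lambda>i. \<bar>y i\<bar>) ` ?J)" "\<bar>y i\<bar>"] m] that by blast
    have "y \<in> open_cube ?J m"
      unfolding open_cube_def
    proof (rule PiE_I)
      fix i assume "i \<in> ?J"
      from bnd[OF this] show "y i \<in> {- real m<..<real m}" by (simp add: abs_less_iff)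
    next
      fix i assume "i \<notin> ?J"
      then show "y i = undefined" using elim(2) by (auto simp: space_PiM PiE_def extensional_def)
    qed
    from mp[OF spec[OF elim(1)] this] show ?case by (simp add: f_def g_def)
  qed
qed

section \<open>Sharpness\<close>

lemma measurable_completion_AE:
  assumes g: "g \<in> N \<rightarrow>\<^sub>M K" and f: "\<And>x. x \<in> space N \<Longrightarrow> f x \<in> space K" and eq: "AE x in N. f x = g x"
  shows "f \<in> completion N \<rightarrow>\<^sub>M K"
proof (rule measurableI)
  fix A assume A: "A \<in> sets K"
  obtain Z where Z: "{x \<in> space N. f x \<noteq> g x} \<subseteq> Z" "Z \<in> null_sets N"
    using eq by (auto elim!: AE_E simp: null_sets_def)
  have "f -` A \<inter> space N \<inter> Z \<in> null_sets (completion N)"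
    using Z(2) by (intro null_sets_completion_subset[OF _ null_sets_completionI[OF Z(2)]]) auto
  moreover have "(g -` A \<inter> space N) - Z \<in> sets (completion N)"
    using measurable_sets[OF g A] Z(2) by (intro sets_completionI_sets sets.Diff) auto
  moreover have "f -` A \<inter> space (completion N) = ((g -` A \<inter> space N) - Z) \<union> (f -` A \<inter> space N \<inter> Z)"
    using Z(1) by auto
  ultimately show "f -` A \<inter> space (completion N) \<in> sets (completion N)"
    by (simp only: null_setsD2 sets.Un)
qed (use f in simp)

text \<open>
  All suprema run over rational intervals, those inside the local maximal function included, so
  measurability in the slice parameter follows from Fubini's theorem.
\<close>

lemma measurable_SUP_fw_quotient:
  assumes J: "finite J" "j \<in> J" and w: "w \<in> borel_measurable (leb_prod J)"
  shows "(\<lambda>y. SUP I\<in>{I\<in>\<rat> \<times> \<rat>. fst I < snd I}. fw_quotient (slice_measure j w y) I) \<in> borel_measurable (leb_prod (J - {j}))"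
proof -
  let ?Q = "{I\<in>\<rat> \<times> \<rat>. fst I < (snd I :: real)}"
  have cQ: "countable ?Q" using countable_rat by (auto intro: countable_subset[of _ "\<rat> \<times> \<rat>"])
  have sl: "sets (slice_measure j w y) = sets borel" for y by (simp add: slice_measure_def)
  show ?thesis
  proof (rule borel_measurable_SUP[OF cQ])
    fix I :: "real \<times> real"
    define a b where "a = fst I" and "b = snd I"
    have "(\<lambda>y. \<integral>\<^sup>+x\<in>cint I. local_maximal (slice_measure j w y) a b x \<partial>lborel) \<in> borel_measurable (leb_prod (J - {j}))"
    proof (rule lborel.borel_measurable_nn_integral)
      have "(\<lambda>z. (SUP K\<in>?Q. emeasure (slice_measure j w (fst z)) ({a..b} \<inter> cint K) / ennreal (snd K - fst K) * indicator {fst K<..<snd K} (snd z)) * indicator (cint I) (snd z))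
        \<in> borel_measurable (leb_prod (J - {j}) \<Otimes>\<^sub>M lborel)"
      proof (intro borel_measurable_times_ennreal borel_measurable_SUP[OF cQ] borel_measurable_divide_ennreal)
        fix K :: "real \<times> real"
        show "(\<lambda>z. emeasure (slice_measure j w (fst z)) ({a..b} \<inter> cint K)) \<in> borel_measurable (leb_prod (J - {j}) \<Otimes>\<^sub>M lborel)"
          by (rule measurable_compose[OF measurable_fst measurable_emeasure_slice_measure[OF J(2) w]]) auto
        show "(\<lambda>z. indicator {fst K<..<snd K} (snd z) :: ennreal) \<in> borel_measurable (leb_prod (J - {j}) \<Otimes>\<^sub>M lborel)"
          by (intro measurable_compose[OF measurable_snd]) auto
        show "(\<lambda>z. indicator (cint I) (snd z) :: ennreal) \<in> borel_measurable (leb_prod (J - {j}) \<Otimes>\<^sub>M lborel)"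
          by (rule measurable_compose[OF measurable_snd borel_measurable_indicator]) simp
      qed simp
      then show "(\<lambda>(y, x). local_maximal (slice_measure j w y) a b x * indicator (cint I) x) \<in> borel_measurable (leb_prod (J - {j}) \<Otimes>\<^sub>M lborel)"
        by (simp add: case_prod_beta' local_maximal_eq_countable_SUP[OF sl])
    qed
    then show "(\<lambda>y. fw_quotient (slice_measure j w y) I) \<in> borel_measurable (leb_prod (J - {j}))"
      unfolding fw_quotient_def a_def b_def
      by (intro borel_measurable_divide_ennreal measurable_emeasure_slice_measure[OF J(2) w]) auto
  qed
qed

text \<open>
  The decay holds simultaneously for almost every slice, all rational intervals, all finite unions of
  rational subintervals and all scales \<open>2 ^ -m\<close> below \<open>exp (- \<gamma>)\<close>, because these data are countable.
\<close>

theorem strong_Ainf_const_le_of_tauberian: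
  fixes B \<beta> \<gamma> :: real
  assumes wt: "weight n w" and B: "B > 1" and \<beta>: "\<beta> > 1" and \<gamma>: "\<gamma> > 0"
    and H: "\<And>\<alpha>. \<alpha> < 1 \<Longrightarrow> \<alpha> > 1 - exp (- \<gamma>) \<Longrightarrow>
      tauberian n w \<alpha> - 1 \<le> ennreal (B * (1 - \<alpha>) powr (1 / \<beta>))"
  shows "strong_Ainf_const n w \<le> ennreal (12 * \<beta> * (1 + max (\<gamma> / \<beta>) (ln B)))"
  unfolding strong_Ainf_const_def
proof (rule SUP_least)
  fix j assume "j \<in> {..<n}"
  then have j: "j < n" and jn: "finite {..<n}" "j \<in> {..<n}" by auto
  let ?N = "{..<n}" and ?J = "{..<n} - {j}"
  let ?L = "leb_prod ({..<n} - {j})"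
  define A where "A = 12 * \<beta> * (1 + max (\<gamma> / \<beta>) (ln B))"
  have A0: "0 \<le> A"
    unfolding A_def using \<beta> \<gamma> by (intro mult_nonneg_nonneg add_nonneg_nonneg) (auto simp: le_max_iff_disj)
  obtain w' where w': "w' \<in> borel_measurable (leb_prod ?N)" "\<And>x. 0 \<le> w' x"
    "AE x in leb_prod ?N. w x = w' x"
    and boxfin: "\<And>a b. (\<integral>\<^sup>+x\<in>pbox {..<n} a b. ennreal (w' x) \<partial>leb_prod {..<n}) < \<infinity>"
    by (rule weight_borel_version[OF wt]) (rule that)
  define M where "M = density (leb_prod ?N) (\<lambda>x. ennreal (w' x))"
  have eM: "emeasure M X = wmeas n w X" if "X \<in> sets M" for X
    unfolding M_def wmeas_borel_version[OF w'(3)] using that w'(1) by (intro emeasure_density) (auto simp: M_def)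
  have test: "emeasure M X \<le> ennreal (1 + B * \<epsilon> powr (1 / \<beta>)) * emeasure M E"
    if \<epsilon>: "0 < \<epsilon>" "\<epsilon> < exp (- \<gamma>)" and E: "E \<in> sets M" "0 < emeasure M E" "emeasure M E < \<infinity>" and X: "X \<in> sets M"
      "X \<subseteq> maximal_level n E (1 - \<epsilon>)" for \<epsilon> E X
  proof -
    have "emeasure M X \<le> wmeas n w (maximal_level n E (1 - \<epsilon>))"
      unfolding eM[OF X(1)] wmeas_def
      by (intro nn_integral_mono mult_left_mono indicator_leI) (use X(2) in auto)
    also have "\<dots> \<le> ennreal (1 + B * \<epsilon> powr (1 / \<beta>)) * wmeas n w E"
      using B E \<epsilon> by (intro weight_level_le_of_tauberian[OF H]) (auto simp: M_def[THEN arg_cong[where f=sets]] eM[symmetric])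
    finally show ?thesis by (simp add: eM E)
  qed
  have expg: "exp (- \<gamma>) < 1" using \<gamma> by simp
  define rint where "rint I = {K \<in> \<rat> \<times> \<rat>. fst K < snd K \<and> cint K \<subseteq> cint I}" for I :: "real \<times> real"
  \<comment> \<open>The countable set of data for which the decay is used in
    \<open>integral_local_maximal_le\<close>.\<close>
  define \<I> where "\<I> = {(I, \<K>, m). I \<in> \<rat> \<times> \<rat> \<and> fst I < snd I \<and> finite \<K> \<and> \<K> \<subseteq> rint I \<and> (1/2) ^ m < exp (- \<gamma>) \<and>
     len (Cover \<K>) < ennreal ((1/2) ^ m * (snd I - fst I))}"
  have cI: "countable \<I>"
  proof (rule countable_subset)
    show "\<I> \<subseteq> (\<rat> \<times> \<rat>) \<times> {\<K>. finite \<K> \<and> \<K> \<subseteq> \<rat> \<times> \<rat>} \<times> (UNIV :: nat set)"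
      by (auto simp: \<I>_def rint_def)
    show "countable ((\<rat> \<times> \<rat>) \<times> {\<K>. finite \<K> \<and> \<K> \<subseteq> (\<rat> \<times> \<rat> :: (real \<times> real) set)} \<times> (UNIV :: nat set))"
      by (intro countable_SIGMA countable_Collect_finite_subset countable_rat) auto
  qed
  have "AE y in ?L. \<forall>i\<in>\<I>. case i of (I, \<K>, m) \<Rightarrow>
    emeasure (slice_measure j w' y) (Cover \<K>) \<le>
      ennreal (B * ((1/2) ^ m) powr (1 / \<beta>)) * emeasure (slice_measure j w' y) (cint I)"
    unfolding AE_ball_countable[OF cI]
  proof
    fix i assume "i \<in> \<I>"
    then obtain I \<K> m where i: "i = (I, \<K>, m)" and I: "I \<in> \<rat> \<times> \<rat>" "fst I < snd I" "finite \<K>" "\<K> \<subseteq> rint I"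
      "(1/2) ^ m < exp (- \<gamma>)" "len (Cover \<K>) < ennreal ((1/2) ^ m * (snd I - fst I))"
      by (auto simp: \<I>_def)
    have "AE y in ?L. emeasure (slice_measure j w' y) (Cover \<K>) \<le>
      ennreal (B * ((1/2) ^ m) powr (1 / \<beta>)) * emeasure (slice_measure j w' y) {fst I..snd I}"
    proof (rule AE_slice_thin_le[OF j w'(1) boxfin I(2) _ _ I(6) _ _ _ M_def])
      show "Cover \<K> \<in> sets borel" using I(3) by auto
      show "Cover \<K> \<subseteq> {fst I..snd I}" using I(4) unfolding rint_def cint_def by blast
      show "(1/2::real) ^ m < 1" using I(5) expg by linarith
      show "0 < B * ((1/2) ^ m) powr (1 / \<beta>)" using B by simp
    qed (use test[of "(1/2) ^ m"] I(5) in auto)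
    then show "AE y in ?L. case i of (I, \<K>, m) \<Rightarrow> emeasure (slice_measure j w' y) (Cover \<K>) \<le>
      ennreal (B * ((1/2) ^ m) powr (1 / \<beta>)) * emeasure (slice_measure j w' y) (cint I)"
      by (simp add: i cint_def)
  qed
  then have fw: "AE y in ?L. fujii_wilson (\<lambda>t. w (y(j := t))) \<le> ennreal A \<and>
      fujii_wilson (\<lambda>t. w (y(j := t))) = (SUP I\<in>{I\<in>\<rat> \<times> \<rat>. fst I < snd I}. fw_quotient (slice_measure j w' y) I)"
    using AE_diffuse_radon_slice[OF jn w'(1) boxfin] AE_slices[OF jn w'(3)] AE_space
  proof eventually_elim
    case (elim y)
    have fb: "fw_bound (slice_measure j w' y) A"
    proof (rule fw_bound_of_rational[OF elim(2)])
      fix a b :: real assume ab: "a \<in> \<rat>" "b \<in> \<rat>" "a < b"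
      show "(\<integral>\<^sup>+x\<in>{a..b}. local_maximal (slice_measure j w' y) a b x \<partial>lborel) \<le> ennreal A * emeasure (slice_measure j w' y) {a..b}"
        unfolding A_def
      proof (rule integral_local_maximal_le[OF elim(2) ab B \<beta> \<gamma>])
        fix \<K> m
        assume "finite \<K>" "\<K> \<subseteq> {J \<in> \<rat> \<times> \<rat>. fst J < snd J \<and> cint J \<subseteq> {a..b}}" "(1/2) ^ m < exp (- \<gamma>)"
          "len (Cover \<K>) < ennreal ((1/2) ^ m * (b - a))"
        then have "((a, b), \<K>, m) \<in> \<I>" using ab unfolding \<I>_def rint_def by (simp add: cint_def)
        from bspec[OF elim(1) this]
        show "emeasure (slice_measure j w' y) (Cover \<K>) \<le>
          ennreal (B * ((1/2) ^ m) powr (1 / \<beta>)) * emeasure (slice_measure j w' y) {a..b}"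
          by (simp add: cint_def)
      qed
    qed
    have eq: "fujii_wilson (\<lambda>t. w (y(j := t))) = (SUP I\<in>{I. fst I < snd I}. fw_quotient (slice_measure j w' y) I)"
      using fujii_wilson_cong_AE[OF elim(3)] fujii_wilson_slice[OF jn(2) w'(1,2) elim(4)] by simp
    then show ?case
      using fb SUP_fw_quotient_le_iff[OF elim(2) A0] SUP_fw_quotient_rational[OF elim(2)] by simp
  qed
  show "esssup (leb ?J) (\<lambda>y. fujii_wilson (\<lambda>t. w (y(j := t)))) \<le> ennreal (12 * \<beta> * (1 + max (\<gamma> / \<beta>) (ln B)))"
    unfolding A_def[symmetric]
  proof (rule esssup_I)
    show "(\<lambda>y. fujii_wilson (\<lambda>t. w (y(j := t)))) \<in> borel_measurable (leb ?J)"
      unfolding leb_def using fw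
      by (intro measurable_completion_AE[OF measurable_SUP_fw_quotient[OF jn w'(1)]]) (auto elim!: eventually_mono)
    show "AE y in leb ?J. fujii_wilson (\<lambda>t. w (y(j := t))) \<le> ennreal A"
      unfolding AE_leb_iff using fw by (auto elim!: eventually_mono)
  qed
qed

theorem theorem1p3:
  shows "\<exists>c::real. \<exists>C::real. \<exists>Cn::nat \<Rightarrow> real. c > 0 \<and> C > 0 \<and> (\<forall>n\<ge>1. Cn n > 0) \<and>
    (\<forall>n\<ge>1. \<forall>w. weight n w \<longrightarrow>
      (w \<in> strong_Ainf n \<longrightarrow>
        (let A = enn2real (strong_Ainf_const n w) in
          \<forall>\<alpha>::real. \<alpha> < 1 \<and> \<alpha> > 1 - exp (- (c * real n * A)) \<longrightarrow>
            tauberian n w \<alpha> - 1 \<le> ennreal (Cn n * (1 - \<alpha>) powr inverse (c * real n * A)))) \<and>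
      (\<forall>B \<beta> \<gamma>::real. B > 1 \<longrightarrow> \<beta> > 1 \<longrightarrow> \<gamma> > 0 \<longrightarrow>
        (\<forall>\<alpha>::real. \<alpha> < 1 \<and> \<alpha> > 1 - exp (- \<gamma>) \<longrightarrow>
            tauberian n w \<alpha> - 1 \<le> ennreal (B * (1 - \<alpha>) powr (1 / \<beta>))) \<longrightarrow>
        w \<in> strong_Ainf n \<and>
        enn2real (strong_Ainf_const n w) \<le> C * \<beta> * (1 + max (\<gamma> / \<beta>) (ln B))))"
proof (rule exI[of _ 144], rule exI[of _ 12], rule exI[of _ "\<lambda>n. 9 ^ n"], intro conjI allI impI)
  fix n :: nat and w :: "(nat \<Rightarrow> real) \<Rightarrow> real"
  assume n: "1 \<le> n" and w: "weight n w"
  show "let A = enn2real (strong_Ainf_const n w) in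
          \<forall>\<alpha>::real. \<alpha> < 1 \<and> \<alpha> > 1 - exp (- (144 * real n * A)) \<longrightarrow>
            tauberian n w \<alpha> - 1 \<le> ennreal (9 ^ n * (1 - \<alpha>) powr inverse (144 * real n * A))"
    if "w \<in> strong_Ainf n"
    unfolding Let_def using tauberian_le_of_strong_Ainf[OF n that refl] by blast
  fix B \<beta> \<gamma> :: real
  assume B: "B > 1" "\<beta> > 1" "\<gamma> > 0" and
    H: "\<forall>\<alpha>::real. \<alpha> < 1 \<and> \<alpha> > 1 - exp (- \<gamma>) \<longrightarrow> tauberian n w \<alpha> - 1 \<le> ennreal (B * (1 - \<alpha>) powr (1 / \<beta>))"
  have le: "strong_Ainf_const n w \<le> ennreal (12 * \<beta> * (1 + max (\<gamma> / \<beta>) (ln B)))"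
    using H by (intro strong_Ainf_const_le_of_tauberian[OF w B]) blast
  then show "w \<in> strong_Ainf n" using w by (auto simp: strong_Ainf_def intro: le_less_trans)
  have "0 \<le> 12 * \<beta> * (1 + max (\<gamma> / \<beta>) (ln B))"
    using B by (intro mult_nonneg_nonneg add_nonneg_nonneg) (auto simp: le_max_iff_disj)
  then show "enn2real (strong_Ainf_const n w) \<le> 12 * \<beta> * (1 + max (\<gamma> / \<beta>) (ln B))"
    using le by (intro enn2real_leI)
qed simp_all

end
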